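(* Let $\mathfrak X$ be a Banach space and let $\dot{\mathbf A}(\mathbb R^n;\mathfrak X)$ be a homogeneous $(d,e,f)$-discretizable space for some real parameters $(d,e,f)$, with associated sequence space $\dot{\mathbf a}(\mathbb R^n;\mathfrak X)$. If $N\in\mathbb N$ satisfies $N>\max\{e,f\}-\frac n2$ and $\{\Psi_\omega\}_{\omega\in\Omega_n}$ is a Daubechies wavelet system of order $N$, then every $g\in\dot{\mathbf A}(\mathbb R^n;\mathfrak X)$ has a series representation $$g=\sum_{\omega\in\Omega_n}\langle g,\Psi_\omega\rangle\Psi_\omega$$ convergent in $\mathscr S'_\infty(\mathbb R^n;\mathfrak X)$, and $$\|g\|_{\dot{\mathbf A}(\mathbb R^n;\mathfrak X)}\approx\sum_{\lambda\in\Lambda_n}\big\|\{\langle g,\Psi^{(\lambda)}_Q\rangle\}_{Q\in\mathscr D}\big\|_{\dot{\mathbf a}(\mathbb R^n;\mathfrak X)},$$ where the positive equivalence constants are independent of $g$.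
   Context: Basic notation. $\mathscr S_\infty$: Schwartz functions on $\mathbb R^n$ with all moments vanishing; $\mathscr S'_\infty(\mathbb R^n;\mathfrak X)$: continuous linear maps $\mathscr S_\infty\to\mathfrak X$; $\mathscr S_\infty\otimes\mathfrak X$: finite sums $\sum_kf_k\mathfrak e_k$, $f_k\in\mathscr S_\infty$, $\mathfrak e_k\in\mathfrak X$. $\mathscr D$: dyadic cubes $2^{-j}([0,1)^n+k)$, $j\in\mathbb Z$, $k\in\mathbb Z^n$; $\ell(Q)$ side length, $x_Q$ lower-left vertex. $\varphi\in\mathscr S(\mathbb R^n)$ is a Littlewood--Paley function if, for some $\sqrt2<\alpha<\beta<\pi$, $c\,\mathbf 1_{[1/\alpha,\alpha]}(|\xi|)\le|\hat\varphi(\xi)|\le C\,\mathbf 1_{[1/\beta,\beta]}(|\xi|)$ for some $c,C>0$ (with $\hat\varphi(\xi)=\int\varphi(x)e^{-ix\cdot\xi}dx$). For a function $\theta$, $\theta_Q(x):=|Q|^{-1/2}\theta((x-x_Q)/\ell(Q))$. $S_\varphi g:=\{\langle g,\varphi_Q\rangle\}_{Q\in\mathscr D}$, $T_\psi t:=\sum_{Q\in\mathscr D}t_Q\psi_Q$ (convergence in $\mathscr S_\infty'(\mathbb R^n;\mathfrak X)$). Condition (LP) for a pair of Littlewood--Paley functions $\varphi,\psi$: $\sum_{j\in\mathbb Z}\hat\varphi(-2^j\xi)\hat\psi(2^j\xi)=1$ for all $\xi\ne0$. Almost diagonal operators. A scalar matrix $B=\{b_{QR}\}_{Q,R\in\mathscr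 D}$ is $(D,E,F)$-almost diagonal if there is $C<\infty$ with $|b_{QR}|\le C\big(1+\frac{\ell(R)}{\ell(Q)}\big)^{-E}\big(1+\frac{\ell(Q)}{\ell(R)}\big)^{-F}\big(1+\frac{|x_Q-x_R|}{\max\{\ell(Q),\ell(R)\}}\big)^{-D}$ for all $Q,R$; $(Bt)_Q:=\sum_Rb_{QR}t_R$. Discretizable spaces. A quasi-normed space $\dot{\mathbf A}(\mathbb R^n;\mathfrak X)\subset\mathscr S'_\infty(\mathbb R^n;\mathfrak X)$ is homogeneous $(d,e,f)$-discretizable ($d,e,f\in\mathbb R$) if: (1) $\mathscr S_\infty\otimes\mathfrak X\subset\dot{\mathbf A}(\mathbb R^n;\mathfrak X)$; (2) there is a quasi-normed space $\dot{\mathbf a}(\mathbb R^n;\mathfrak X)$ of sequences $t=\{t_Q\}_{Q\in\mathscr D}$, $t_Q\in\mathfrak X$ (fixed as the associated sequence space), such that for any Littlewood--Paley functions $\varphi,\psi$ satisfying (LP), $S_\varphi:\dot{\mathbf A}\to\dot{\mathbf a}$ and $T_\psi:\dot{\mathbf a}\to\dot{\mathbf A}$ are bounded and $T_\psi\circ S_\varphi$ is the identity on $\dot{\mathbf A}$; (3) for all $D>d$, $E>e$, $F>f$ and any $(D,E,F)$-almost diagonal $B$, the series $\sum_Rb_{QR}t_R$ converges absolutely in $\mathfrak X$ for all $Q\in\mathscr D$ and $t\in\dot{\mathbf a}(\mathbb R^n;\mathfrak X)$, and $B$ is bounded on $\dot{\mathbf a}(\mathbb R^n;\mathfrak X)$.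 Daubechies wavelet system of order $N\in\mathbb N$. Take a univariate scaling function $\psi^{(0)}\in C_c^N(\mathbb R)$ and an associated univariate wavelet $\psi^{(1)}\in C_c^N(\mathbb R)$; for $\lambda\in\{0,1\}^n$ let $\Psi^{(\lambda)}(x):=\prod_{i=1}^n\psi^{(\lambda_i)}(x_i)$. With $\Lambda_n:=\{0,1\}^n\setminus\{\mathbf 0\}$, assume $\int x^\alpha\Psi^{(\lambda)}(x)\,dx=0$ for all $\lambda\in\Lambda_n$ and $|\alpha|\le N$. Let $\Psi^{(\lambda)}_Q(x):=|Q|^{-1/2}\Psi^{(\lambda)}((x-x_Q)/\ell(Q))$, $\Omega_n:=\Lambda_n\times\mathscr D$, and $\Psi_\omega:=\Psi_Q^{(\lambda)}$ for $\omega=(\lambda,Q)$; the functions are chosen so that $\{\Psi_\omega\}_{\omega\in\Omega_n}$ is a complete orthonormal basis of $L^2(\mathbb R^n)$. Pairing. For $g\in\dot{\mathbf A}(\mathbb R^n;\mathfrak X)$, $\langle g,\Psi_\omega\rangle:=\sum_{R\in\mathscr D}\langle g,\varphi_R\rangle\langle\psi_R,\Psi_\omega\rangle$ with Littlewood--Paley functions $\varphi,\psi$ satisfying (LP); under the assumption on $N$ this series converges absolutely and is independent of the choice of $\varphi,\psi$. *)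

theory Defs
  imports "HOL-Analysis.Analysis"
begin

section \<open>Complex Banach spaces and quasi-normed spaces\<close>

class complex_banach = banach +
  fixes scaleC :: "complex \<Rightarrow> 'a \<Rightarrow> 'a"  (infixr \<open>*\<^sub>C\<close> 75)
  assumes scaleC_add_right: "c *\<^sub>C (x + y) = c *\<^sub>C x + c *\<^sub>C y"
    and scaleC_add_left: "(c + d) *\<^sub>C x = c *\<^sub>C x + d *\<^sub>C x"
    and scaleC_scaleC: "c *\<^sub>C d *\<^sub>C x = (c * d) *\<^sub>C x"
    and scaleC_of_real: "complex_of_real r *\<^sub>C x = r *\<^sub>R x"
    and norm_scaleC: "norm (c *\<^sub>C x) = cmod c * norm x"

instantiation complex :: complex_banach
begin

definition scaleC_complex :: "complex \<Rightarrow> complex \<Rightarrow> complex"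
  where "scaleC_complex c x = c * x"

instance
  by standard (simp_all add: scaleC_complex_def algebra_simps norm_mult scaleR_conv_of_real)

end

text \<open>A quasi-normed space is given by its carrier, a complex linear space of \<open>'x\<close>-valued functions
  with the pointwise operations, and by a quasi-norm on this carrier.\<close>

definition quasi_normed_space :: "('i \<Rightarrow> 'x::complex_banach) set \<Rightarrow> (('i \<Rightarrow> 'x) \<Rightarrow> real) \<Rightarrow> bool" where
  "quasi_normed_space V q \<longleftrightarrow>
     (\<lambda>_. 0) \<in> V \<and>
     (\<forall>u\<in>V. \<forall>v\<in>V. (\<lambda>i. u i + v i) \<in> V) \<and>
     (\<forall>c. \<forall>v\<in>V. (\<lambda>i. c *\<^sub>C v i) \<in> V) \<and>
     (\<forall>v\<in>V. 0 \<le> q v) \<and>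
     (\<forall>v\<in>V. q v = 0 \<longleftrightarrow> v = (\<lambda>_. 0)) \<and>
     (\<forall>c. \<forall>v\<in>V. q (\<lambda>i. c *\<^sub>C v i) = cmod c * q v) \<and>
     (\<exists>K. \<forall>u\<in>V. \<forall>v\<in>V. q (\<lambda>i. u i + v i) \<le> K * (q u + q v))"


section \<open>Schwartz functions with vanishing moments, and their dual\<close>

definition monomial :: "('n::finite \<Rightarrow> nat) \<Rightarrow> real^'n \<Rightarrow> real" where
  "monomial \<alpha> x = (\<Prod>i\<in>UNIV. (x $ i) ^ \<alpha> i)"

definition partial_deriv :: "'n::finite \<Rightarrow> (real^'n \<Rightarrow> complex) \<Rightarrow> real^'n \<Rightarrow> complex" where
  "partial_deriv i f x = vector_derivative (\<lambda>t. f (x + t *\<^sub>R axis i 1)) (at 0)"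

text \<open>Higher partial derivatives are indexed by the list of the directions of differentiation rather
  than by a multi-index; on smooth functions the order is irrelevant.\<close>

definition partials :: "'n::finite list \<Rightarrow> (real^'n \<Rightarrow> complex) \<Rightarrow> real^'n \<Rightarrow> complex" where
  "partials is f = foldr partial_deriv is f"

definition schwartz :: "(real^'n::finite \<Rightarrow> complex) set" where
  "schwartz = {f. (\<forall>is x. partials is f differentiable (at x)) \<and>
                  (\<forall>\<alpha> is. bounded (range (\<lambda>x. monomial \<alpha> x *\<^sub>R partials is f x)))}"

definition schwartz_seminorm :: "('n::finite \<Rightarrow> nat) \<Rightarrow> 'n list \<Rightarrow> (real^'n \<Rightarrow> complex) \<Rightarrow> real" where
  "schwartz_seminorm \<alpha> is f = (SUP x. norm (monomial \<alpha> x *\<^sub>R partials is f x))"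

definition S_infty :: "(real^'n::finite \<Rightarrow> complex) set" where
  "S_infty = {f \<in> schwartz. \<forall>\<alpha>. (LINT x|lborel. monomial \<alpha> x *\<^sub>R f x) = 0}"

definition S_infty_topology :: "(real^'n::finite \<Rightarrow> complex) topology" where
  "S_infty_topology = topology_generated_by
     {{f \<in> S_infty. schwartz_seminorm \<alpha> is (\<lambda>x. f x - f0 x) < r} | \<alpha> is f0 r. f0 \<in> S_infty \<and> 0 < r}"

text \<open>A continuous linear map on \<open>S_infty\<close> is represented by its extension by zero to all functions,
  so that equality and the pointwise operations are those of maps on \<open>S_infty\<close>.\<close>

type_synonym ('n, 'x) distr = "(real^'n \<Rightarrow> complex) \<Rightarrow> 'x"

definition S_infty_dual :: "('n::finite, 'x::complex_banach) distr set" where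
  "S_infty_dual = {g.
     (\<forall>f. f \<notin> S_infty \<longrightarrow> g f = 0) \<and>
     (\<forall>f\<in>S_infty. \<forall>h\<in>S_infty. g (\<lambda>x. f x + h x) = g f + g h) \<and>
     (\<forall>c. \<forall>f\<in>S_infty. g (\<lambda>x. c * f x) = c *\<^sub>C g f) \<and>
     continuous_map S_infty_topology euclidean g}"

text \<open>Convergence in \<open>S_infty_dual\<close> is convergence on each test function; since the index sets carry
  no order, series converge unconditionally.\<close>

definition distr_has_sum :: "('i \<Rightarrow> ('n::finite, 'x::complex_banach) distr) \<Rightarrow> 'i set \<Rightarrow> ('n, 'x) distr \<Rightarrow> bool" where
  "distr_has_sum F I g \<longleftrightarrow> (\<forall>f\<in>S_infty. ((\<lambda>i. F i f) has_sum g f) I)"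

text \<open>The duality pairing is bilinear: in contrast to \<open>L2_inner\<close> below, there is no complex
  conjugation.\<close>

definition pair :: "(real^'n::finite \<Rightarrow> complex) \<Rightarrow> (real^'n \<Rightarrow> complex) \<Rightarrow> complex" where
  "pair f h = (LINT x|lborel. f x * h x)"

text \<open>The product of the scalar function \<open>\<theta>\<close> and the vector \<open>v\<close>, as a distribution.\<close>

definition distr_of :: "(real^'n::finite \<Rightarrow> complex) \<Rightarrow> 'x::complex_banach \<Rightarrow> ('n, 'x) distr" where
  "distr_of \<theta> v = (\<lambda>f. if f \<in> S_infty then pair \<theta> f *\<^sub>C v else 0)"

definition S_infty_tensor :: "('n::finite, 'x::complex_banach) distr set" where
  "S_infty_tensor = {\<lambda>f. \<Sum>k<m. distr_of (h k) (v k) f | (m::nat) h v. \<forall>k<m. h k \<in> S_infty}"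


section \<open>Dyadic cubes and Littlewood--Paley functions\<close>

text \<open>The pair \<open>(j, k)\<close> encodes the dyadic cube \<open>2\<^bsup>-j\<^esup>([0,1)\<^sup>n + k)\<close>; this encoding is bijective.\<close>

type_synonym 'n cube = "int \<times> (int^'n)"

definition side :: "'n::finite cube \<Rightarrow> real" where
  "side Q = 2 powi (- fst Q)"

definition corner :: "'n::finite cube \<Rightarrow> real^'n" where
  "corner Q = (\<chi> i. side Q * of_int (snd Q $ i))"

definition volume :: "'n::finite cube \<Rightarrow> real" where
  "volume Q = side Q ^ CARD('n)"

definition adapt :: "(real^'n::finite \<Rightarrow> complex) \<Rightarrow> 'n cube \<Rightarrow> real^'n \<Rightarrow> complex" where
  "adapt \<theta> Q x = (volume Q powr (- 1/2)) *\<^sub>R \<theta> ((x - corner Q) /\<^sub>R side Q)"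

definition fourier :: "(real^'n::finite \<Rightarrow> complex) \<Rightarrow> real^'n \<Rightarrow> complex" where
  "fourier f \<xi> = (LINT x|lborel. f x * exp (- \<i> * complex_of_real (x \<bullet> \<xi>)))"

definition littlewood_paley :: "(real^'n::finite \<Rightarrow> complex) \<Rightarrow> bool" where
  "littlewood_paley \<phi> \<longleftrightarrow> \<phi> \<in> schwartz \<and>
     (\<exists>\<alpha> \<beta> c C. sqrt 2 < \<alpha> \<and> \<alpha> < \<beta> \<and> \<beta> < pi \<and> 0 < c \<and> 0 < C \<and>
       (\<forall>\<xi>. c * indicat_real {1/\<alpha>..\<alpha>} (norm \<xi>) \<le> cmod (fourier \<phi> \<xi>) \<and>
            cmod (fourier \<phi> \<xi>) \<le> C * indicat_real {1/\<beta>..\<beta>} (norm \<xi>)))"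

definition LP_pair :: "(real^'n::finite \<Rightarrow> complex) \<Rightarrow> (real^'n \<Rightarrow> complex) \<Rightarrow> bool" where
  "LP_pair \<phi> \<psi> \<longleftrightarrow> littlewood_paley \<phi> \<and> littlewood_paley \<psi> \<and>
     (\<forall>\<xi>. \<xi> \<noteq> 0 \<longrightarrow>
       ((\<lambda>j::int. fourier \<phi> (- ((2 powi j) *\<^sub>R \<xi>)) * fourier \<psi> ((2 powi j) *\<^sub>R \<xi>)) has_sum 1) UNIV)"

definition analysis_op :: "(real^'n::finite \<Rightarrow> complex) \<Rightarrow> ('n, 'x::complex_banach) distr \<Rightarrow> 'n cube \<Rightarrow> 'x" where
  "analysis_op \<phi> g = (\<lambda>Q. g (adapt \<phi> Q))"

text \<open>The value is meaningful only if the series converges, which is required separately wherever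
  \<open>synthesis_op\<close> is used.\<close>

definition synthesis_op :: "(real^'n::finite \<Rightarrow> complex) \<Rightarrow> ('n cube \<Rightarrow> 'x::complex_banach) \<Rightarrow> ('n, 'x) distr" where
  "synthesis_op \<psi> t = (\<lambda>f. \<Sum>\<^sub>\<infinity>Q. distr_of (adapt \<psi> Q) (t Q) f)"


section \<open>Almost diagonal matrices and discretizable spaces\<close>

definition almost_diagonal :: "real \<Rightarrow> real \<Rightarrow> real \<Rightarrow> ('n::finite cube \<Rightarrow> 'n cube \<Rightarrow> complex) \<Rightarrow> bool" where
  "almost_diagonal D E F B \<longleftrightarrow> (\<exists>C. \<forall>Q R. cmod (B Q R) \<le>
     C * (1 + side R / side Q) powr (-E) * (1 + side Q / side R) powr (-F)
       * (1 + norm (corner Q - corner R) / max (side Q) (side R)) powr (-D))"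

definition matrix_op :: "('n::finite cube \<Rightarrow> 'n cube \<Rightarrow> complex) \<Rightarrow> ('n cube \<Rightarrow> 'x::complex_banach) \<Rightarrow> 'n cube \<Rightarrow> 'x" where
  "matrix_op B t = (\<lambda>Q. \<Sum>\<^sub>\<infinity>R. B Q R *\<^sub>C t R)"

text \<open>\<open>(A, nA)\<close> is the function space and \<open>(a, na)\<close> the associated sequence space.\<close>

definition discretizable ::
  "real \<Rightarrow> real \<Rightarrow> real \<Rightarrow> ('n::finite, 'x::complex_banach) distr set \<Rightarrow> (('n, 'x) distr \<Rightarrow> real) \<Rightarrow>
   ('n cube \<Rightarrow> 'x) set \<Rightarrow> (('n cube \<Rightarrow> 'x) \<Rightarrow> real) \<Rightarrow> bool" where
  "discretizable d e f A nA a na \<longleftrightarrow>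
     A \<subseteq> S_infty_dual \<and> quasi_normed_space A nA \<and>
     S_infty_tensor \<subseteq> A \<and>
     quasi_normed_space a na \<and>
     (\<forall>\<phi> \<psi>. LP_pair \<phi> \<psi> \<longrightarrow>
        (\<exists>C. \<forall>g\<in>A. analysis_op \<phi> g \<in> a \<and> na (analysis_op \<phi> g) \<le> C * nA g) \<and>
        (\<forall>t\<in>a. distr_has_sum (\<lambda>Q. distr_of (adapt \<psi> Q) (t Q)) UNIV (synthesis_op \<psi> t)) \<and>
        (\<exists>C. \<forall>t\<in>a. synthesis_op \<psi> t \<in> A \<and> nA (synthesis_op \<psi> t) \<le> C * na t) \<and>
        (\<forall>g\<in>A. synthesis_op \<psi> (analysis_op \<phi> g) = g)) \<and>
     (\<forall>D E F B. d < D \<longrightarrow> e < E \<longrightarrow> f < F \<longrightarrow> almost_diagonal D E F B \<longrightarrow>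
        (\<forall>t\<in>a. \<forall>Q. (\<lambda>R. B Q R *\<^sub>C t R) abs_summable_on UNIV) \<and>
        (\<exists>C. \<forall>t\<in>a. matrix_op B t \<in> a \<and> na (matrix_op B t) \<le> C * na t))"


section \<open>Orthonormal bases and multiresolution analyses\<close>

text \<open>Elements of \<open>L\<^sup>2\<close> are represented by Borel functions, without passing to classes modulo
  null sets; the closed subspaces below are nevertheless stable under changes on null sets.\<close>

definition L2 :: "('a::euclidean_space \<Rightarrow> complex) set" where
  "L2 = {f \<in> borel_measurable borel. integrable lborel (\<lambda>x. (cmod (f x))\<^sup>2)}"

definition L2_inner :: "('a::euclidean_space \<Rightarrow> complex) \<Rightarrow> ('a \<Rightarrow> complex) \<Rightarrow> complex" where
  "L2_inner f h = (LINT x|lborel. f x * cnj (h x))"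

definition L2_dist :: "('a::euclidean_space \<Rightarrow> complex) \<Rightarrow> ('a \<Rightarrow> complex) \<Rightarrow> real" where
  "L2_dist f h = sqrt (LINT x|lborel. (cmod (f x - h x))\<^sup>2)"

definition L2_closed_subspace :: "('a::euclidean_space \<Rightarrow> complex) set \<Rightarrow> bool" where
  "L2_closed_subspace V \<longleftrightarrow> V \<subseteq> L2 \<and> (\<lambda>_. 0) \<in> V \<and>
     (\<forall>f\<in>V. \<forall>h\<in>V. (\<lambda>x. f x + h x) \<in> V) \<and>
     (\<forall>c. \<forall>f\<in>V. (\<lambda>x. c * f x) \<in> V) \<and>
     (\<forall>f\<in>L2. (\<forall>\<epsilon>>0. \<exists>h\<in>V. L2_dist f h < \<epsilon>) \<longrightarrow> f \<in> V)"

definition orthonormal_basis ::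
  "('i \<Rightarrow> 'a::euclidean_space \<Rightarrow> complex) \<Rightarrow> 'i set \<Rightarrow> ('a \<Rightarrow> complex) set \<Rightarrow> bool" where
  "orthonormal_basis b I V \<longleftrightarrow>
     (\<forall>i\<in>I. b i \<in> V) \<and>
     (\<forall>i\<in>I. \<forall>j\<in>I. L2_inner (b i) (b j) = (if i = j then 1 else 0)) \<and>
     (\<forall>f\<in>V. ((\<lambda>K. L2_dist f (\<lambda>x. \<Sum>i\<in>K. L2_inner f (b i) * b i x)) \<longlongrightarrow> 0) (finite_subsets_at_top I))"

definition multiresolution_analysis :: "(int \<Rightarrow> (real \<Rightarrow> complex) set) \<Rightarrow> (real \<Rightarrow> complex) \<Rightarrow> bool" where
  "multiresolution_analysis V s \<longleftrightarrow>
     (\<forall>j. L2_closed_subspace (V j)) \<and>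
     (\<forall>j. V j \<subseteq> V (j + 1)) \<and>
     (\<forall>j f. f \<in> V j \<longleftrightarrow> (\<lambda>x. f (2 * x)) \<in> V (j + 1)) \<and>
     (\<Inter>j. V j) = {f \<in> L2. AE x in lborel. f x = 0} \<and>
     (\<forall>f\<in>L2. \<forall>\<epsilon>>0. \<exists>j. \<exists>h\<in>V j. L2_dist f h < \<epsilon>) \<and>
     orthonormal_basis (\<lambda>k::int. \<lambda>x. s (x - of_int k)) UNIV (V 0)"

text \<open>\<open>w\<close> is a wavelet associated with the scaling function \<open>s\<close>: its integer translates form an
  orthonormal basis of the orthogonal complement of \<open>V 0\<close> in \<open>V 1\<close>.\<close>

definition scaling_wavelet_pair :: "(real \<Rightarrow> complex) \<Rightarrow> (real \<Rightarrow> complex) \<Rightarrow> bool" where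
  "scaling_wavelet_pair s w \<longleftrightarrow> (\<exists>V. multiresolution_analysis V s \<and>
     orthonormal_basis (\<lambda>k::int. \<lambda>x. w (x - of_int k)) UNIV
       {f \<in> V 1. \<forall>h\<in>V 0. L2_inner f h = 0})"


section \<open>Daubechies wavelets\<close>

definition Cc :: "nat \<Rightarrow> (real \<Rightarrow> real) set" where
  "Cc N = {f. (\<forall>k<N. \<forall>x. (deriv ^^ k) f differentiable (at x)) \<and>
              continuous_on UNIV ((deriv ^^ N) f) \<and> compact (closure {x. f x \<noteq> 0})}"

definition wavelet_types :: "('n::finite \<Rightarrow> bool) set" where
  "wavelet_types = UNIV - {\<lambda>_. False}"

definition wavelet_indices :: "(('n::finite \<Rightarrow> bool) \<times> 'n cube) set" where
  "wavelet_indices = wavelet_types \<times> UNIV"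

definition wavelet_product :: "(real \<Rightarrow> real) \<Rightarrow> (real \<Rightarrow> real) \<Rightarrow> ('n::finite \<Rightarrow> bool) \<Rightarrow> real^'n \<Rightarrow> complex" where
  "wavelet_product s w l x = complex_of_real (\<Prod>i\<in>UNIV. (if l i then w else s) (x $ i))"

text \<open>The scaling function and the wavelet are real-valued, so that expansions with respect to the
  bilinear pairing agree with those with respect to the inner product of \<open>L\<^sup>2\<close>.\<close>

definition daubechies_system :: "nat \<Rightarrow> (('n::finite \<Rightarrow> bool) \<Rightarrow> real^'n \<Rightarrow> complex) \<Rightarrow> bool" where
  "daubechies_system N \<Psi> \<longleftrightarrow> (\<exists>s w.
     s \<in> Cc N \<and> w \<in> Cc N \<and>
     scaling_wavelet_pair (\<lambda>x. complex_of_real (s x)) (\<lambda>x. complex_of_real (w x)) \<and>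
     \<Psi> = wavelet_product s w \<and>
     (\<forall>l\<in>wavelet_types. \<forall>\<alpha>. (\<Sum>i\<in>UNIV. \<alpha> i) \<le> N \<longrightarrow>
        (LINT x|lborel. monomial \<alpha> x *\<^sub>R \<Psi> l x) = 0) \<and>
     orthonormal_basis (\<lambda>(l, Q). adapt (\<Psi> l) Q) wavelet_indices L2)"

text \<open>The pairing of a distribution \<open>g\<close> with a function \<open>\<theta>\<close> outside \<open>S_infty\<close>, computed by means of the
  pair \<open>\<phi>, \<psi>\<close>; for the functions of interest, the value does not depend on this pair.\<close>

definition distr_pair ::
  "(real^'n::finite \<Rightarrow> complex) \<Rightarrow> (real^'n \<Rightarrow> complex) \<Rightarrow> ('n, 'x::complex_banach) distr \<Rightarrow> (real^'n \<Rightarrow> complex) \<Rightarrow> 'x" where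
  "distr_pair \<phi> \<psi> g \<theta> = (\<Sum>\<^sub>\<infinity>R. pair (adapt \<psi> R) \<theta> *\<^sub>C g (adapt \<phi> R))"

end

theory Submission
  imports Defs
begin

text \<open>Since \<open>\<psi>\<close> and the wavelets have cancellation, the matrices \<open>pair (adapt \<psi> R) (adapt (\<Psi> l) Q)\<close> are almost
  diagonal with \<open>E = F = N + n/2\<close> and arbitrarily large \<open>D\<close>; hence the wavelet coefficients of \<open>g\<close>, which are
  the images under these matrices of the coefficients of \<open>g\<close> with respect to \<open>\<phi>\<close>, lie in \<open>a\<close>. To test the
  wavelet series against \<open>h\<close> one has to exchange two vector-valued sums and to apply the Parseval identity of
  the wavelet basis to \<open>adapt \<psi> R\<close> and \<open>h\<close>. The double family need not be absolutely summable, but it is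
  unconditionally summable: replacing arbitrary entries of an almost diagonal matrix by zero keeps it almost
  diagonal, and the coefficients of \<open>h\<close> form a row of another almost diagonal matrix, so that all masked
  iterated sums converge absolutely. Testing the expansion against \<open>adapt \<phi> R\<close> expresses the coefficients of \<open>g\<close>
  with respect to \<open>\<phi>\<close> by the wavelet coefficients, again through almost diagonal matrices; this gives the upper
  bound of the norm of \<open>g\<close>.\<close>

section \<open>Unconditional summability and scalar multiplication\<close>

text \<open>The exponent N + n/2 is what turns the hypothesis on \<open>N\<close> into e, f < E = F.
  The normalisation |Q|^(-1/2) yields the ratio of the smaller to the larger side to the power n/2,
  and cancellation yields the power N in both directions: on the smaller cube \<open>\<psi>\<close>
  has all moments zero and the smoothness of the wavelet limits the gain, while on the smaller cube
  the wavelet has moments only up to order \<open>N\<close>. Since d is arbitrary, D has to be as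
  large as one likes; this comes from the rapid decay of both functions.

  The obstacle is that \<open>a\<close> is an abstract quasi-normed space of sequences. It is not
  assumed to be a lattice, to be complete, or to contain finite sequences densely, so one can
  neither pass to norms of entries nor approximate by finite sums. The one available tool is the
  action of almost diagonal matrices on \<open>a\<close>, including the absolute convergence of each
  single row. This is why masked matrices take the place of a dominating series.\<close>

lemma abs_summable_on_tail:
  fixes f :: "'a \<Rightarrow> 'b::real_normed_vector"
  assumes "f abs_summable_on A" "0 < e"
  obtains F0 where "finite F0" "F0 \<subseteq> A"
    "\<And>F. finite F \<Longrightarrow> F \<subseteq> A \<Longrightarrow> F \<inter> F0 = {} \<Longrightarrow> (\<Sum>x\<in>F. norm (f x)) < e"
proof -
  obtain F0 where F0: "finite F0" "F0 \<subseteq> A"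
    and le: "dist (\<Sum>x\<in>F0. norm (f x)) (\<Sum>\<^sub>\<infinity>x\<in>A. norm (f x)) \<le> e / 2"
    using infsum_finite_approximation[OF assms(1), of "e/2"] assms(2) by auto
  have "(\<Sum>x\<in>F. norm (f x)) < e" if F: "finite F" "F \<subseteq> A" "F \<inter> F0 = {}" for F
  proof -
    have "(\<Sum>x\<in>F \<union> F0. norm (f x)) \<le> (\<Sum>\<^sub>\<infinity>x\<in>A. norm (f x))"
      using F F0 assms(1) by (intro finite_sum_le_infsum) auto
    moreover have "(\<Sum>x\<in>F \<union> F0. norm (f x)) = (\<Sum>x\<in>F. norm (f x)) + (\<Sum>x\<in>F0. norm (f x))"
      using F F0 by (intro sum.union_disjoint) auto
    ultimately show ?thesis
      using le assms(2) unfolding dist_real_def by linarith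
  qed
  with F0 show ?thesis using that by blast
qed

text \<open>Two finite sets containing \<open>F0\<close> differ from it by sets disjoint from
  \<open>F0\<close>, so both partial sums are within e/2 of the sum over \<open>F0\<close>;
  completeness then provides the limit.\<close>

lemma summable_on_Cauchy:
  fixes f :: "'a \<Rightarrow> 'b::banach"
  assumes "\<And>e. 0 < e \<Longrightarrow> \<exists>F0. finite F0 \<and> F0 \<subseteq> A \<and>
    (\<forall>F. finite F \<and> F \<subseteq> A \<and> F \<inter> F0 = {} \<longrightarrow> norm (sum f F) < e)"
  shows "f summable_on A"
proof -
  have "\<exists>P. eventually P (finite_subsets_at_top A) \<and>
              (\<forall>F F'. P F \<and> P F' \<longrightarrow> dist (sum f F) (sum f F') < e)" if "e > 0" for e :: real
  proof -
    obtain F0 where F0: "finite F0" "F0 \<subseteq> A"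
      and small: "\<And>F. finite F \<Longrightarrow> F \<subseteq> A \<Longrightarrow> F \<inter> F0 = {} \<Longrightarrow> norm (sum f F) < e/2"
      using assms[OF half_gt_zero[OF \<open>e > 0\<close>]] by metis
    define P where "P F \<longleftrightarrow> finite F \<and> F0 \<subseteq> F \<and> F \<subseteq> A" for F
    have "eventually P (finite_subsets_at_top A)"
      unfolding eventually_finite_subsets_at_top P_def using F0 by blast
    moreover have "dist (sum f F) (sum f F') < e" if "P F" "P F'" for F F'
    proof -
      have *: "dist (sum f G) (sum f F0) < e/2" if "P G" for G
      proof -
        have "sum f G - sum f F0 = sum f (G - F0)"
          using that F0 by (subst sum_diff) (auto simp: P_def)
        then show ?thesis
          using small[of "G - F0"] that by (auto simp: P_def dist_norm)
      qed
      show ?thesis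
        using *[OF \<open>P F\<close>] *[OF \<open>P F'\<close>] dist_triangle_half_l by blast
    qed
    ultimately show ?thesis by blast
  qed
  then have "cauchy_filter (filtermap (sum f) (finite_subsets_at_top A))"
    by (simp add: cauchy_filter_metric_filtermap)
  moreover have "complete (UNIV::'b set)"
    by (meson Cauchy_convergent UNIV_I complete_def convergent_def)
  ultimately obtain L where "(sum f \<longlongrightarrow> L) (finite_subsets_at_top A)"
    using complete_uniform[where S=UNIV] by (force simp add: filterlim_def)
  then show ?thesis
    using summable_on_def has_sum_def by blast
qed

text \<open>A gliding hump argument. No absolute summability of the double family is claimed: it may fail when
  \<open>'x\<close> has infinite dimension.\<close>

lemma summable_on_if_masked_iterated_sums:
  fixes x :: "'q \<Rightarrow> 'r \<Rightarrow> 'x::banach"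
  assumes row: "\<And>q. q \<in> I \<Longrightarrow> x q abs_summable_on UNIV"
    and masked: "\<And>S. (\<lambda>q. \<Sum>\<^sub>\<infinity>r. if (q, r) \<in> S then x q r else 0) abs_summable_on I"
  shows "(\<lambda>(q, r). x q r) summable_on I \<times> UNIV"
proof (rule summable_on_Cauchy, rule ccontr)
  fix e :: real
  assume "0 < e"
  let ?f = "\<lambda>(q, r). x q r"
  assume "\<not> (\<exists>F0. finite F0 \<and> F0 \<subseteq> I \<times> UNIV \<and>
    (\<forall>F. finite F \<and> F \<subseteq> I \<times> UNIV \<and> F \<inter> F0 = {} \<longrightarrow> norm (sum ?f F) < e))"
  then have bad: "\<exists>F. finite F \<and> F \<subseteq> I \<times> UNIV \<and> F \<inter> F0 = {} \<and> e \<le> norm (sum ?f F)"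
    if "finite F0" "F0 \<subseteq> I \<times> UNIV" for F0
    using that by (meson not_le)
  \<comment> \<open>A bad block exists off any finite set \<open>K\<close> of rows: these rows
    together are absolutely summable, so entries avoiding a finite set \<open>F0\<close> contribute
    less than e/2 there, and at least e/2 is left for the other rows.\<close>
  have "\<exists>F. finite F \<and> F \<subseteq> I \<times> UNIV \<and> fst ` F \<inter> K = {} \<and> e / 2 \<le> norm (sum ?f F)"
    if K: "finite K" "K \<subseteq> I" for K
  proof -
    have "?f abs_summable_on K \<times> UNIV"
      using K row by (intro iffD2[OF Infinite_Sum.abs_summable_on_Sigma_iff]) (auto simp: subset_iff)
    then obtain F0 where F0: "finite F0" "F0 \<subseteq> K \<times> UNIV"
      and small: "\<And>F. finite F \<Longrightarrow> F \<subseteq> K \<times> UNIV \<Longrightarrow> F \<inter> F0 = {} \<Longrightarrow> (\<Sum>p\<in>F. norm (?f p)) < e/2"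
      using abs_summable_on_tail[of ?f "K \<times> UNIV" "e/2"] \<open>0 < e\<close> by auto
    obtain F where F: "finite F" "F \<subseteq> I \<times> UNIV" "F \<inter> F0 = {}" "e \<le> norm (sum ?f F)"
      using bad[of F0] F0 K by blast
    let ?G = "F \<inter> K \<times> UNIV" and ?H = "F - K \<times> UNIV"
    have "sum ?f F = sum ?f ?G + sum ?f ?H"
      using F by (metis sum.Int_Diff)
    moreover have "norm (sum ?f ?G) < e/2"
      using small[of ?G] F norm_sum[of ?f ?G] by fastforce
    moreover have "norm (sum ?f ?G + sum ?f ?H) \<le> norm (sum ?f ?G) + norm (sum ?f ?H)"
      by (rule norm_triangle_ineq)
    ultimately have "e / 2 \<le> norm (sum ?f ?H)"
      using F(4) by (auto simp: case_prod_unfold)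
    then show ?thesis
      using F by (intro exI[of _ ?H]) (auto simp: case_prod_unfold)
  qed
  then obtain F where F: "\<And>K. finite K \<Longrightarrow> K \<subseteq> I \<Longrightarrow>
      finite (F K) \<and> F K \<subseteq> I \<times> UNIV \<and> fst ` F K \<inter> K = {} \<and> e / 2 \<le> norm (sum ?f (F K))"
    by metis
  \<comment> \<open>\<open>K n\<close> collects the rows used by the first n blocks, so the blocks
    \<open>G n\<close>, chosen off \<open>K n\<close>, occupy pairwise disjoint sets of
    rows.\<close>
  define K where "K = rec_nat {} (\<lambda>_ K. K \<union> fst ` F K)"
  have K_Suc: "K (Suc n) = K n \<union> fst ` F (K n)" for n
    by (simp add: K_def)
  have K: "finite (K n) \<and> K n \<subseteq> I" for n
  proof (induction n)
    case (Suc n)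
    then show ?case
      using F[of "K n"] by (auto simp: K_Suc)
  qed (auto simp: K_def)
  define G where "G n = F (K n)" for n
  have G: "finite (G n)" "G n \<subseteq> I \<times> UNIV" "fst ` G n \<inter> K n = {}" "e / 2 \<le> norm (sum ?f (G n))" for n
    using F[of "K n"] K[of n] by (auto simp: G_def)
  have mono: "K m \<subseteq> K n" if "m \<le> n" for m n
    by (rule lift_Suc_mono_le[OF _ that]) (auto simp: K_Suc)
  have sub: "fst ` G m \<subseteq> K n" if "m < n" for m n
    using mono[of "Suc m" n] that by (auto simp: K_Suc G_def Suc_le_eq)
  have disj: "fst ` G m \<inter> fst ` G n = {}" if "m \<noteq> n" for m n
    using that sub[of m n] sub[of n m] G(3)[of m] G(3)[of n] by (cases m n rule: linorder_cases) blast+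
  define S where "S = (\<Union>n. G n)"
  define y where "y q = (\<Sum>\<^sub>\<infinity>r. if (q, r) \<in> S then x q r else 0)" for q
  \<comment> \<open>A row of block n meets no other block, so masking by \<open>S\<close> leaves
    exactly the entries of block n in it. Hence the masked row sums over the rows of the block add
    up to the sum over the block.\<close>
  have block: "e / 2 \<le> (\<Sum>q\<in>fst ` G n. norm (y q))" for n
  proof -
    have y: "y q = (\<Sum>r\<in>{r. (q, r) \<in> G n}. x q r)" if "q \<in> fst ` G n" for q
    proof -
      have "(q, r) \<in> S \<longleftrightarrow> (q, r) \<in> G n" for r
      proof
        assume "(q, r) \<in> S"
        then obtain m where m: "(q, r) \<in> G m" by (auto simp: S_def)
        then have "q \<in> fst ` G m" by force
        then have "m = n" using disj[of m n] that by blast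
        then show "(q, r) \<in> G n" using m by simp
      qed (auto simp: S_def)
      then have "y q = (\<Sum>\<^sub>\<infinity>r. if (q, r) \<in> G n then x q r else 0)"
        by (simp add: y_def)
      also have "\<dots> = (\<Sum>\<^sub>\<infinity>r\<in>{r. (q, r) \<in> G n}. x q r)"
        by (rule infsum_cong_neutral) auto
      also have "\<dots> = (\<Sum>r\<in>{r. (q, r) \<in> G n}. x q r)"
      proof (rule infsum_finite)
        have "{r. (q, r) \<in> G n} \<subseteq> snd ` G n" by force
        then show "finite {r. (q, r) \<in> G n}"
          using G(1)[of n] finite_subset by blast
      qed
      finally show ?thesis .
    qed
    have fin: "finite {r. (q, r) \<in> G n}" for q
      using finite_subset[of "{r. (q, r) \<in> G n}" "snd ` G n"] G(1)[of n] by force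
    have "sum ?f (G n) = sum ?f (SIGMA q:fst ` G n. {r. (q, r) \<in> G n})"
      by (rule arg_cong[of _ _ "sum ?f"]) force
    also have "\<dots> = (\<Sum>q\<in>fst ` G n. \<Sum>r\<in>{r. (q, r) \<in> G n}. x q r)"
      using G(1)[of n] fin by (subst sum.Sigma) auto
    also have "\<dots> = (\<Sum>q\<in>fst ` G n. y q)"
      by (rule sum.cong) (auto simp: y)
    finally show ?thesis
      using G(4)[of n] norm_sum[of y "fst ` G n"] by simp
  qed
  have "y abs_summable_on I"
    using masked[of S] by (simp add: y_def)
  then obtain F0 where F0: "finite F0" "F0 \<subseteq> I"
    and small: "\<And>F. finite F \<Longrightarrow> F \<subseteq> I \<Longrightarrow> F \<inter> F0 = {} \<Longrightarrow> (\<Sum>q\<in>F. norm (y q)) < e/2"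
    by (rule abs_summable_on_tail[OF _ half_gt_zero[OF \<open>0 < e\<close>]]) (rule that; simp)
  \<comment> \<open>Infinitely many disjoint sets of rows cannot all meet the finite set
    \<open>F0\<close>; a block that misses it contradicts the smallness of the tail of
    \<open>y\<close>.\<close>
  have "\<exists>n. fst ` G n \<inter> F0 = {}"
  proof (rule ccontr)
    assume "\<not> ?thesis"
    then have "\<forall>n. \<exists>q. q \<in> fst ` G n \<and> q \<in> F0"
      by blast
    then obtain p where p: "\<forall>n. p n \<in> fst ` G n \<and> p n \<in> F0"
      using choice[of "\<lambda>n q. q \<in> fst ` G n \<and> q \<in> F0"] by blast
    have "inj p"
    proof (rule injI, rule ccontr)
      fix m n assume "p m = p n" "m \<noteq> n"
      then show False
        using p[rule_format, of m] p[rule_format, of n] disj[of m n] by auto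
    qed
    moreover have "finite (range p)"
      using p F0 by (intro finite_subset[of "range p" F0]) auto
    ultimately show False
      using range_inj_infinite by blast
  qed
  then obtain n where n: "fst ` G n \<inter> F0 = {}" by blast
  have "fst ` G n \<subseteq> I"
    using G(2)[of n] by auto
  then have "(\<Sum>q\<in>fst ` G n. norm (y q)) < e / 2"
    using G(1)[of n] n by (intro small) auto
  then show False
    using block[of n] by simp
qed

section \<open>Complex scalars and finite sums in quasi-normed spaces\<close>

lemma bounded_linear_scaleC_right: "bounded_linear (\<lambda>x::'x::complex_banach. c *\<^sub>C x)"
proof (rule bounded_linear_intro)
  fix r :: real and x :: 'x
  show "c *\<^sub>C r *\<^sub>R x = r *\<^sub>R c *\<^sub>C x"
    by (metis mult.commute scaleC_of_real scaleC_scaleC)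
  show "norm (c *\<^sub>C x) \<le> norm x * cmod c"
    by (simp add: norm_scaleC mult.commute)
qed (rule scaleC_add_right)

lemma bounded_linear_scaleC_left: "bounded_linear (\<lambda>c. c *\<^sub>C (x::'x::complex_banach))"
proof (rule bounded_linear_intro)
  fix r :: real and c
  show "(r *\<^sub>R c) *\<^sub>C x = r *\<^sub>R c *\<^sub>C x"
    by (metis scaleC_of_real scaleC_scaleC scaleR_conv_of_real)
  show "norm (c *\<^sub>C x) \<le> norm c * norm x"
    by (simp add: norm_scaleC)
qed (rule scaleC_add_left)

lemma scaleC_zero_left [simp]: "0 *\<^sub>C (x::'x::complex_banach) = 0"
  using linear_0[OF bounded_linear.linear[OF bounded_linear_scaleC_left]] .

text \<open>Every step of the induction applies the quasi-triangle inequality once more, so the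
  constant grows with the number of summands but is independent of the summands. It will be applied
  to the finitely many wavelet types.\<close>

lemma quasi_normed_space_sum:
  assumes V: "quasi_normed_space V q" and "finite F"
  shows "\<exists>K\<ge>0. \<forall>v. (\<forall>l\<in>F. v l \<in> V) \<longrightarrow> (\<lambda>i. \<Sum>l\<in>F. v l i) \<in> V \<and> q (\<lambda>i. \<Sum>l\<in>F. v l i) \<le> K * (\<Sum>l\<in>F. q (v l))"
  using assms(2)
proof induction
  case empty
  show ?case
    using V unfolding quasi_normed_space_def by (intro exI[of _ 0]) auto
next
  case (insert l F)
  obtain K where K: "\<And>u v. u \<in> V \<Longrightarrow> v \<in> V \<Longrightarrow> q (\<lambda>i. u i + v i) \<le> K * (q u + q v)"
    and add: "\<And>u v. u \<in> V \<Longrightarrow> v \<in> V \<Longrightarrow> (\<lambda>i. u i + v i) \<in> V"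
    and nonneg: "\<And>v. v \<in> V \<Longrightarrow> 0 \<le> q v"
    using V unfolding quasi_normed_space_def by metis
  obtain L where L: "L \<ge> 0" "\<And>v. (\<forall>l\<in>F. v l \<in> V) \<Longrightarrow>
      (\<lambda>i. \<Sum>l\<in>F. v l i) \<in> V \<and> q (\<lambda>i. \<Sum>l\<in>F. v l i) \<le> L * (\<Sum>l\<in>F. q (v l))"
    using insert.IH by blast
  \<comment> \<open>\<open>quasi_normed_space\<close> puts no sign on the constant \<open>K\<close>,
    hence the absolute value.\<close>
  have "(\<lambda>i. v l i + (\<Sum>l\<in>F. v l i)) \<in> V \<and>
      q (\<lambda>i. v l i + (\<Sum>l\<in>F. v l i)) \<le> (\<bar>K\<bar> * (1 + L)) * (q (v l) + (\<Sum>l\<in>F. q (v l)))"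
    if v: "\<forall>l\<in>insert l F. v l \<in> V" for v
  proof -
    let ?s = "\<lambda>i. \<Sum>l\<in>F. v l i" and ?S = "\<Sum>l\<in>F. q (v l)"
    have s: "?s \<in> V" "q ?s \<le> L * ?S"
      using L(2)[of v] v by auto
    have "0 \<le> ?S" "0 \<le> q (v l)"
      using v nonneg by (auto intro: sum_nonneg)
    have "q (\<lambda>i. v l i + ?s i) \<le> K * (q (v l) + q ?s)"
      using K[of "v l" ?s] v s by auto
    also have "\<dots> \<le> \<bar>K\<bar> * (q (v l) + q ?s)"
      using nonneg[OF s(1)] \<open>0 \<le> q (v l)\<close> by (intro mult_right_mono) auto
    also have "\<dots> \<le> \<bar>K\<bar> * ((1 + L) * (q (v l) + ?S))"
    proof (rule mult_left_mono)
      have "0 \<le> L * q (v l)"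
        using L(1) \<open>0 \<le> q (v l)\<close> by simp
      then show "q (v l) + q ?s \<le> (1 + L) * (q (v l) + ?S)"
        using s(2) \<open>0 \<le> ?S\<close> by (simp add: algebra_simps)
    qed simp
    finally show ?thesis
      using add[of "v l" ?s] v s by (simp add: mult.assoc)
  qed
  then show ?case
    using insert.hyps L(1) by (intro exI[of _ "\<bar>K\<bar> * (1 + L)"]) auto
qed

section \<open>Rapidly decreasing functions\<close>

lemma lborel_integral_affine:
  fixes f :: "'a::euclidean_space \<Rightarrow> 'b::{banach, second_countable_topology}"
  assumes f: "f \<in> borel_measurable borel" and "c \<noteq> 0"
  shows "(LINT x|lborel. f x) = \<bar>c\<bar> ^ DIM('a) *\<^sub>R (LINT x|lborel. f (t + c *\<^sub>R x))"
proof -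
  have [measurable]: "f \<in> borel_measurable borel" by fact
  have "(LINT x|lborel. f x) = (LINT x|density (distr lborel borel (\<lambda>x. t + c *\<^sub>R x)) (\<lambda>_. \<bar>c\<bar> ^ DIM('a)). f x)"
    using lborel_affine[OF \<open>c \<noteq> 0\<close>, of t] by simp
  also have "\<dots> = (LINT x|distr lborel borel (\<lambda>x. t + c *\<^sub>R x). \<bar>c\<bar> ^ DIM('a) *\<^sub>R f x)"
    by (subst integral_density) auto
  also have "\<dots> = (LINT x|lborel. \<bar>c\<bar> ^ DIM('a) *\<^sub>R f (t + c *\<^sub>R x))"
    by (subst integral_distr) auto
  finally show ?thesis by simp
qed

text \<open>Where k \<le> |x| \<le> k + 1 the integrand is at most (k + 1)^(-n-2). Enlarging this
  shell to the ball of radius k + 1 costs the volume factor (k + 1)^n and leaves the convergent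
  series of (k + 1)^(-2); the exponent n + 2 pays for using balls instead of shells.\<close>

lemma integrable_inverse_power_norm:
  "integrable lborel (\<lambda>x::'a::euclidean_space. 1 / (1 + norm x) ^ (DIM('a) + 2))"
proof (rule integrableI_bounded)
  let ?n = "DIM('a)" and ?V = "unit_ball_vol (real DIM('a))"
  let ?g = "\<lambda>(k::nat) x::'a. ennreal (1 / (real k + 1) ^ (?n + 2)) * indicator (cball 0 (real k + 1)) x"
  have term_le_suminf: "G k \<le> (\<Sum>k. G k)" for G :: "nat \<Rightarrow> ennreal" and k
    using sum_le_suminf[of G "{k}"] by simp
  have "ennreal (norm (1 / (1 + norm x) ^ (?n + 2))) \<le> (\<Sum>k. ?g k x)" for x :: 'a
  proof -
    define k where "k = nat \<lfloor>norm x\<rfloor>"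
    have "real k = of_int \<lfloor>norm x\<rfloor>"
      by (simp add: k_def)
    then have k: "real k \<le> norm x" "norm x \<le> real k + 1"
      by linarith+
    have "ennreal (norm (1 / (1 + norm x) ^ (?n + 2))) \<le> ennreal (1 / (real k + 1) ^ (?n + 2))"
    proof (rule ennreal_leI)
      have "(real k + 1) ^ (?n + 2) \<le> (1 + norm x) ^ (?n + 2)"
        using k by (intro power_mono) auto
      moreover have "0 < (real k + 1) ^ (?n + 2)"
        by (intro zero_less_power) simp
      ultimately show "norm (1 / (1 + norm x) ^ (?n + 2)) \<le> 1 / (real k + 1) ^ (?n + 2)"
        by (simp add: frac_le del: power_Suc)
    qed
    also have "\<dots> = ?g k x"
      using k by (simp add: indicator_def del: power_Suc)
    also have "\<dots> \<le> (\<Sum>k. ?g k x)"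
      by (rule term_le_suminf)
    finally show ?thesis .
  qed
  then have "(\<integral>\<^sup>+x. ennreal (norm (1 / (1 + norm (x::'a)) ^ (?n + 2))) \<partial>lborel) \<le> (\<integral>\<^sup>+x. (\<Sum>k. ?g k x) \<partial>lborel)"
    by (intro nn_integral_mono)
  also have "\<dots> = (\<Sum>k. \<integral>\<^sup>+x. ?g k x \<partial>lborel)"
    by (intro nn_integral_suminf borel_measurable_times_ennreal borel_measurable_const borel_measurable_indicator) auto
  also have "\<dots> = (\<Sum>k. ennreal (?V / (real k + 1)\<^sup>2))"
  proof (rule suminf_cong)
    fix k :: nat
    have "(\<integral>\<^sup>+x. ?g k x \<partial>lborel) = ennreal (1 / (real k + 1) ^ (?n + 2)) * ennreal (?V * (real k + 1) ^ ?n)"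
      by (subst nn_integral_cmult_indicator) (auto simp: emeasure_cball)
    also have "\<dots> = ennreal (1 / (real k + 1) ^ (?n + 2) * (?V * (real k + 1) ^ ?n))"
      by (intro ennreal_mult[symmetric]) auto
    also have "1 / (real k + 1) ^ (?n + 2) * (?V * (real k + 1) ^ ?n) = ?V / (real k + 1)\<^sup>2"
    proof -
      have "real k + 1 \<noteq> 0" by simp
      then show ?thesis
        unfolding power_add by (simp add: field_simps)
    qed
    finally show "(\<integral>\<^sup>+x. ?g k x \<partial>lborel) = ennreal (?V / (real k + 1)\<^sup>2)" .
  qed
  also have "\<dots> < \<infinity>"
  proof -
    have "summable (\<lambda>k. 1 / (real (Suc k))\<^sup>2)"
      using inverse_power_summable[of 2, where 'a=real] summable_Suc_iff[of "\<lambda>k. 1 / (real k)\<^sup>2"]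
      by (simp add: inverse_eq_divide)
    then have "summable (\<lambda>k. ?V * (1 / (real (Suc k))\<^sup>2))"
      by (rule summable_mult)
    then have "summable (\<lambda>k. ?V / (real k + 1)\<^sup>2)"
      by (simp add: add.commute)
    then show ?thesis
      by (subst suminf_ennreal2) auto
  qed
  finally show "(\<integral>\<^sup>+x. ennreal (norm (1 / (1 + norm (x::'a)) ^ (?n + 2))) \<partial>lborel) < \<infinity>" .
qed simp

text \<open>Decay is separated from smoothness because it is needed both for derivatives of Schwartz
  functions and for wavelets, which have only \<open>N\<close> derivatives. The weights 1 + |x|
  replace the monomials of \<open>schwartz\<close> since they are submultiplicative under
  translations.\<close>

definition rapidly_decreasing :: "('a::real_normed_vector \<Rightarrow> 'b::real_normed_vector) \<Rightarrow> bool" where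
  "rapidly_decreasing f \<longleftrightarrow> (\<forall>m. \<exists>C. \<forall>x. (1 + norm x) ^ m * norm (f x) \<le> C)"

lemma rapidly_decreasing_bound:
  assumes "rapidly_decreasing f"
  obtains C where "0 \<le> C" "\<And>x. (1 + norm x) ^ m * norm (f x) \<le> C"
proof -
  obtain C where C: "\<And>x. (1 + norm x) ^ m * norm (f x) \<le> C"
    using assms unfolding rapidly_decreasing_def by blast
  moreover have "0 \<le> C"
    using C[of 0] by (meson norm_ge_zero add_nonneg_nonneg mult_nonneg_nonneg order_trans zero_le_one zero_le_power)
  ultimately show ?thesis using that by blast
qed

lemma rapidly_decreasing_dominated:
  assumes f: "rapidly_decreasing f" and g: "\<And>x. norm (g x) \<le> K * (1 + norm x) ^ k * norm (f x)"
  shows "rapidly_decreasing g"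
  unfolding rapidly_decreasing_def
proof
  fix m
  obtain C where C: "0 \<le> C" "\<And>x. (1 + norm x) ^ (m + k) * norm (f x) \<le> C"
    using rapidly_decreasing_bound[OF f] by blast
  have "(1 + norm x) ^ m * norm (g x) \<le> \<bar>K\<bar> * C" for x
  proof -
    have "norm (g x) \<le> \<bar>K\<bar> * ((1 + norm x) ^ k * norm (f x))"
      using g[of x] by (smt (verit) mult.assoc mult_right_mono mult_nonneg_nonneg norm_ge_zero zero_le_power abs_ge_self)
    then have "(1 + norm x) ^ m * norm (g x) \<le> (1 + norm x) ^ m * (\<bar>K\<bar> * ((1 + norm x) ^ k * norm (f x)))"
      by (intro mult_left_mono) auto
    also have "\<dots> = \<bar>K\<bar> * ((1 + norm x) ^ (m + k) * norm (f x))"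
      by (simp add: power_add)
    also have "\<dots> \<le> \<bar>K\<bar> * C"
      using C by (intro mult_left_mono) auto
    finally show ?thesis .
  qed
  then show "\<exists>C. \<forall>x. (1 + norm x) ^ m * norm (g x) \<le> C" by blast
qed

lemma rapidly_decreasing_affine:
  fixes f :: "'a::real_normed_vector \<Rightarrow> 'b::real_normed_vector"
  assumes f: "rapidly_decreasing f" and "r \<noteq> 0"
  shows "rapidly_decreasing (\<lambda>x. c *\<^sub>R f (r *\<^sub>R (x - a)))"
  unfolding rapidly_decreasing_def
proof
  fix m
  obtain C where C: "0 \<le> C" "\<And>x. (1 + norm x) ^ m * norm (f x) \<le> C"
    using rapidly_decreasing_bound[OF f] by blast
  \<comment> \<open>Solving y = r (x - a) for x gives |x| \<le> |a| + |y| / |r|.\<close>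
  define K where "K = 1 + norm a + 1 / \<bar>r\<bar>"
  have K: "1 + norm x \<le> K * (1 + norm (r *\<^sub>R (x - a)))" for x
  proof -
    let ?y = "r *\<^sub>R (x - a)"
    have "x = a + (1 / r) *\<^sub>R ?y"
      using \<open>r \<noteq> 0\<close> by simp
    then have "norm x \<le> norm a + norm ((1 / r) *\<^sub>R ?y)"
      by (metis norm_triangle_ineq)
    also have "\<dots> = norm a + 1 / \<bar>r\<bar> * norm ?y"
      by simp
    finally have "norm x \<le> norm a + 1 / \<bar>r\<bar> * norm ?y" .
    moreover have "0 \<le> 1 / \<bar>r\<bar>" "0 \<le> norm a * norm ?y" "0 \<le> norm ?y"
      by simp_all
    ultimately show ?thesis
      unfolding K_def distrib_left distrib_right by linarith
  qed
  have "(1 + norm x) ^ m * norm (c *\<^sub>R f (r *\<^sub>R (x - a))) \<le> \<bar>c\<bar> * (K ^ m * C)" for x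
  proof -
    let ?y = "r *\<^sub>R (x - a)"
    have "0 \<le> K"
      by (simp add: K_def)
    have "(1 + norm x) ^ m * norm (f ?y) \<le> (K * (1 + norm ?y)) ^ m * norm (f ?y)"
      using K by (intro mult_right_mono power_mono) auto
    also have "\<dots> = K ^ m * ((1 + norm ?y) ^ m * norm (f ?y))"
      by (simp add: power_mult_distrib)
    also have "\<dots> \<le> K ^ m * C"
      using C(2)[of ?y] \<open>0 \<le> K\<close> by (intro mult_left_mono zero_le_power)
    finally have "\<bar>c\<bar> * ((1 + norm x) ^ m * norm (f ?y)) \<le> \<bar>c\<bar> * (K ^ m * C)"
      by (intro mult_left_mono) auto
    then show ?thesis by (simp add: algebra_simps)
  qed
  then show "\<exists>C. \<forall>x. (1 + norm x) ^ m * norm (c *\<^sub>R f (r *\<^sub>R (x - a))) \<le> C" by blast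
qed

lemma rapidly_decreasing_integrable:
  fixes f :: "'a::euclidean_space \<Rightarrow> 'b::{banach, second_countable_topology}"
  assumes f: "rapidly_decreasing f" "f \<in> borel_measurable borel"
  shows "integrable lborel f"
proof -
  obtain C where C: "\<And>x. (1 + norm x) ^ (DIM('a) + 2) * norm (f x) \<le> C"
    using rapidly_decreasing_bound[OF f(1)] by blast
  have "integrable lborel (\<lambda>x::'a. C * (1 / (1 + norm x) ^ (DIM('a) + 2)))"
    by (intro integrable_mult_right integrable_inverse_power_norm)
  then show ?thesis
  proof (rule Bochner_Integration.integrable_bound)
    have "norm (f x) \<le> C * (1 / (1 + norm x) ^ (DIM('a) + 2))" for x
    proof -
      have "0 < (1 + norm x) ^ (DIM('a) + 2)"
        by (intro zero_less_power) (simp add: add_pos_nonneg)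
      then show ?thesis
        using C[of x] by (simp add: pos_le_divide_eq mult.commute del: power_Suc)
    qed
    then show "AE x in lborel. norm (f x) \<le> norm (C * (1 / (1 + norm x) ^ (DIM('a) + 2)))"
      by (intro always_eventually allI) (metis abs_ge_self order_trans real_norm_def)
  qed (use f(2) in simp)
qed

section \<open>Schwartz functions\<close>

lemma schwartz_differentiable: "f \<in> schwartz \<Longrightarrow> partials is f differentiable (at x)"
  by (simp add: schwartz_def)

lemma schwartz_measurable:
  assumes "f \<in> schwartz" shows "partials is f \<in> borel_measurable borel"
proof (rule borel_measurable_continuous_onI, rule continuous_at_imp_continuous_on, rule ballI)
  show "isCont (partials is f) x" for x
    using schwartz_differentiable[OF assms] by (rule differentiable_imp_continuous_within)
qed

lemma monomial_le: "\<bar>monomial \<alpha> x\<bar> \<le> (1 + norm x) ^ (\<Sum>i\<in>UNIV. \<alpha> i)"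
proof -
  have "\<bar>monomial \<alpha> x\<bar> = (\<Prod>i\<in>UNIV. \<bar>x $ i\<bar> ^ \<alpha> i)"
    by (simp add: monomial_def abs_prod power_abs)
  also have "\<dots> \<le> (\<Prod>i\<in>UNIV. (1 + norm x) ^ \<alpha> i)"
  proof (rule prod_mono, intro conjI)
    fix i
    have "\<bar>x $ i\<bar> \<le> 1 + norm x"
      using component_le_norm_cart[of x i] by linarith
    then show "\<bar>x $ i\<bar> ^ \<alpha> i \<le> (1 + norm x) ^ \<alpha> i"
      by (intro power_mono) auto
  qed simp
  also have "\<dots> = (1 + norm x) ^ (\<Sum>i\<in>UNIV. \<alpha> i)"
    by (simp add: power_sum)
  finally show ?thesis .
qed

text \<open>Pure powers of single coordinates suffice: at each x the largest coordinate satisfies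
  |x| \<le> n |x_k|, so (1 + |x|)^m is controlled by the monomials 1 and x_k^m. Since k depends on
  x, the bounds for all k are added.\<close>

lemma schwartz_rapidly_decreasing:
  assumes "f \<in> schwartz" shows "rapidly_decreasing (partials is f)"
  unfolding rapidly_decreasing_def
proof
  fix m
  let ?h = "partials is f" and ?n = "real CARD('a)"
  have bdd: "\<exists>B. \<forall>x. norm (monomial \<alpha> x *\<^sub>R ?h x) \<le> B" for \<alpha>
    using assms unfolding schwartz_def bounded_iff by auto
  obtain B where B: "\<And>\<alpha> x. norm (monomial \<alpha> x *\<^sub>R ?h x) \<le> B \<alpha>"
    using bdd by metis
  define e :: "'a \<Rightarrow> 'a \<Rightarrow> nat" where "e k i = (if i = k then m else 0)" for k i
  have e: "monomial (e k) x = (x $ k) ^ m" for k x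
  proof -
    have "monomial (e k) x = (\<Prod>i\<in>UNIV. if i = k then (x $ k) ^ m else 1)"
      unfolding monomial_def e_def by (rule prod.cong) auto
    then show ?thesis by simp
  qed
  have z: "monomial (\<lambda>_. 0) x = 1" for x :: "real^'a"
    by (simp add: monomial_def)
  have "(1 + norm x) ^ m * norm (?h x) \<le> 2 ^ m * (B (\<lambda>_. 0) + ?n ^ m * (\<Sum>k\<in>UNIV. B (e k)))" for x
  proof -
    have Bpos: "0 \<le> B \<alpha>" for \<alpha>
      using B[of \<alpha> x] norm_ge_zero order_trans by blast
    obtain k where k: "\<And>i. \<bar>x $ i\<bar> \<le> \<bar>x $ k\<bar>"
    proof -
      have "Max (range (\<lambda>i. \<bar>x $ i\<bar>)) \<in> range (\<lambda>i. \<bar>x $ i\<bar>)"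
        by (rule Max_in) auto
      then obtain k where "Max (range (\<lambda>i. \<bar>x $ i\<bar>)) = \<bar>x $ k\<bar>"
        by blast
      moreover have "\<bar>x $ i\<bar> \<le> Max (range (\<lambda>i. \<bar>x $ i\<bar>))" for i
        by (rule Max_ge) auto
      ultimately show ?thesis using that by metis
    qed
    have "norm x \<le> (\<Sum>i\<in>UNIV. \<bar>x $ i\<bar>)"
      by (rule norm_le_l1_cart)
    also have "\<dots> \<le> ?n * \<bar>x $ k\<bar>"
      using k by (intro order_trans[OF sum_bounded_above[of UNIV _ "\<bar>x $ k\<bar>"]]) auto
    finally have "norm x \<le> ?n * \<bar>x $ k\<bar>" .
    then have "1 + norm x \<le> 2 * max 1 (?n * \<bar>x $ k\<bar>)"
      by linarith
    then have "(1 + norm x) ^ m \<le> (2 * max 1 (?n * \<bar>x $ k\<bar>)) ^ m"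
      by (intro power_mono) auto
    also have "\<dots> = 2 ^ m * (max 1 (?n * \<bar>x $ k\<bar>)) ^ m"
      by (simp add: power_mult_distrib)
    also have "\<dots> \<le> 2 ^ m * (1 + ?n ^ m * \<bar>x $ k\<bar> ^ m)"
      by (intro mult_left_mono) (auto simp: max_def power_mult_distrib)
    finally have "(1 + norm x) ^ m * norm (?h x) \<le> 2 ^ m * (1 + ?n ^ m * \<bar>x $ k\<bar> ^ m) * norm (?h x)"
      by (intro mult_right_mono) auto
    also have "\<dots> = 2 ^ m * (norm (?h x) + ?n ^ m * (\<bar>x $ k\<bar> ^ m * norm (?h x)))"
      by (simp add: algebra_simps)
    also have "\<dots> \<le> 2 ^ m * (B (\<lambda>_. 0) + ?n ^ m * (\<Sum>k\<in>UNIV. B (e k)))"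
    proof (intro mult_left_mono add_mono)
      show "norm (?h x) \<le> B (\<lambda>_. 0)"
        using B[of "\<lambda>_. 0" x] by (simp add: z)
      have "\<bar>x $ k\<bar> ^ m * norm (?h x) \<le> B (e k)"
        using B[of "e k" x] by (simp add: e power_abs)
      also have "\<dots> \<le> (\<Sum>k\<in>UNIV. B (e k))"
        using Bpos by (intro member_le_sum) auto
      finally show "\<bar>x $ k\<bar> ^ m * norm (?h x) \<le> (\<Sum>k\<in>UNIV. B (e k))" .
    qed auto
    finally show ?thesis .
  qed
  then show "\<exists>C. \<forall>x. (1 + norm x) ^ m * norm (?h x) \<le> C" by blast
qed

lemma schwartzI:
  assumes "\<And>is x. partials is f differentiable (at x)" "\<And>is. rapidly_decreasing (partials is f)"
  shows "f \<in> schwartz"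
  unfolding schwartz_def
proof (safe intro!: assms(1))
  fix \<alpha> :: "'a \<Rightarrow> nat" and "is"
  obtain C where C: "\<And>x. (1 + norm x) ^ (\<Sum>i\<in>UNIV. \<alpha> i) * norm (partials is f x) \<le> C"
    using rapidly_decreasing_bound[OF assms(2)] by blast
  have "norm (monomial \<alpha> x *\<^sub>R partials is f x) \<le> C" for x
    using mult_right_mono[OF monomial_le[of \<alpha> x], of "norm (partials is f x)"] C[of x] by simp
  then show "bounded (range (\<lambda>x. monomial \<alpha> x *\<^sub>R partials is f x))"
    unfolding bounded_iff by blast
qed

lemma has_vector_derivative_along_line:
  fixes h :: "real^'n::finite \<Rightarrow> complex"
  assumes "h differentiable (at (u + t *\<^sub>R z))"
  shows "((\<lambda>t. h (u + t *\<^sub>R z)) has_vector_derivative frechet_derivative h (at (u + t *\<^sub>R z)) z) (at t within S)"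
proof -
  let ?D = "frechet_derivative h (at (u + t *\<^sub>R z))"
  have D: "(h has_derivative ?D) (at (u + t *\<^sub>R z))"
    using assms by (simp add: frechet_derivative_works)
  have "((\<lambda>t. u + t *\<^sub>R z) has_derivative (\<lambda>s. s *\<^sub>R z)) (at t within S)"
    by (auto intro!: derivative_eq_intros)
  then have "((\<lambda>t. h (u + t *\<^sub>R z)) has_derivative (\<lambda>s. ?D (s *\<^sub>R z))) (at t within S)"
    by (rule has_derivative_compose[where g = h]) (rule D)
  moreover have "?D (s *\<^sub>R z) = s *\<^sub>R ?D z" for s
    using linear_frechet_derivative[OF assms] by (simp add: linear_cmul)
  ultimately show ?thesis
    by (simp add: has_vector_derivative_def)
qed

lemma partial_deriv_eq:
  assumes "h differentiable (at x)"
  shows "partial_deriv i h x = frechet_derivative h (at x) (axis i 1)"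
  unfolding partial_deriv_def
  using has_vector_derivative_along_line[of h x 0 "axis i 1" UNIV] assms
  by (intro vector_derivative_at) simp

lemma partials_affine:
  assumes f: "\<And>is x. partials is f differentiable (at x)"
  shows "partials is (\<lambda>x. c *\<^sub>R f (r *\<^sub>R (x - a))) = (\<lambda>x. (c * r ^ length is) *\<^sub>R partials is f (r *\<^sub>R (x - a)))"
proof (induction "is")
  case Nil
  then show ?case by (simp add: partials_def)
next
  case (Cons i "is")
  let ?h = "partials is f" and ?c = "c * r ^ length is"
  have "partial_deriv i (\<lambda>x. ?c *\<^sub>R ?h (r *\<^sub>R (x - a))) x = (?c * r) *\<^sub>R partial_deriv i ?h (r *\<^sub>R (x - a))" for x
  proof -
    let ?y = "r *\<^sub>R (x - a)"
    have "((\<lambda>t. ?h (?y + t *\<^sub>R (r *\<^sub>R axis i 1))) has_vector_derivative frechet_derivative ?h (at ?y) (r *\<^sub>R axis i 1)) (at 0)"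
      using has_vector_derivative_along_line[of ?h ?y 0 "r *\<^sub>R axis i 1" UNIV] f by simp
    moreover have "frechet_derivative ?h (at ?y) (r *\<^sub>R axis i 1) = r *\<^sub>R partial_deriv i ?h ?y"
      using linear_frechet_derivative[OF f] by (simp add: linear_cmul partial_deriv_eq[OF f])
    moreover have "?y + t *\<^sub>R (r *\<^sub>R axis i 1) = r *\<^sub>R (x + t *\<^sub>R axis i 1 - a)" for t
      by (simp add: algebra_simps)
    ultimately have "((\<lambda>t. ?h (r *\<^sub>R (x + t *\<^sub>R axis i 1 - a))) has_vector_derivative r *\<^sub>R partial_deriv i ?h ?y) (at 0)"
      by simp
    then have "((\<lambda>t. ?c *\<^sub>R ?h (r *\<^sub>R (x + t *\<^sub>R axis i 1 - a))) has_vector_derivative ?c *\<^sub>R (r *\<^sub>R partial_deriv i ?h ?y)) (at 0)"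
      by (rule bounded_linear.has_vector_derivative[OF bounded_linear_scaleR_right])
    then show ?thesis
      unfolding partial_deriv_def[of i "\<lambda>x. ?c *\<^sub>R ?h (r *\<^sub>R (x - a))"]
      by (simp add: vector_derivative_at)
  qed
  then show ?case
    using Cons by (auto simp: partials_def mult.assoc mult.commute[of r])
qed

section \<open>Functions adapted to dyadic cubes\<close>

lemma side_pos [simp]: "0 < side Q"
  by (simp add: side_def)

lemma volume_pos [simp]: "0 < volume Q"
  by (simp add: volume_def)

lemma adapt_affine: "adapt f Q = (\<lambda>x. (volume Q powr (- 1/2)) *\<^sub>R f (inverse (side Q) *\<^sub>R (x - corner Q)))"
  by (simp add: adapt_def fun_eq_iff)

lemma schwartz_adapt:
  assumes "f \<in> schwartz" shows "adapt f Q \<in> schwartz"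
proof (rule schwartzI)
  let ?r = "inverse (side Q)"
  note eq = partials_affine[OF schwartz_differentiable[OF assms]]
  have "?r \<noteq> 0"
    using side_pos[of Q] by (metis inverse_zero_imp_zero less_irrefl)
  fix "is"
  show "rapidly_decreasing (partials is (adapt f Q))"
    unfolding adapt_affine eq
    by (rule rapidly_decreasing_affine[OF schwartz_rapidly_decreasing[OF assms] \<open>?r \<noteq> 0\<close>])
  fix x
  have "(\<lambda>x. partials is f (?r *\<^sub>R (x - corner Q))) differentiable (at x)"
    using schwartz_differentiable[OF assms, of "is" "?r *\<^sub>R (x - corner Q)"]
    by (intro differentiable_compose[of "partials is f" "\<lambda>x. ?r *\<^sub>R (x - corner Q)"] derivative_intros) auto
  then show "partials is (adapt f Q) differentiable (at x)"
    unfolding adapt_affine eq by (intro derivative_intros)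
qed

section \<open>Vanishing moments of Littlewood--Paley functions\<close>

lemma fourier_integrand_integrable:
  assumes "rapidly_decreasing f" "f \<in> borel_measurable borel"
  shows "integrable lborel (\<lambda>x. f x * exp (- \<i> * complex_of_real (x \<bullet> \<xi>)))"
proof (rule rapidly_decreasing_integrable)
  have "norm (exp (- \<i> * complex_of_real t)) = 1" for t
    by (simp add: norm_exp_eq_Re)
  then show "rapidly_decreasing (\<lambda>x. f x * exp (- \<i> * complex_of_real (x \<bullet> \<xi>)))"
    by (intro rapidly_decreasing_dominated[OF assms(1), of _ 1 0]) (simp only: norm_mult, simp)
qed (use assms(2) in measurable)

text \<open>Up to a constant, the conclusion is a partial derivative of \<open>fourier f\<close>.\<close>

lemma fourier_coordinate_eq_0:
  fixes f :: "real^'n::finite \<Rightarrow> complex"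
  assumes f: "rapidly_decreasing f" "f \<in> borel_measurable borel"
    and zero: "\<And>\<xi>. norm \<xi> < r \<Longrightarrow> fourier f \<xi> = 0" and "norm \<xi> < r"
  shows "fourier (\<lambda>x. (x $ i) *\<^sub>R f x) \<xi> = 0"
proof -
  note [measurable] = f(2)
  let ?E = "\<lambda>\<xi> x. exp (- \<i> * complex_of_real (x \<bullet> \<xi>))"
  define a where "a k = inverse (real (Suc k))" for k
  have a: "0 < a k" for k by (simp add: a_def)
  have a_lim: "a \<longlonglongrightarrow> 0"
    unfolding a_def by (rule LIMSEQ_inverse_real_of_nat)
  \<comment> \<open>\<open>G k\<close> is the difference quotient of the Fourier integrand in
    direction \<open>i\<close> with increment \<open>a k\<close>, after extracting the exponential
    at \<open>\<xi>\<close>; \<open>g\<close> is its pointwise limit.\<close>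
  define G where "G k x = f x * ?E \<xi> x * ((exp (- \<i> * complex_of_real (x $ i) * complex_of_real (a k)) - 1) / complex_of_real (a k))" for k x
  define g where "g x = f x * ?E \<xi> x * (- \<i> * complex_of_real (x $ i))" for x
  have coord: "rapidly_decreasing (\<lambda>x. (x $ i) *\<^sub>R f x)"
  proof (rule rapidly_decreasing_dominated[OF f(1), of _ 1 1])
    show "norm ((x $ i) *\<^sub>R f x) \<le> 1 * (1 + norm x) ^ 1 * norm (f x)" for x
      using component_le_norm_cart[of x i] by (auto intro!: mult_right_mono)
  qed
  have E_norm: "norm (?E \<xi> x) = 1" for x
    by (simp add: norm_exp_eq_Re)
  have exp_lim: "((\<lambda>a. (exp (z * a) - 1) / a) \<longlongrightarrow> z) (at 0)" for z :: complex
  proof -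
    have "((\<lambda>a. exp (z * a)) has_field_derivative z) (at 0)"
      by (auto intro!: derivative_eq_intros)
    then show ?thesis
      by (simp add: DERIV_def)
  qed
  have lim: "(\<lambda>k. LINT x|lborel. G k x) \<longlonglongrightarrow> (LINT x|lborel. g x)"
  proof (rule integral_dominated_convergence)
    show "integrable lborel (\<lambda>x. norm ((x $ i) *\<^sub>R f x))"
      by (intro integrable_norm rapidly_decreasing_integrable[OF coord]) measurable
    show "AE x in lborel. (\<lambda>k. G k x) \<longlonglongrightarrow> g x"
    proof (intro always_eventually allI)
      fix x
      have "filterlim (\<lambda>k. complex_of_real (a k)) (at 0) sequentially"
        unfolding filterlim_at using a a_lim
        by (auto intro!: always_eventually simp: less_imp_neq[symmetric] tendsto_of_real_iff[of _ 0, simplified])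
      from filterlim_compose[OF exp_lim this]
      show "(\<lambda>k. G k x) \<longlonglongrightarrow> g x"
        unfolding G_def g_def by (intro tendsto_mult tendsto_const)
    qed
    show "AE x in lborel. norm (G k x) \<le> norm ((x $ i) *\<^sub>R f x)" for k
    proof (intro always_eventually allI)
      fix x
      \<comment> \<open>|exp(it) - 1| = 2 |sin(t/2)| \<le> |t| cancels the divisor
        \<open>a k\<close>, so the dominating function |x_i f(x)| is independent of k.\<close>
      have "norm (exp (- \<i> * complex_of_real (x $ i) * complex_of_real (a k)) - 1)
          = norm (exp (\<i> * complex_of_real (- (x $ i * a k))) - 1)"
        by (simp add: mult.assoc)
      also have "\<dots> = 2 * \<bar>sin (- (x $ i * a k) / 2)\<bar>"
        by (rule dist_exp_i_1)
      also have "\<dots> \<le> 2 * \<bar>- (x $ i * a k) / 2\<bar>"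
        by (intro mult_left_mono abs_sin_x_le_abs_x) simp
      also have "\<dots> = \<bar>x $ i\<bar> * a k"
        using a[of k] by (simp add: abs_mult)
      finally have "norm ((exp (- \<i> * complex_of_real (x $ i) * complex_of_real (a k)) - 1) / complex_of_real (a k)) \<le> \<bar>x $ i\<bar>"
        using a[of k] by (simp add: norm_divide divide_le_eq)
      then have "norm (f x) * norm ((exp (- \<i> * complex_of_real (x $ i) * complex_of_real (a k)) - 1) / complex_of_real (a k)) \<le> norm (f x) * \<bar>x $ i\<bar>"
        by (intro mult_left_mono) auto
      then show "norm (G k x) \<le> norm ((x $ i) *\<^sub>R f x)"
        unfolding G_def norm_mult E_norm norm_scaleR by (simp add: mult.commute)
    qed
  qed (unfold G_def g_def, measurable)
  have "\<forall>\<^sub>F k in sequentially. (LINT x|lborel. G k x) = 0"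
  proof -
    have "\<forall>\<^sub>F k in sequentially. a k < r - norm \<xi>"
      using order_tendstoD(2)[OF a_lim, of "r - norm \<xi>"] \<open>norm \<xi> < r\<close> by simp
    then show ?thesis
    proof (rule eventually_mono)
      \<comment> \<open>For such k both frequencies of the quotient lie in the ball on which
        \<open>fourier f\<close> vanishes.\<close>
      fix k assume k: "a k < r - norm \<xi>"
      let ?\<eta> = "\<xi> + a k *\<^sub>R axis i 1"
      have "norm ?\<eta> \<le> norm \<xi> + a k"
        using norm_triangle_ineq[of \<xi> "a k *\<^sub>R axis i 1"] a[of k] by (simp add: norm_axis_1)
      then have "norm ?\<eta> < r" using k by linarith
      have "?E ?\<eta> x = ?E \<xi> x * exp (- \<i> * complex_of_real (x $ i) * complex_of_real (a k))" for x
        unfolding exp_add[symmetric] by (simp add: inner_add_right inner_axis algebra_simps)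
      then have "G k x = (f x * ?E ?\<eta> x - f x * ?E \<xi> x) / complex_of_real (a k)" for x
        by (simp add: G_def algebra_simps diff_divide_distrib)
      then have "(LINT x|lborel. G k x) = (LINT x|lborel. (f x * ?E ?\<eta> x - f x * ?E \<xi> x) / complex_of_real (a k))"
        by simp
      also have "\<dots> = (fourier f ?\<eta> - fourier f \<xi>) / complex_of_real (a k)"
        unfolding fourier_def
        by (subst Bochner_Integration.integral_diff[symmetric])
           (auto intro: fourier_integrand_integrable[OF f, simplified])
      also have "\<dots> = 0"
        using zero \<open>norm ?\<eta> < r\<close> \<open>norm \<xi> < r\<close> by simp
      finally show "(LINT x|lborel. G k x) = 0" .
    qed
  qed
  then have "(\<lambda>k. LINT x|lborel. G k x) \<longlonglongrightarrow> 0"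
    by (rule tendsto_eventually)
  then have "(LINT x|lborel. g x) = 0"
    by (rule LIMSEQ_unique[OF lim])
  moreover have "(x $ i) *\<^sub>R f x * ?E \<xi> x = \<i> * g x" for x
    by (simp add: g_def scaleR_conv_of_real algebra_simps)
  ultimately show ?thesis
    unfolding fourier_def by simp
qed

lemma rapidly_decreasing_monomial:
  assumes "rapidly_decreasing f"
  shows "rapidly_decreasing (\<lambda>x. monomial \<alpha> x *\<^sub>R f x)"
proof (rule rapidly_decreasing_dominated[OF assms, of _ 1 "\<Sum>i\<in>UNIV. \<alpha> i"])
  show "norm (monomial \<alpha> x *\<^sub>R f x) \<le> 1 * (1 + norm x) ^ (\<Sum>i\<in>UNIV. \<alpha> i) * norm (f x)" for x
    using mult_right_mono[OF monomial_le[of \<alpha> x], of "norm (f x)"] by simp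
qed

lemma monomial_measurable [measurable]: "monomial \<alpha> \<in> borel_measurable borel"
  unfolding monomial_def by measurable

lemma sum_fun_upd_Suc:
  fixes \<alpha> :: "'n::finite \<Rightarrow> nat"
  shows "(\<Sum>j\<in>UNIV. (\<alpha>(i := Suc (\<alpha> i))) j) = Suc (\<Sum>j\<in>UNIV. \<alpha> j)"
proof -
  have "(\<Sum>j\<in>UNIV. (\<alpha>(i := Suc (\<alpha> i))) j) = (\<Sum>j\<in>UNIV. \<alpha> j + (if j = i then 1 else 0))"
    by (rule sum.cong) auto
  then show ?thesis
    by (simp add: sum.distrib)
qed

lemma monomial_fun_upd_Suc: "monomial (\<alpha>(i := Suc (\<alpha> i))) x = x $ i * monomial \<alpha> x"
proof -
  have "monomial (\<alpha>(i := Suc (\<alpha> i))) x = (\<Prod>j\<in>UNIV. (if j = i then x $ j else 1) * (x $ j) ^ \<alpha> j)"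
    unfolding monomial_def by (rule prod.cong) auto
  then show ?thesis
    by (simp add: prod.distrib monomial_def)
qed

text \<open>The exponents are raised one at a time, each corresponding to one more derivative of
  \<open>fourier f\<close>. Vanishing is carried through the induction on the whole open ball, since
  vanishing at one frequency could not be differentiated again.\<close>

lemma fourier_monomial_eq_0:
  fixes f :: "real^'n::finite \<Rightarrow> complex"
  assumes f: "rapidly_decreasing f" "f \<in> borel_measurable borel"
    and zero: "\<And>\<xi>. norm \<xi> < r \<Longrightarrow> fourier f \<xi> = 0"
  shows "norm \<xi> < r \<Longrightarrow> fourier (\<lambda>x. monomial \<alpha> x *\<^sub>R f x) \<xi> = 0"
proof (induction "\<Sum>i\<in>UNIV. \<alpha> i" arbitrary: \<alpha> \<xi>)
  case 0
  then have "monomial \<alpha> x = 1" for x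
    by (simp add: monomial_def)
  then have "(\<lambda>x. monomial \<alpha> x *\<^sub>R f x) = f"
    by simp
  then show ?case using zero[OF 0(2)] by metis
next
  case (Suc m)
  then obtain i where i: "\<alpha> i \<noteq> 0"
    by (metis sum.neutral nat.distinct(1))
  define \<beta> where "\<beta> = \<alpha>(i := \<alpha> i - 1)"
  have \<alpha>: "\<alpha> = \<beta>(i := Suc (\<beta> i))"
    using i by (auto simp: \<beta>_def)
  have m: "m = (\<Sum>j\<in>UNIV. \<beta> j)"
    using Suc(2) sum_fun_upd_Suc[of \<beta> i] by (simp add: \<alpha>[symmetric])
  have mon: "monomial \<alpha> x = x $ i * monomial \<beta> x" for x
    using monomial_fun_upd_Suc[of \<beta> i x] by (simp add: \<alpha>[symmetric])
  have "fourier (\<lambda>x. (x $ i) *\<^sub>R (monomial \<beta> x *\<^sub>R f x)) \<xi> = 0"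
    using f Suc.prems
    by (intro fourier_coordinate_eq_0[where r = r] rapidly_decreasing_monomial Suc.hyps(1)[OF m]) measurable
  then show ?case
    by (simp add: mon)
qed

text \<open>The moments of \<open>f\<close> are the values at frequency 0 of the Fourier transforms
  of its monomial multiples.\<close>

lemma S_infty_if_fourier_vanishes_near_0:
  assumes f: "f \<in> schwartz" and "0 < r" and zero: "\<And>\<xi>. norm \<xi> < r \<Longrightarrow> fourier f \<xi> = 0"
  shows "f \<in> S_infty"
proof -
  have "fourier (\<lambda>x. monomial \<alpha> x *\<^sub>R f x) 0 = 0" for \<alpha>
    using schwartz_rapidly_decreasing[OF f, of "[]"] schwartz_measurable[OF f, of "[]"] \<open>0 < r\<close> zero
    by (intro fourier_monomial_eq_0[where r = r]) (auto simp: partials_def)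
  then show ?thesis
    using f by (simp add: S_infty_def fourier_def)
qed

lemma fourier_adapt:
  fixes f :: "real^'n::finite \<Rightarrow> complex"
  assumes f: "f \<in> borel_measurable borel"
  shows "fourier (adapt f Q) \<xi> =
    (side Q ^ CARD('n) * volume Q powr (- 1/2)) *\<^sub>R (exp (- \<i> * complex_of_real (corner Q \<bullet> \<xi>)) * fourier f (side Q *\<^sub>R \<xi>))"
proof -
  note [measurable] = f
  let ?c = "volume Q powr (- 1/2)" and ?E = "exp (- \<i> * complex_of_real (corner Q \<bullet> \<xi>))"
  have side: "side Q \<noteq> 0" by (metis side_pos less_irrefl)
  have "fourier (adapt f Q) \<xi> = \<bar>side Q\<bar> ^ DIM(real^'n) *\<^sub>R
      (LINT x|lborel. adapt f Q (corner Q + side Q *\<^sub>R x) * exp (- \<i> * complex_of_real ((corner Q + side Q *\<^sub>R x) \<bullet> \<xi>)))"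
    unfolding fourier_def by (rule lborel_integral_affine[OF _ side]) (unfold adapt_def, measurable)
  also have "\<dots> = side Q ^ CARD('n) *\<^sub>R (LINT x|lborel. (?c *\<^sub>R ?E) * (f x * exp (- \<i> * complex_of_real (x \<bullet> (side Q *\<^sub>R \<xi>)))))"
  proof -
    have "adapt f Q (corner Q + side Q *\<^sub>R x) * exp (- \<i> * complex_of_real ((corner Q + side Q *\<^sub>R x) \<bullet> \<xi>))
        = (?c *\<^sub>R ?E) * (f x * exp (- \<i> * complex_of_real (x \<bullet> (side Q *\<^sub>R \<xi>))))" for x
      using side by (simp add: adapt_def inner_add_left exp_add algebra_simps exp_diff exp_minus divide_simps)
    moreover have "\<bar>side Q\<bar> = side Q"
      by (simp add: less_imp_le)
    ultimately show ?thesis by simp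
  qed
  also have "\<dots> = side Q ^ CARD('n) *\<^sub>R ((?c *\<^sub>R ?E) * fourier f (side Q *\<^sub>R \<xi>))"
    unfolding fourier_def by (subst integral_mult_right_zero) simp
  finally show ?thesis by simp
qed

lemma littlewood_paley_adapt_S_infty:
  assumes "littlewood_paley \<phi>"
  shows "adapt \<phi> Q \<in> S_infty"
proof -
  obtain \<alpha> \<beta> C where \<beta>: "sqrt 2 < \<alpha>" "\<alpha> < \<beta>" and le: "\<And>\<xi>. cmod (fourier \<phi> \<xi>) \<le> C * indicat_real {1/\<beta>..\<beta>} (norm \<xi>)"
    and \<phi>: "\<phi> \<in> schwartz"
    using assms unfolding littlewood_paley_def by blast
  have "1 < sqrt (2::real)" by simp
  then have "0 < \<beta>" using \<beta> by linarith
  show ?thesis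
  proof (rule S_infty_if_fourier_vanishes_near_0[OF schwartz_adapt[OF \<phi>]])
    \<comment> \<open>Adapting to \<open>Q\<close> dilates frequencies by 1 / \<open>side Q\<close>,
      so this is the inner radius of the annulus supporting the transform of
      \<open>adapt \<phi> Q\<close>.\<close>
    show "0 < 1 / (\<beta> * side Q)"
      using \<open>0 < \<beta>\<close> by simp
    fix \<xi> :: "real^'a" assume "norm \<xi> < 1 / (\<beta> * side Q)"
    then have "norm (side Q *\<^sub>R \<xi>) < 1 / \<beta>"
      using \<open>0 < \<beta>\<close> side_pos[of Q] by (simp add: field_simps abs_of_pos)
    then have "fourier \<phi> (side Q *\<^sub>R \<xi>) = 0"
      using le[of "side Q *\<^sub>R \<xi>"] by simp
    then show "fourier (adapt \<phi> Q) \<xi> = 0"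
      using schwartz_measurable[OF \<phi>, of "[]"] by (simp add: fourier_adapt partials_def)
  qed
qed

lemma unit_cube [simp]: "side (0, k) = 1" "volume (0, k) = 1" "corner (0, 0) = 0"
  by (simp_all add: side_def volume_def corner_def vec_eq_iff)

text \<open>This lets a single test function be treated as a member of an adapted family, so that
  estimates for pairs of cubes apply to it.\<close>

lemma adapt_unit_cube: "adapt f (0, 0) = f"
  by (simp add: adapt_def fun_eq_iff)

lemma littlewood_paley_S_infty: "littlewood_paley \<phi> \<Longrightarrow> \<phi> \<in> S_infty"
  using littlewood_paley_adapt_S_infty[of \<phi> "(0, 0)"] by (simp add: adapt_unit_cube)

section \<open>Taylor expansion of tensor products\<close>

text \<open>The remainder in integral form: the kernel is at most b^(p-1), and the length of the
  interval supplies the last factor b. The factorial is dropped, because only the power of b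
  matters. The integral form requires p > 0, so p = 0 is treated apart.\<close>

lemma Taylor_remainder_bound:
  fixes g :: "real \<Rightarrow> 'a::banach"
  assumes Df0: "Df 0 = g"
    and Df: "\<And>m t. m < p \<Longrightarrow> 0 \<le> t \<Longrightarrow> t \<le> b \<Longrightarrow> (Df m has_vector_derivative Df (Suc m) t) (at t within {0..b})"
    and "0 \<le> b" and M: "\<And>t. 0 \<le> t \<Longrightarrow> t \<le> b \<Longrightarrow> norm (Df p t) \<le> M"
  shows "norm (g b - (\<Sum>i<p. (b ^ i / fact i) *\<^sub>R Df i 0)) \<le> M * b ^ p"
proof (cases "p = 0")
  case True
  then show ?thesis using M[of b] \<open>0 \<le> b\<close> Df0 by simp
next
  case False
  have "0 \<le> M"
    using M[of 0] \<open>0 \<le> b\<close> norm_ge_zero order_trans by blast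
  let ?i = "\<lambda>x. ((b - x) ^ (p - 1) / fact (p - 1)) *\<^sub>R Df p x"
  have int: "(?i has_integral g b - (\<Sum>i<p. ((b - 0) ^ i / fact i) *\<^sub>R Df i 0)) {0..b}"
    using False Df \<open>0 \<le> b\<close> by (intro Taylor_has_integral Df0) auto
  have "norm (g b - (\<Sum>i<p. ((b - 0) ^ i / fact i) *\<^sub>R Df i 0)) \<le> b ^ (p - 1) * M * measure lborel (cbox 0 b)"
  proof (rule has_integral_bound)
    show "(?i has_integral g b - (\<Sum>i<p. ((b - 0) ^ i / fact i) *\<^sub>R Df i 0)) (cbox 0 b)"
      using int by simp
    fix x assume "x \<in> cbox 0 b"
    then have x: "0 \<le> x" "x \<le> b" by auto
    have "(b - x) ^ (p - 1) / fact (p - 1) \<le> b ^ (p - 1) / 1"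
      using x by (intro frac_le power_mono) (auto simp: fact_ge_1)
    then have "\<bar>(b - x) ^ (p - 1) / fact (p - 1)\<bar> \<le> b ^ (p - 1)"
      using x by simp
    then show "norm (?i x) \<le> b ^ (p - 1) * M"
      unfolding norm_scaleR using M[OF x] \<open>0 \<le> b\<close> by (intro mult_mono) auto
  qed (use \<open>0 \<le> M\<close> \<open>0 \<le> b\<close> in simp)
  also have "\<dots> = M * b ^ p"
    using False \<open>0 \<le> b\<close> by (simp add: power_eq_if)
  finally show ?thesis by simp
qed

text \<open>The derivatives up to order \<open>N\<close> are continuous, hence bounded on the
  compact interval from -\<rho> to \<rho>, and zero outside it. Adding these finitely many bounds
  gives one constant for all orders.\<close>

lemma Cc_bounds:
  assumes h: "h \<in> Cc N"
  obtains M \<rho> where "0 \<le> M" "0 \<le> \<rho>"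
    "\<And>k x. k \<le> N \<Longrightarrow> \<bar>(deriv ^^ k) h x\<bar> \<le> M"
    "\<And>k x. \<rho> < \<bar>x\<bar> \<Longrightarrow> (deriv ^^ k) h x = 0"
    "\<And>k x. k < N \<Longrightarrow> ((deriv ^^ k) h has_real_derivative (deriv ^^ Suc k) h x) (at x)"
proof -
  have der: "((deriv ^^ k) h has_real_derivative (deriv ^^ Suc k) h x) (at x)" if "k < N" for k x
    using h that by (simp add: Cc_def DERIV_deriv_iff_real_differentiable)
  have cont: "continuous_on UNIV ((deriv ^^ k) h)" if "k \<le> N" for k
  proof (cases "k = N")
    case True
    then show ?thesis using h by (simp add: Cc_def)
  next
    case False
    then show ?thesis
      using der that by (intro continuous_at_imp_continuous_on ballI) (meson DERIV_isCont le_neq_implies_less)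
  qed
  have "compact (closure {x. h x \<noteq> 0})"
    using h by (simp add: Cc_def)
  then have "bounded {x. h x \<noteq> 0}"
    by (meson bounded_subset closure_subset compact_imp_bounded)
  then obtain \<rho> where \<rho>: "\<And>x. h x \<noteq> 0 \<Longrightarrow> \<bar>x\<bar> \<le> \<rho>" "0 < \<rho>"
    unfolding bounded_pos by auto
  have zero: "(deriv ^^ k) h x = 0" if "\<rho> < \<bar>x\<bar>" for k x
    using that
  proof (induction k arbitrary: x)
    case 0
    then show ?case using \<rho>(1)[of x] by force
  next
    case (Suc k)
    \<comment> \<open>The exterior region is open, so a derivative that is zero there has derivative
      zero there. This works for every k, also beyond the order \<open>N\<close>.\<close>
    have "open {x::real. \<rho> < \<bar>x\<bar>}"
      by (intro open_Collect_less continuous_intros)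
    from has_field_derivative_transform_within_open[OF DERIV_const this, of x _ "(deriv ^^ k) h"]
    have "((deriv ^^ k) h has_real_derivative 0) (at x)"
      using Suc by simp
    then show ?case
      by (simp add: DERIV_imp_deriv)
  qed
  have "\<exists>B. \<forall>x. \<bar>(deriv ^^ k) h x\<bar> \<le> B" if "k \<le> N" for k
  proof -
    have "compact ((deriv ^^ k) h ` {-\<rho>..\<rho>})"
      using cont[OF that] by (intro compact_continuous_image compact_Icc) (rule continuous_on_subset, auto)
    then have "bounded ((deriv ^^ k) h ` {-\<rho>..\<rho>})"
      by (rule compact_imp_bounded)
    then obtain B where "0 < B" and B': "\<forall>y\<in>(deriv ^^ k) h ` {-\<rho>..\<rho>}. norm y \<le> B"
      unfolding bounded_pos by blast
    have B: "\<bar>(deriv ^^ k) h x\<bar> \<le> B" if "\<bar>x\<bar> \<le> \<rho>" for x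
    proof -
      have "x \<in> {-\<rho>..\<rho>}" using that by auto
      then show ?thesis using B' by (auto simp del: abs_le_iff)
    qed
    with \<open>0 < B\<close> have "\<bar>(deriv ^^ k) h x\<bar> \<le> B" for x
      using zero[of x k] by (cases "\<bar>x\<bar> \<le> \<rho>") auto
    then show ?thesis by blast
  qed
  then obtain B where B: "\<And>k x. k \<le> N \<Longrightarrow> \<bar>(deriv ^^ k) h x\<bar> \<le> B k"
    by metis
  have B0: "0 \<le> B k" if "k \<le> N" for k
    using B[OF that, of 0] by linarith
  have "\<bar>(deriv ^^ k) h x\<bar> \<le> (\<Sum>k\<le>N. B k)" if "k \<le> N" for k x
    using order_trans[OF B[OF that] member_le_sum[of k "{..N}" B]] B0 that by auto
  moreover have "0 \<le> (\<Sum>k\<le>N. B k)"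
    using B0 by (intro sum_nonneg) auto
  ultimately show ?thesis
    using that \<rho>(2) zero der by (meson less_imp_le)
qed

text \<open>Division by \<open>L\<close> makes all factors at most 1 in modulus, where replacing
  factors one by one costs only the sum of the differences. Since 1 \<le> \<open>L\<close>, the
  division does not enlarge these differences; undoing it costs L^(card I).\<close>

lemma abs_prod_diff_le:
  fixes a b :: "'i \<Rightarrow> real"
  assumes "finite I" "1 \<le> L" "\<And>i. i \<in> I \<Longrightarrow> \<bar>a i\<bar> \<le> L" "\<And>i. i \<in> I \<Longrightarrow> \<bar>b i\<bar> \<le> L"
    and "\<And>i. i \<in> I \<Longrightarrow> \<bar>a i - b i\<bar> \<le> e"
  shows "\<bar>prod a I - prod b I\<bar> \<le> L ^ card I * (real (card I) * e)"
proof -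
  have L: "0 < L" using \<open>1 \<le> L\<close> by linarith
  have "norm ((\<Prod>i\<in>I. a i / L) - (\<Prod>i\<in>I. b i / L)) \<le> (\<Sum>i\<in>I. norm (a i / L - b i / L))"
    using assms L by (intro norm_prod_diff) auto
  also have "\<dots> \<le> real (card I) * e"
  proof (rule sum_bounded_above)
    fix i assume i: "i \<in> I"
    have "norm (a i / L - b i / L) = \<bar>a i - b i\<bar> / L"
      using L by (simp flip: diff_divide_distrib)
    also have "\<dots> \<le> \<bar>a i - b i\<bar> / 1"
      using \<open>1 \<le> L\<close> by (intro divide_left_mono) auto
    finally show "norm (a i / L - b i / L) \<le> e"
      using assms(5)[OF i] by simp
  qed
  finally have "L ^ card I * norm ((\<Prod>i\<in>I. a i / L) - (\<Prod>i\<in>I. b i / L)) \<le> L ^ card I * (real (card I) * e)"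
    using L by (intro mult_left_mono) auto
  moreover have "L ^ card I * norm ((\<Prod>i\<in>I. a i / L) - (\<Prod>i\<in>I. b i / L)) = \<bar>prod a I - prod b I\<bar>"
    using L by (simp add: prod_dividef flip: diff_divide_distrib)
  ultimately show ?thesis by simp
qed

definition Taylor_poly :: "nat \<Rightarrow> (real \<Rightarrow> real) \<Rightarrow> real \<Rightarrow> real \<Rightarrow> real" where
  "Taylor_poly N h x y = (\<Sum>k<N. (deriv ^^ k) h x / fact k * y ^ k)"

text \<open>The expansion is made in \<open>s\<close>, for the function t \<mapsto> h(x + t y). The
  chain rule then separates the gain s^N from the growth |y|^N, which rapid decay will
  absorb.\<close>

lemma Taylor_poly_error:
  assumes der: "\<And>k x. k < N \<Longrightarrow> ((deriv ^^ k) h has_real_derivative (deriv ^^ Suc k) h x) (at x)"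
    and M: "\<And>x. \<bar>(deriv ^^ N) h x\<bar> \<le> M" and "0 \<le> s"
  shows "\<bar>h (x + s * y) - Taylor_poly N h x (s * y)\<bar> \<le> M * \<bar>y\<bar> ^ N * s ^ N"
proof -
  let ?D = "\<lambda>k t. y ^ k * (deriv ^^ k) h (x + t * y)"
  have "norm (?D 0 s - (\<Sum>k<N. (s ^ k / fact k) *\<^sub>R ?D k 0)) \<le> M * \<bar>y\<bar> ^ N * s ^ N"
  proof (rule Taylor_remainder_bound[of ?D])
    fix k t assume "k < N"
    have "((\<lambda>t. x + t * y) has_real_derivative y) (at t within {0..s})"
      by (auto intro!: derivative_eq_intros)
    from DERIV_chain2[OF der[OF \<open>k < N\<close>] this]
    have "((\<lambda>t. y ^ k * (deriv ^^ k) h (x + t * y)) has_real_derivative y ^ k * ((deriv ^^ Suc k) h (x + t * y) * y)) (at t within {0..s})"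
      by (rule DERIV_cmult)
    then show "(?D k has_vector_derivative ?D (Suc k) t) (at t within {0..s})"
      by (simp add: has_real_derivative_iff_has_vector_derivative algebra_simps)
  next
    fix t
    show "norm (?D N t) \<le> M * \<bar>y\<bar> ^ N"
      using mult_right_mono[OF M[of "x + t * y"], of "\<bar>y\<bar> ^ N"] by (simp add: abs_mult power_abs mult.commute)
  qed (use \<open>0 \<le> s\<close> in auto)
  moreover have "(\<Sum>k<N. (s ^ k / fact k) *\<^sub>R ?D k 0) = Taylor_poly N h x (s * y)"
    unfolding Taylor_poly_def by (rule sum.cong) (auto simp: power_mult_distrib)
  ultimately show ?thesis by simp
qed

text \<open>Only smallness of order \<open>s ^ N\<close> matters here, not the degree of the subtracted polynomial: all of its
  moments against a function of \<open>S_infty\<close> vanish. Hence one may expand factor by factor.\<close>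

lemma Taylor_product_bound:
  fixes h :: "'n::finite \<Rightarrow> real \<Rightarrow> real"
  assumes h: "\<And>i. h i \<in> Cc N"
  obtains K p where "0 \<le> K" "\<And>s v y. 0 < s \<Longrightarrow> s \<le> 1 \<Longrightarrow>
     (1 + norm v) ^ m * \<bar>(\<Prod>i\<in>UNIV. h i (v $ i + s * y $ i)) - (\<Prod>i\<in>UNIV. Taylor_poly N (h i) (v $ i) (s * y $ i))\<bar>
       \<le> K * s ^ N * (1 + norm y) ^ p"
proof -
  have "\<exists>M \<rho>. 0 \<le> M \<and> 0 \<le> \<rho> \<and> (\<forall>k x. k \<le> N \<longrightarrow> \<bar>(deriv ^^ k) (h i) x\<bar> \<le> M) \<and>
      (\<forall>k x. \<rho> < \<bar>x\<bar> \<longrightarrow> (deriv ^^ k) (h i) x = 0)" for i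
    by (rule Cc_bounds[OF h[of i]]) blast
  then obtain M' \<rho>' where M': "\<And>i. 0 \<le> M' i" "\<And>i k x. k \<le> N \<Longrightarrow> \<bar>(deriv ^^ k) (h i) x\<bar> \<le> M' i"
    and \<rho>': "\<And>i. 0 \<le> \<rho>' i" "\<And>i k x. \<rho>' i < \<bar>x\<bar> \<Longrightarrow> (deriv ^^ k) (h i) x = 0"
    by metis
  have der: "k < N \<Longrightarrow> ((deriv ^^ k) (h i) has_real_derivative (deriv ^^ Suc k) (h i) x) (at x)" for i k x
    by (rule Cc_bounds[OF h[of i]]) blast
  define M where "M = (\<Sum>i\<in>UNIV. M' i)"
  define \<rho> where "\<rho> = (\<Sum>i\<in>UNIV. \<rho>' i)"
  have "M' i \<le> M" "\<rho>' i \<le> \<rho>" for i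
    unfolding M_def \<rho>_def by (auto intro!: member_le_sum M'(1) \<rho>'(1))
  then have M: "k \<le> N \<Longrightarrow> \<bar>(deriv ^^ k) (h i) x\<bar> \<le> M" and \<rho>: "\<rho> < \<bar>x\<bar> \<Longrightarrow> (deriv ^^ k) (h i) x = 0" for i k x
    using M'(2)[of k i x] \<rho>'(2)[of i x k] by (meson order_trans order_le_less_trans)+
  have "0 \<le> M" "0 \<le> \<rho>"
    unfolding M_def \<rho>_def by (auto intro!: sum_nonneg M'(1) \<rho>'(1))
  let ?n = "CARD('n)"
  \<comment> \<open>With Y = 1 + |y|, every factor is at most (1 + N)(1 + M) Y^N and the factors
    differ by at most M Y^N s^N. \<open>abs_prod_diff_le\<close> turns this into K0 s^N Y^(nN + N);
    the weight in \<open>v\<close> will add Y^m and the remaining factor of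
    \<open>K\<close>.\<close>
  define K0 where "K0 = ((1 + real N) * (1 + M)) ^ ?n * (real ?n * M)"
  define K where "K = (real ?n * (1 + \<rho>)) ^ m * K0"
  have n: "1 \<le> real ?n" by (simp add: Suc_le_eq)
  have K0: "0 \<le> K0" unfolding K0_def using \<open>0 \<le> M\<close> by simp
  show ?thesis
  proof (rule that[of K "m + (?n * N + N)"])
    show "0 \<le> K" unfolding K_def using K0 \<open>0 \<le> \<rho>\<close> by simp
    fix s :: real and v y :: "real^'n"
    assume s: "0 < s" "s \<le> 1"
    let ?Y = "1 + norm y"
    let ?a = "\<lambda>i. h i (v $ i + s * y $ i)" and ?b = "\<lambda>i. Taylor_poly N (h i) (v $ i) (s * y $ i)"
    have Y: "1 \<le> ?Y" by simp
    have yi: "\<bar>y $ i\<bar> \<le> ?Y" for i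
      using component_le_norm_cart[of y i] by linarith
    have syi: "\<bar>s * y $ i\<bar> \<le> norm y" for i
    proof -
      have "\<bar>s * y $ i\<bar> \<le> 1 * \<bar>y $ i\<bar>"
        unfolding abs_mult using s by (intro mult_right_mono) auto
      then show ?thesis using component_le_norm_cart[of y i] by linarith
    qed
    have diff: "\<bar>prod ?a UNIV - prod ?b UNIV\<bar> \<le> K0 * s ^ N * ?Y ^ (?n * N + N)"
    proof -
      let ?L = "(1 + real N) * (1 + M) * ?Y ^ N" and ?e = "M * ?Y ^ N * s ^ N"
      have YN: "1 \<le> ?Y ^ N" using Y by simp
      have NM: "1 \<le> (1 + real N) * (1 + M)"
        using \<open>0 \<le> M\<close> mult_mono[of 1 "1 + real N" 1 "1 + M"] by simp
      have L1: "1 \<le> ?L"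
        using mult_mono[OF NM YN] \<open>0 \<le> M\<close> by simp
      have "\<bar>prod ?a UNIV - prod ?b UNIV\<bar> \<le> ?L ^ card (UNIV :: 'n set) * (real (card (UNIV :: 'n set)) * ?e)"
      proof (rule abs_prod_diff_le[OF _ L1])
        fix i :: 'n
        have "\<bar>?a i\<bar> \<le> M" using M[of 0 i] by simp
        also have "\<dots> \<le> (1 + real N) * (1 + M)"
          using \<open>0 \<le> M\<close> mult_mono[of 1 "1 + real N" M "1 + M"] by simp
        also have "\<dots> \<le> ?L"
          using mult_left_mono[OF YN, of "(1 + real N) * (1 + M)"] \<open>0 \<le> M\<close> by simp
        finally show "\<bar>?a i\<bar> \<le> ?L" .
        have "\<bar>?b i\<bar> \<le> (\<Sum>k<N. \<bar>(deriv ^^ k) (h i) (v $ i) / fact k * (s * y $ i) ^ k\<bar>)"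
          unfolding Taylor_poly_def by (rule sum_abs)
        also have "\<dots> \<le> real (card {..<N}) * (M * ?Y ^ N)"
        proof (rule sum_bounded_above)
          fix k assume k: "k \<in> {..<N}"
          have "\<bar>(deriv ^^ k) (h i) (v $ i) / fact k\<bar> \<le> M / 1"
            unfolding abs_divide using M[of k i] k by (intro frac_le) (auto simp: fact_ge_1 \<open>0 \<le> M\<close>)
          moreover have "\<bar>(s * y $ i) ^ k\<bar> \<le> ?Y ^ N"
          proof -
            have "\<bar>(s * y $ i) ^ k\<bar> \<le> ?Y ^ k"
              unfolding power_abs using syi[of i] by (intro power_mono) auto
            also have "\<dots> \<le> ?Y ^ N"
              using Y k by (intro power_increasing) auto
            finally show ?thesis .
          qed
          ultimately show "\<bar>(deriv ^^ k) (h i) (v $ i) / fact k * (s * y $ i) ^ k\<bar> \<le> M * ?Y ^ N"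
            unfolding abs_mult using \<open>0 \<le> M\<close> by (intro mult_mono) auto
        qed
        also have "\<dots> \<le> ?L"
        proof -
          have "real N * M \<le> (1 + real N) * (1 + M)"
            using \<open>0 \<le> M\<close> by (intro mult_mono) auto
          then have "(real N * M) * ?Y ^ N \<le> ?L"
            using YN by (intro mult_right_mono) auto
          then show ?thesis
            by (metis card_lessThan mult.assoc)
        qed
        finally show "\<bar>?b i\<bar> \<le> ?L" .
        have "\<bar>?a i - ?b i\<bar> \<le> M * \<bar>y $ i\<bar> ^ N * s ^ N"
          using s by (intro Taylor_poly_error der M) auto
        also have "\<dots> \<le> ?e"
          using yi[of i] s \<open>0 \<le> M\<close> by (intro mult_right_mono mult_left_mono power_mono) auto
        finally show "\<bar>?a i - ?b i\<bar> \<le> ?e" .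
      qed simp
      also have "\<dots> = K0 * s ^ N * ?Y ^ (?n * N + N)"
        by (simp add: K0_def power_mult_distrib power_add power_mult[symmetric] mult_ac)
      finally show ?thesis .
    qed
    show "(1 + norm v) ^ m * \<bar>prod ?a UNIV - prod ?b UNIV\<bar> \<le> K * s ^ N * ?Y ^ (m + (?n * N + N))"
    \<comment> \<open>If a coordinate of \<open>v\<close> exceeds \<rho> + |y|, then both v_i and
      v_i + s y_i lie outside the support, because s \<le> 1, and both products vanish. Otherwise
      |v| is at most n (\<rho> + |y|), and the weight in \<open>v\<close> becomes polynomial growth
      in \<open>y\<close>.\<close>
    proof (cases "\<exists>i. \<rho> + norm y < \<bar>v $ i\<bar>")
      case True
      then obtain i where i: "\<rho> + norm y < \<bar>v $ i\<bar>" by blast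
      then have "\<rho> < \<bar>v $ i\<bar>" "\<rho> < \<bar>v $ i + s * y $ i\<bar>"
        using syi[of i] by auto
      then have "?a i = 0" "?b i = 0"
        using \<rho>[of "v $ i + s * y $ i" 0 i] \<rho>[of "v $ i" _ i] by (auto simp: Taylor_poly_def)
      then have "prod ?a UNIV = 0" "prod ?b UNIV = 0"
        by (meson UNIV_I finite_class.finite_UNIV prod_zero)+
      then have "\<bar>prod ?a UNIV - prod ?b UNIV\<bar> = 0"
        by linarith
      then show ?thesis
        unfolding \<open>\<bar>prod ?a UNIV - prod ?b UNIV\<bar> = 0\<close> using \<open>0 \<le> K\<close> s by simp
    next
      case False
      then have vi: "\<bar>v $ i\<bar> \<le> \<rho> + norm y" for i
        by (meson not_le)
      have "norm v \<le> (\<Sum>i\<in>UNIV. \<bar>v $ i\<bar>)"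
        by (rule norm_le_l1_cart)
      also have "\<dots> \<le> real ?n * (\<rho> + norm y)"
        using vi by (intro sum_bounded_above) auto
      finally have "1 + norm v \<le> real ?n * (1 + \<rho> + norm y)"
        using n unfolding distrib_left by linarith
      also have "\<dots> \<le> real ?n * ((1 + \<rho>) * ?Y)"
        using \<open>0 \<le> \<rho>\<close> by (intro mult_left_mono) (auto simp: algebra_simps)
      finally have "(1 + norm v) ^ m \<le> (real ?n * (1 + \<rho>) * ?Y) ^ m"
        by (intro power_mono) (auto simp: mult.assoc)
      then have "(1 + norm v) ^ m * \<bar>prod ?a UNIV - prod ?b UNIV\<bar> \<le> (real ?n * (1 + \<rho>) * ?Y) ^ m * (K0 * s ^ N * ?Y ^ (?n * N + N))"
        using diff \<open>0 \<le> \<rho>\<close> by (intro mult_mono) auto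
      also have "\<dots> = K * s ^ N * ?Y ^ (m + (?n * N + N))"
        by (simp add: K_def power_mult_distrib power_add mult_ac)
      finally show ?thesis .
    qed
  qed
qed

section \<open>Cancellation estimates at small and large scales\<close>

lemma norm_integral_le:
  fixes f :: "'a \<Rightarrow> 'b::{banach, second_countable_topology}"
  assumes "integrable M f" "integrable M g" "\<And>x. norm (f x) \<le> g x"
  shows "norm (integral\<^sup>L M f) \<le> integral\<^sup>L M g"
proof -
  have "norm (integral\<^sup>L M f) \<le> (LINT x|M. norm (f x))"
    by (rule integral_norm_bound)
  also have "\<dots> \<le> integral\<^sup>L M g"
    using assms by (intro integral_mono) auto
  finally show ?thesis .
qed

lemma Cc_continuous: "h \<in> Cc N \<Longrightarrow> continuous_on UNIV h"
proof (cases N)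
  case (Suc n)
  moreover assume "h \<in> Cc N"
  ultimately have "h differentiable (at x)" for x
    by (force simp: Cc_def dest: spec[of _ 0])
  then show ?thesis
    by (intro continuous_at_imp_continuous_on ballI) (simp add: differentiable_imp_continuous_within)
qed (simp add: Cc_def)

lemma Cc_measurable: "h \<in> Cc N \<Longrightarrow> h \<in> borel_measurable borel"
  by (rule borel_measurable_continuous_onI[OF Cc_continuous])

text \<open>This is the pairing after rescaling when the cube of \<open>f\<close> is the smaller
  one: \<open>s\<close> is the ratio of the sides and \<open>v\<close> the displacement in units of
  the larger side. The product of the Taylor polynomials integrates to 0 against \<open>f\<close>,
  so only the remainder of order s^N counts.\<close>

lemma small_scale_bound:
  fixes h :: "'n::finite \<Rightarrow> real \<Rightarrow> real"
  assumes h: "\<And>i. h i \<in> Cc N" and f: "f \<in> S_infty"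
  obtains C where "\<And>s v. 0 < s \<Longrightarrow> s \<le> 1 \<Longrightarrow>
    (1 + norm v) ^ m * cmod (LINT y|lborel. f y * complex_of_real (\<Prod>i\<in>UNIV. h i ((v + s *\<^sub>R y) $ i))) \<le> C * s ^ N"
proof -
  have "\<exists>K p. 0 \<le> K \<and> (\<forall>s v y. 0 < s \<longrightarrow> s \<le> 1 \<longrightarrow>
     (1 + norm v) ^ m * \<bar>(\<Prod>i\<in>UNIV. h i (v $ i + s * y $ i)) - (\<Prod>i\<in>UNIV. Taylor_poly N (h i) (v $ i) (s * y $ i))\<bar>
       \<le> K * s ^ N * (1 + norm y) ^ p)"
    by (rule Taylor_product_bound[of h N m, OF h]) blast
  then obtain K p where K: "0 \<le> K" "\<And>s v y. 0 < s \<Longrightarrow> s \<le> 1 \<Longrightarrow>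
     (1 + norm v) ^ m * \<bar>(\<Prod>i\<in>UNIV. h i (v $ i + s * y $ i)) - (\<Prod>i\<in>UNIV. Taylor_poly N (h i) (v $ i) (s * y $ i))\<bar>
       \<le> K * s ^ N * (1 + norm y) ^ p"
    by blast
  have f_schwartz: "f \<in> schwartz" and moments: "\<And>\<alpha>. (LINT x|lborel. monomial \<alpha> x *\<^sub>R f x) = 0"
    using f by (auto simp: S_infty_def)
  have rapid: "rapidly_decreasing f" and [measurable]: "f \<in> borel_measurable borel"
    using schwartz_rapidly_decreasing[OF f_schwartz, of "[]"] schwartz_measurable[OF f_schwartz, of "[]"]
    by (simp_all add: partials_def)
  have h_meas [measurable]: "h i \<in> borel_measurable borel" for i
    using h by (rule Cc_measurable)
  let ?w = "\<lambda>y. (1 + norm y) ^ p *\<^sub>R f y"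
  have w: "integrable lborel ?w"
    by (intro rapidly_decreasing_integrable rapidly_decreasing_dominated[OF rapid, of _ 1 p]) auto
  show ?thesis
  proof (rule that[of "K * (LINT y|lborel. norm (?w y))"])
    fix s :: real and v :: "real^'n"
    assume s: "0 < s" "s \<le> 1"
    define a where "a y = (\<Prod>i\<in>UNIV. h i (v $ i + s * y $ i))" for y :: "real^'n"
    define b where "b y = (\<Prod>i\<in>UNIV. Taylor_poly N (h i) (v $ i) (s * y $ i))" for y :: "real^'n"
    have [measurable]: "a \<in> borel_measurable borel" "b \<in> borel_measurable borel"
      unfolding a_def b_def Taylor_poly_def by measurable
    have ab: "(1 + norm v) ^ m * \<bar>a y - b y\<bar> \<le> K * s ^ N * (1 + norm y) ^ p" for y
      using K(2)[OF s] by (simp add: a_def b_def)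
    \<comment> \<open>The weight in \<open>v\<close> is at least 1; without it the bound is of
      polynomial growth in y, which gives integrability against \<open>f\<close>.\<close>
    have ab': "\<bar>a y - b y\<bar> \<le> K * s ^ N * (1 + norm y) ^ p" for y
    proof -
      have "1 * \<bar>a y - b y\<bar> \<le> (1 + norm v) ^ m * \<bar>a y - b y\<bar>"
        by (intro mult_right_mono one_le_power) auto
      from order_trans[OF this ab[of y]] show ?thesis by simp
    qed
    have diff: "integrable lborel (\<lambda>y. f y * complex_of_real (a y - b y))"
    proof (intro rapidly_decreasing_integrable rapidly_decreasing_dominated[OF rapid, of _ "K * s ^ N" p])
      show "norm (f y * complex_of_real (a y - b y)) \<le> K * s ^ N * (1 + norm y) ^ p * norm (f y)" for y
        using mult_right_mono[OF ab'[of y], of "norm (f y)"] by (simp add: norm_mult mult.commute flip: of_real_diff)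
    qed measurable
    define c where "c i k = (deriv ^^ k) (h i) (v $ i) / fact k * s ^ k" for i k
    \<comment> \<open>Multiplying out the product of one-variable polynomials: each function
      \<open>g\<close> in \<open>?F\<close> selects one exponent per coordinate and produces
      \<open>monomial g\<close>.\<close>
    let ?F = "PiE (UNIV :: 'n set) (\<lambda>_. {..<N})"
    have b_eq: "b y = (\<Sum>g\<in>?F. (\<Prod>i\<in>UNIV. c i (g i)) * monomial g y)" for y
    proof -
      have "b y = (\<Prod>i\<in>UNIV. \<Sum>k<N. c i k * (y $ i) ^ k)"
        by (simp add: b_def Taylor_poly_def c_def power_mult_distrib mult.assoc)
      also have "\<dots> = (\<Sum>g\<in>?F. \<Prod>i\<in>UNIV. c i (g i) * (y $ i) ^ g i)"
        by (rule prod_sum_PiE) auto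
      finally show ?thesis
        by (simp add: prod.distrib monomial_def)
    qed
    have mon_int: "integrable lborel (\<lambda>y. monomial g y *\<^sub>R f y)" for g
      by (intro rapidly_decreasing_integrable rapidly_decreasing_monomial rapid) measurable
    have fb: "f y * complex_of_real (b y) = (\<Sum>g\<in>?F. (\<Prod>i\<in>UNIV. c i (g i)) *\<^sub>R (monomial g y *\<^sub>R f y))" for y
      by (simp add: b_eq scaleR_conv_of_real sum_distrib_left mult_ac)
    have b_int: "integrable lborel (\<lambda>y. f y * complex_of_real (b y))"
      unfolding fb by (intro Bochner_Integration.integrable_sum integrable_scaleR_right mon_int)
    have b_zero: "(LINT y|lborel. f y * complex_of_real (b y)) = 0"
    proof -
      have "(LINT y|lborel. f y * complex_of_real (b y)) = (\<Sum>g\<in>?F. LINT y|lborel. (\<Prod>i\<in>UNIV. c i (g i)) *\<^sub>R (monomial g y *\<^sub>R f y))"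
        unfolding fb by (intro Bochner_Integration.integral_sum integrable_scaleR_right mon_int)
      also have "\<dots> = 0"
        by (simp only: integral_scaleR_right moments scaleR_zero_right sum.neutral_const)
      finally show ?thesis .
    qed
    have "f y * complex_of_real (a y) = f y * complex_of_real (a y - b y) + f y * complex_of_real (b y)" for y
      by (simp add: algebra_simps)
    then have "(LINT y|lborel. f y * complex_of_real (a y)) = (LINT y|lborel. f y * complex_of_real (a y - b y))"
      using diff b_int b_zero by simp
    then have "(1 + norm v) ^ m * cmod (LINT y|lborel. f y * complex_of_real (a y))
        = norm (LINT y|lborel. (1 + norm v) ^ m *\<^sub>R (f y * complex_of_real (a y - b y)))"
      by simp
    also have "\<dots> \<le> (LINT y|lborel. K * s ^ N * norm (?w y))"
    proof (rule norm_integral_le)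
      show "integrable lborel (\<lambda>y. (1 + norm v) ^ m *\<^sub>R (f y * complex_of_real (a y - b y)))"
        using diff by (rule integrable_scaleR_right)
      show "integrable lborel (\<lambda>y. K * s ^ N * norm (?w y))"
        using w by (intro integrable_mult_right integrable_norm)
      show "norm ((1 + norm v) ^ m *\<^sub>R (f y * complex_of_real (a y - b y))) \<le> K * s ^ N * norm (?w y)" for y
        using mult_right_mono[OF ab[of y], of "norm (f y)"]
        by (simp add: norm_mult power_abs mult_ac flip: of_real_diff)
    qed
    finally show "(1 + norm v) ^ m * cmod (LINT y|lborel. f y * complex_of_real (\<Prod>i\<in>UNIV. h i ((v + s *\<^sub>R y) $ i)))
        \<le> K * (LINT y|lborel. norm (?w y)) * s ^ N"
      by (simp add: a_def mult_ac)
  qed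
qed

text \<open>The k-th derivative in t of \<open>partials is f\<close> along t \<mapsto> u + t z,
  written out by iterating the directional derivative. Collecting the directions in the list keeps
  the polynomial dependence on \<open>z\<close> explicit, which is what the moment conditions act
  on.\<close>

primrec line_deriv :: "nat \<Rightarrow> (real^'n::finite \<Rightarrow> complex) \<Rightarrow> real^'n \<Rightarrow> real^'n \<Rightarrow> 'n list \<Rightarrow> real \<Rightarrow> complex" where
  "line_deriv 0 f u z is t = partials is f (u + t *\<^sub>R z)"
| "line_deriv (Suc k) f u z is t = (\<Sum>i\<in>UNIV. (z $ i) *\<^sub>R line_deriv k f u z (i # is) t)"

lemma line_deriv_has_vector_derivative:
  assumes f: "f \<in> schwartz"
  shows "(line_deriv k f u z is has_vector_derivative line_deriv (Suc k) f u z is t) (at t within S)"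
proof (induction k arbitrary: "is")
  case 0
  let ?x = "u + t *\<^sub>R z" and ?h = "partials is f"
  have diff: "?h differentiable (at ?x)"
    by (rule schwartz_differentiable[OF f])
  have "frechet_derivative ?h (at ?x) z = frechet_derivative ?h (at ?x) (\<Sum>i\<in>UNIV. z $ i *\<^sub>R axis i 1)"
    by (simp add: basis_expansion[where 'a=real, unfolded scalar_mult_eq_scaleR])
  also have "\<dots> = (\<Sum>i\<in>UNIV. z $ i *\<^sub>R partial_deriv i ?h ?x)"
    using linear_frechet_derivative[OF diff] by (simp add: linear_sum linear_cmul partial_deriv_eq[OF diff])
  also have "\<dots> = line_deriv (Suc 0) f u z is t"
    by (simp add: partials_def)
  finally show ?case
    using has_vector_derivative_along_line[OF diff, of S] by simp
next
  case (Suc k)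
  have "((\<lambda>t. \<Sum>i\<in>UNIV. (z $ i) *\<^sub>R line_deriv k f u z (i # is) t) has_vector_derivative
      (\<Sum>i\<in>UNIV. (z $ i) *\<^sub>R line_deriv (Suc k) f u z (i # is) t)) (at t within S)"
    by (intro has_vector_derivative_sum bounded_linear.has_vector_derivative[OF bounded_linear_scaleR_right] Suc.IH)
  then show ?case
    by (simp del: line_deriv.simps add: line_deriv.simps(2)[of k f u z "is", abs_def] line_deriv.simps(2)[of "Suc k"])
qed

text \<open>For t between 0 and 1 one has 1 + |u| \<le> (1 + |z|)(1 + |u + t z|). The weight in
  \<open>u\<close> is thus absorbed by the decay at u + t z at the price of m powers of 1 + |z|, and
  each directional derivative costs one more.\<close>

lemma line_deriv_bound:
  assumes f: "f \<in> schwartz"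
  shows "\<exists>K. \<forall>u z t. 0 \<le> t \<longrightarrow> t \<le> 1 \<longrightarrow>
    (1 + norm u) ^ m * norm (line_deriv k f u z is t) \<le> K * (1 + norm z) ^ (m + k)"
proof (induction k arbitrary: "is")
  case 0
  obtain C where C: "0 \<le> C" "\<And>x. (1 + norm x) ^ m * norm (partials is f x) \<le> C"
    using rapidly_decreasing_bound[OF schwartz_rapidly_decreasing[OF f]] by blast
  have "(1 + norm u) ^ m * norm (partials is f (u + t *\<^sub>R z)) \<le> C * (1 + norm z) ^ m"
    if t: "0 \<le> t" "t \<le> 1" for u z :: "real^'a" and t
  proof -
    let ?x = "u + t *\<^sub>R z"
    have "norm (t *\<^sub>R z) \<le> norm z"
      using t mult_right_mono[of t 1 "norm z"] by simp
    then have "norm u \<le> norm ?x + norm z"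
      using norm_triangle_ineq4[of ?x "t *\<^sub>R z"] by simp
    then have "1 + norm u \<le> (1 + norm z) * (1 + norm ?x)"
    proof -
      have "(1 + norm z) * (1 + norm ?x) = 1 + norm z + norm ?x + norm z * norm ?x"
        by (simp add: algebra_simps)
      moreover have "0 \<le> norm z * norm ?x" by simp
      ultimately show ?thesis
        using \<open>norm u \<le> norm ?x + norm z\<close> by linarith
    qed
    then have "(1 + norm u) ^ m \<le> ((1 + norm z) * (1 + norm ?x)) ^ m"
      by (intro power_mono) auto
    then have "(1 + norm u) ^ m * norm (partials is f ?x) \<le> ((1 + norm z) * (1 + norm ?x)) ^ m * norm (partials is f ?x)"
      by (intro mult_right_mono) auto
    also have "\<dots> = (1 + norm z) ^ m * ((1 + norm ?x) ^ m * norm (partials is f ?x))"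
      by (simp add: power_mult_distrib)
    also have "\<dots> \<le> (1 + norm z) ^ m * C"
      using C by (intro mult_left_mono) auto
    finally show ?thesis by (simp add: mult.commute)
  qed
  then show ?case by auto
next
  case (Suc k)
  have "\<forall>i. \<exists>K. \<forall>u z t. 0 \<le> t \<longrightarrow> t \<le> 1 \<longrightarrow>
      (1 + norm u) ^ m * norm (line_deriv k f u z (i # is) t) \<le> K * (1 + norm z) ^ (m + k)"
    using Suc by blast
  from choice[OF this] obtain K where K: "\<And>i u z t. 0 \<le> t \<Longrightarrow> t \<le> 1 \<Longrightarrow>
      (1 + norm u) ^ m * norm (line_deriv k f u z (i # is) t) \<le> K i * (1 + norm z) ^ (m + k)"
    by blast
  have "(1 + norm u) ^ m * norm (line_deriv (Suc k) f u z is t) \<le> (\<Sum>i\<in>UNIV. K i) * (1 + norm z) ^ (m + Suc k)"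
    if t: "0 \<le> t" "t \<le> 1" for u z :: "real^'a" and t
  proof -
    have "norm (line_deriv (Suc k) f u z is t) \<le> (\<Sum>i\<in>UNIV. \<bar>z $ i\<bar> * norm (line_deriv k f u z (i # is) t))"
      using norm_sum[of "\<lambda>i. (z $ i) *\<^sub>R line_deriv k f u z (i # is) t" UNIV] by simp
    then have "(1 + norm u) ^ m * norm (line_deriv (Suc k) f u z is t)
        \<le> (1 + norm u) ^ m * (\<Sum>i\<in>UNIV. \<bar>z $ i\<bar> * norm (line_deriv k f u z (i # is) t))"
      by (intro mult_left_mono) auto
    also have "\<dots> = (\<Sum>i\<in>UNIV. \<bar>z $ i\<bar> * ((1 + norm u) ^ m * norm (line_deriv k f u z (i # is) t)))"
      by (simp add: sum_distrib_left mult_ac)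
    also have "\<dots> \<le> (\<Sum>i\<in>UNIV. (1 + norm z) * (K i * (1 + norm z) ^ (m + k)))"
    proof (rule sum_mono)
      fix i
      have "\<bar>z $ i\<bar> \<le> 1 + norm z"
        using component_le_norm_cart[of z i] by linarith
      then show "\<bar>z $ i\<bar> * ((1 + norm u) ^ m * norm (line_deriv k f u z (i # is) t)) \<le> (1 + norm z) * (K i * (1 + norm z) ^ (m + k))"
        by (rule mult_mono[OF _ K[OF t]]) auto
    qed
    also have "\<dots> = (\<Sum>i\<in>UNIV. K i) * (1 + norm z) ^ (m + Suc k)"
      by (simp add: sum_distrib_right mult_ac)
    finally show ?thesis .
  qed
  then show ?case by blast
qed

lemma line_deriv_measurable:
  assumes f: "f \<in> schwartz"
  shows "(\<lambda>z. line_deriv k f u z is t) \<in> borel_measurable borel"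
proof (induction k arbitrary: "is")
  case 0
  note [measurable] = schwartz_measurable[OF f]
  show ?case by simp
next
  case (Suc k)
  note [measurable] = this
  show ?case by simp
qed

text \<open>At t = 0 and for fixed \<open>u\<close>, \<open>line_deriv k\<close> is a homogeneous
  polynomial of degree k in z. The monomial is present for the sake of the induction: each step
  moves one coordinate of z out of \<open>line_deriv\<close> into it, with the total degree
  unchanged.\<close>

lemma line_deriv_moments:
  fixes f \<Theta> :: "real^'n::finite \<Rightarrow> complex"
  assumes f: "f \<in> schwartz" and \<Theta>: "rapidly_decreasing \<Theta>" "\<Theta> \<in> borel_measurable borel"
    and moments: "\<And>\<alpha>. (\<Sum>i\<in>UNIV. \<alpha> i) \<le> N \<Longrightarrow> (LINT x|lborel. monomial \<alpha> x *\<^sub>R \<Theta> x) = 0"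
  shows "integrable lborel (\<lambda>z. line_deriv k f u z is 0 * (monomial \<alpha> z *\<^sub>R \<Theta> z))"
    and "(\<Sum>i\<in>UNIV. \<alpha> i) + k \<le> N \<Longrightarrow> (LINT z|lborel. line_deriv k f u z is 0 * (monomial \<alpha> z *\<^sub>R \<Theta> z)) = 0"
proof -
  have int: "integrable lborel (\<lambda>z. line_deriv k f u z is 0 * (monomial \<alpha> z *\<^sub>R \<Theta> z))" for k "is" \<alpha>
  proof (rule rapidly_decreasing_integrable)
    obtain K where K: "\<And>u z. (1 + norm u) ^ 0 * norm (line_deriv k f u z is 0) \<le> K * (1 + norm z) ^ (0 + k)"
      using line_deriv_bound[OF f, of 0 k "is"] by fastforce
    show "rapidly_decreasing (\<lambda>z. line_deriv k f u z is 0 * (monomial \<alpha> z *\<^sub>R \<Theta> z))"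
    proof (rule rapidly_decreasing_dominated[OF rapidly_decreasing_monomial[OF \<Theta>(1), of \<alpha>], of _ K k])
      show "norm (line_deriv k f u z is 0 * (monomial \<alpha> z *\<^sub>R \<Theta> z)) \<le> K * (1 + norm z) ^ k * norm (monomial \<alpha> z *\<^sub>R \<Theta> z)" for z
        unfolding norm_mult using K[of u z] by (intro mult_right_mono) auto
    qed
    note [measurable] = line_deriv_measurable[OF f] \<Theta>(2)
    show "(\<lambda>z. line_deriv k f u z is 0 * (monomial \<alpha> z *\<^sub>R \<Theta> z)) \<in> borel_measurable borel"
      by measurable
  qed
  then show "integrable lborel (\<lambda>z. line_deriv k f u z is 0 * (monomial \<alpha> z *\<^sub>R \<Theta> z))" .
  show "(\<Sum>i\<in>UNIV. \<alpha> i) + k \<le> N \<Longrightarrow> (LINT z|lborel. line_deriv k f u z is 0 * (monomial \<alpha> z *\<^sub>R \<Theta> z)) = 0"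
  proof (induction k arbitrary: "is" \<alpha>)
    case 0
    then have "(LINT z|lborel. monomial \<alpha> z *\<^sub>R \<Theta> z) = 0"
      using moments by simp
    then show ?case
      by (simp only: line_deriv.simps scaleR_zero_left add_0_right integral_mult_right_zero mult_zero_right)
  next
    case (Suc k)
    define \<beta> where "\<beta> i = \<alpha>(i := Suc (\<alpha> i))" for i
    have sum\<beta>: "(\<Sum>j\<in>UNIV. \<beta> i j) = Suc (\<Sum>j\<in>UNIV. \<alpha> j)" for i
      unfolding \<beta>_def by (rule sum_fun_upd_Suc)
    have mon\<beta>: "monomial (\<beta> i) z = z $ i * monomial \<alpha> z" for i z
      unfolding \<beta>_def by (rule monomial_fun_upd_Suc)
    have "line_deriv (Suc k) f u z is 0 * (monomial \<alpha> z *\<^sub>R \<Theta> z)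
        = (\<Sum>i\<in>UNIV. line_deriv k f u z (i # is) 0 * (monomial (\<beta> i) z *\<^sub>R \<Theta> z))" for z
      by (simp add: mon\<beta> sum_distrib_left sum_distrib_right scaleR_sum_right mult_ac)
    then have "(LINT z|lborel. line_deriv (Suc k) f u z is 0 * (monomial \<alpha> z *\<^sub>R \<Theta> z))
        = (LINT z|lborel. (\<Sum>i\<in>UNIV. line_deriv k f u z (i # is) 0 * (monomial (\<beta> i) z *\<^sub>R \<Theta> z)))"
      by presburger
    also have "\<dots> = (\<Sum>i\<in>UNIV. LINT z|lborel. line_deriv k f u z (i # is) 0 * (monomial (\<beta> i) z *\<^sub>R \<Theta> z))"
      by (intro Bochner_Integration.integral_sum int)
    also have "\<dots> = 0"
      using Suc by (simp add: sum\<beta>)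
    finally show ?case .
  qed
qed

text \<open>Here the wavelet has vanishing moments only up to total order \<open>N\<close>, so \<open>f\<close> is expanded along lines, which
  produces Taylor polynomials of total degree less than \<open>N\<close>.\<close>

lemma large_scale_bound:
  fixes f \<Theta> :: "real^'n::finite \<Rightarrow> complex"
  assumes f: "f \<in> schwartz" and \<Theta>: "rapidly_decreasing \<Theta>" "\<Theta> \<in> borel_measurable borel"
    and moments: "\<And>\<alpha>. (\<Sum>i\<in>UNIV. \<alpha> i) \<le> N \<Longrightarrow> (LINT x|lborel. monomial \<alpha> x *\<^sub>R \<Theta> x) = 0"
  obtains C where "\<And>b u. 0 < b \<Longrightarrow> b \<le> 1 \<Longrightarrow>
    (1 + norm u) ^ m * cmod (LINT z|lborel. f (u + b *\<^sub>R z) * \<Theta> z) \<le> C * b ^ N"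
proof -
  note [measurable] = line_deriv_measurable[OF f] \<Theta>(2) schwartz_measurable[OF f, of "[]", unfolded partials_def foldr.simps id_apply]
  obtain K where K: "\<And>u z t. 0 \<le> t \<Longrightarrow> t \<le> 1 \<Longrightarrow>
    (1 + norm u) ^ m * norm (line_deriv N f u z [] t) \<le> K * (1 + norm z) ^ (m + N)"
    using line_deriv_bound[OF f, of m N "[]"] by blast
  have "0 \<le> K"
    using K[of 0 0 0] by (smt (verit) mult_nonneg_nonneg norm_ge_zero power_one norm_zero mult_cancel_left1)
  let ?w = "\<lambda>z. (1 + norm z) ^ (m + N) *\<^sub>R \<Theta> z"
  have w: "integrable lborel ?w"
    by (intro rapidly_decreasing_integrable rapidly_decreasing_dominated[OF \<Theta>(1), of _ 1 "m + N"]) auto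
  show ?thesis
  proof (rule that[of "K * (LINT z|lborel. norm (?w z))"])
    fix b :: real and u :: "real^'n"
    assume b: "0 < b" "b \<le> 1"
    define P where "P z = (\<Sum>k<N. (b ^ k / fact k) *\<^sub>R line_deriv k f u z [] 0)" for z
    have [measurable]: "P \<in> borel_measurable borel"
      unfolding P_def by measurable
    have err: "(1 + norm u) ^ m * norm (f (u + b *\<^sub>R z) - P z) \<le> K * (1 + norm z) ^ (m + N) * b ^ N" for z
    proof -
      \<comment> \<open>The weight depends only on \<open>u\<close>; it is divided into the bound
        for the derivative and multiplied back after the Taylor estimate.\<close>
      let ?c = "(1 + norm u) ^ m"
      have c: "0 < ?c" by (intro zero_less_power) (simp add: add_pos_nonneg)
      have "norm (line_deriv 0 f u z [] b - (\<Sum>k<N. (b ^ k / fact k) *\<^sub>R line_deriv k f u z [] 0)) \<le> K * (1 + norm z) ^ (m + N) / ?c * b ^ N"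
      proof (rule Taylor_remainder_bound[of "\<lambda>k. line_deriv k f u z []"])
        fix t assume "0 \<le> t" "t \<le> b"
        then show "norm (line_deriv N f u z [] t) \<le> K * (1 + norm z) ^ (m + N) / ?c"
          using K[of t u z] b c by (simp add: pos_le_divide_eq mult.commute)
      qed (use b line_deriv_has_vector_derivative[OF f] in auto)
      then have "norm (f (u + b *\<^sub>R z) - P z) \<le> K * (1 + norm z) ^ (m + N) / ?c * b ^ N"
        by (simp add: P_def partials_def)
      then have "?c * norm (f (u + b *\<^sub>R z) - P z) \<le> ?c * (K * (1 + norm z) ^ (m + N) / ?c * b ^ N)"
        using c by (intro mult_left_mono) auto
      moreover have "1 + norm u \<noteq> 0"
        using norm_ge_zero[of u] by linarith
      ultimately show ?thesis by (simp add: mult.assoc)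
    qed
    have err': "norm (f (u + b *\<^sub>R z) - P z) \<le> K * b ^ N * (1 + norm z) ^ (m + N)" for z
    proof -
      have "1 * norm (f (u + b *\<^sub>R z) - P z) \<le> (1 + norm u) ^ m * norm (f (u + b *\<^sub>R z) - P z)"
        by (intro mult_right_mono one_le_power) auto
      then show ?thesis using err[of z] by (simp add: mult_ac)
    qed
    have diff: "integrable lborel (\<lambda>z. (f (u + b *\<^sub>R z) - P z) * \<Theta> z)"
    proof (intro rapidly_decreasing_integrable rapidly_decreasing_dominated[OF \<Theta>(1), of _ "K * b ^ N" "m + N"])
      show "norm ((f (u + b *\<^sub>R z) - P z) * \<Theta> z) \<le> K * b ^ N * (1 + norm z) ^ (m + N) * norm (\<Theta> z)" for z
        unfolding norm_mult by (intro mult_right_mono err') auto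
    qed measurable
    \<comment> \<open>The monomial with exponent 0 is the constant 1, inserted to match
      \<open>line_deriv_moments\<close>.\<close>
    have line: "integrable lborel (\<lambda>z. line_deriv k f u z [] 0 * (monomial (\<lambda>_. 0) z *\<^sub>R \<Theta> z))"
      "k \<le> N \<Longrightarrow> (LINT z|lborel. line_deriv k f u z [] 0 * (monomial (\<lambda>_. 0) z *\<^sub>R \<Theta> z)) = 0" for k
      by (rule line_deriv_moments(1)[OF f \<Theta>], erule moments)
         (rule line_deriv_moments(2)[OF f \<Theta>, of N], erule moments, simp)
    have one: "monomial (\<lambda>_. 0) z = 1" for z :: "real^'n"
      by (simp add: monomial_def)
    have P_eq: "P z * \<Theta> z = (\<Sum>k<N. (b ^ k / fact k) *\<^sub>R (line_deriv k f u z [] 0 * (monomial (\<lambda>_. 0) z *\<^sub>R \<Theta> z)))" for z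
      by (simp add: P_def sum_distrib_right one)
    have P_int: "integrable lborel (\<lambda>z. P z * \<Theta> z)"
      unfolding P_eq by (intro Bochner_Integration.integrable_sum integrable_scaleR_right line(1))
    have P_zero: "(LINT z|lborel. P z * \<Theta> z) = 0"
    proof -
      have "(LINT z|lborel. P z * \<Theta> z) = (\<Sum>k<N. LINT z|lborel. (b ^ k / fact k) *\<^sub>R (line_deriv k f u z [] 0 * (monomial (\<lambda>_. 0) z *\<^sub>R \<Theta> z)))"
        unfolding P_eq by (intro Bochner_Integration.integral_sum integrable_scaleR_right line(1))
      also have "\<dots> = 0"
        by (intro sum.neutral ballI) (simp only: integral_scaleR_right line(2) lessThan_iff less_imp_le scaleR_zero_right)
      finally show ?thesis .
    qed
    have "f (u + b *\<^sub>R z) * \<Theta> z = (f (u + b *\<^sub>R z) - P z) * \<Theta> z + P z * \<Theta> z" for z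
      by (simp add: algebra_simps)
    then have "(LINT z|lborel. f (u + b *\<^sub>R z) * \<Theta> z) = (LINT z|lborel. (f (u + b *\<^sub>R z) - P z) * \<Theta> z)"
      using diff P_int P_zero by simp
    then have "(1 + norm u) ^ m * cmod (LINT z|lborel. f (u + b *\<^sub>R z) * \<Theta> z)
        = norm (LINT z|lborel. (1 + norm u) ^ m *\<^sub>R ((f (u + b *\<^sub>R z) - P z) * \<Theta> z))"
      by simp
    also have "\<dots> \<le> (LINT z|lborel. K * b ^ N * norm (?w z))"
    proof (rule norm_integral_le)
      show "integrable lborel (\<lambda>z. (1 + norm u) ^ m *\<^sub>R ((f (u + b *\<^sub>R z) - P z) * \<Theta> z))"
        using diff by (rule integrable_scaleR_right)
      show "integrable lborel (\<lambda>z. K * b ^ N * norm (?w z))"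
        using w by (intro integrable_mult_right integrable_norm)
      show "norm ((1 + norm u) ^ m *\<^sub>R ((f (u + b *\<^sub>R z) - P z) * \<Theta> z)) \<le> K * b ^ N * norm (?w z)" for z
        using mult_right_mono[OF err[of z], of "norm (\<Theta> z)"]
        by (simp add: norm_mult power_abs mult_ac)
    qed
    finally show "(1 + norm u) ^ m * cmod (LINT z|lborel. f (u + b *\<^sub>R z) * \<Theta> z) \<le> K * (LINT z|lborel. norm (?w z)) * b ^ N"
      by (simp add: mult_ac)
  qed
qed

section \<open>Almost diagonality of the wavelet coefficients\<close>

lemma side_simps [simp]: "\<bar>side Q\<bar> = side Q" "side Q \<noteq> 0"
  using side_pos[of Q] by linarith+

lemma pair_commute: "pair f h = pair h f"
  by (simp add: pair_def mult.commute)

text \<open>In the coordinates of \<open>R\<close>, the Jacobian |R| and the two normalisations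
  combine to (|R| / |Q|)^(1/2), the origin of n/2 in the exponents. Because \<open>pair\<close> is
  symmetric, the coordinates of either cube can be used.\<close>

lemma pair_adapt_affine:
  fixes f h :: "real^'n::finite \<Rightarrow> complex"
  assumes [measurable]: "f \<in> borel_measurable borel" "h \<in> borel_measurable borel"
  shows "pair (adapt f R) (adapt h Q) =
    (volume R powr (1/2) * volume Q powr (- 1/2)) *\<^sub>R
      (LINT y|lborel. f y * h ((corner R - corner Q) /\<^sub>R side Q + (side R / side Q) *\<^sub>R y))"
proof -
  have side: "side R \<noteq> 0" "\<bar>side R\<bar> = side R"
    using side_pos[of R] by linarith+
  have vol: "side R ^ CARD('n) = volume R powr (1/2) * volume R powr (1/2)"
  proof -
    have "volume R powr (1/2) * volume R powr (1/2) = \<bar>volume R\<bar>"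
      by (simp flip: powr_add)
    also have "\<dots> = volume R"
      by (rule abs_of_pos[OF volume_pos])
    finally show ?thesis
      by (simp only: volume_def)
  qed
  have volR: "volume R powr (1/2) * volume R powr (- (1/2)) = 1"
    using less_imp_neq[OF volume_pos[of R]] by (simp flip: powr_add)
  have "pair (adapt f R) (adapt h Q) = \<bar>side R\<bar> ^ DIM(real^'n) *\<^sub>R
      (LINT y|lborel. adapt f R (corner R + side R *\<^sub>R y) * adapt h Q (corner R + side R *\<^sub>R y))"
    unfolding pair_def by (rule lborel_integral_affine[OF _ side(1)]) (unfold adapt_def, measurable)
  also have "(\<lambda>y. adapt f R (corner R + side R *\<^sub>R y) * adapt h Q (corner R + side R *\<^sub>R y))
      = (\<lambda>y. (volume R powr (- 1/2) * volume Q powr (- 1/2)) *\<^sub>R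
          (f y * h ((corner R - corner Q) /\<^sub>R side Q + (side R / side Q) *\<^sub>R y)))"
  proof
    fix y
    have "(corner R + side R *\<^sub>R y - corner R) /\<^sub>R side R = y"
      using side by simp
    moreover have "(corner R + side R *\<^sub>R y - corner Q) /\<^sub>R side Q = (corner R - corner Q) /\<^sub>R side Q + (side R / side Q) *\<^sub>R y"
      by (simp add: scaleR_add_right scaleR_diff_right divide_inverse mult.commute)
    ultimately show "adapt f R (corner R + side R *\<^sub>R y) * adapt h Q (corner R + side R *\<^sub>R y) =
        (volume R powr (- 1/2) * volume Q powr (- 1/2)) *\<^sub>R
          (f y * h ((corner R - corner Q) /\<^sub>R side Q + (side R / side Q) *\<^sub>R y))"
      unfolding adapt_def by simp
  qed
  also have "\<bar>side R\<bar> ^ DIM(real^'n) *\<^sub>R (LINT y|lborel. (volume R powr (- 1/2) * volume Q powr (- 1/2)) *\<^sub>R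
          (f y * h ((corner R - corner Q) /\<^sub>R side Q + (side R / side Q) *\<^sub>R y)))
      = (volume R powr (1/2) * (volume R powr (1/2) * volume R powr (- (1/2))) * volume Q powr (- 1/2)) *\<^sub>R
      (LINT y|lborel. f y * h ((corner R - corner Q) /\<^sub>R side Q + (side R / side Q) *\<^sub>R y))"
    by (simp add: side vol mult_ac)
  finally show ?thesis
    unfolding volR by simp
qed

lemma volume_powr_ratio:
  fixes Q R :: "'n::finite cube"
  shows "volume R powr (1/2) * volume Q powr (- 1/2) = (side R / side Q) powr (real CARD('n) / 2)"
proof -
  let ?k = "real CARD('n) / 2"
  have "volume S powr a = side S powr (real CARD('n) * a)" for a and S :: "'n cube"
    by (simp add: volume_def powr_powr flip: powr_realpow)
  then have "volume R powr (1/2) * volume Q powr (- 1/2) = side R powr (real CARD('n) * (1/2)) * side Q powr (real CARD('n) * (- 1/2))"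
    by (simp only:)
  also have "\<dots> = side R powr ?k * inverse (side Q powr ?k)"
    by (simp flip: powr_minus)
  also have "\<dots> = side R powr ?k / side Q powr ?k"
    by (rule divide_inverse[symmetric])
  also have "\<dots> = (side R / side Q) powr ?k"
    by (intro powr_divide[symmetric] less_imp_le side_pos)
  finally show ?thesis .
qed

text \<open>For s = a / b \<le> 1 one has 1 + s \<le> 2 and 1 + 1/s \<le> 2/s, so s (1 + s)(1 + 1/s)
  \<le> 4. A power of the smaller over the larger side therefore yields both scale factors of
  \<open>almost_diagonal\<close> with the same exponent.\<close>

lemma min_max_powr_le:
  fixes a b e :: real
  assumes "0 < a" "a \<le> b" "0 \<le> e"
  shows "(a / b) powr e \<le> 4 powr e * (1 + a / b) powr (- e) * (1 + b / a) powr (- e)"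
proof -
  define s where "s = a / b"
  have "0 < b" using assms by linarith
  then have s: "0 < s" "s \<le> 1" using assms by (simp_all add: s_def)
  have ba: "b / a = 1 / s" using assms by (simp add: s_def)
  have "1 \<le> 1 / s"
    using s by simp
  then have "1 + 1 / s \<le> 2 / s" "0 \<le> 1 + 1 / s"
    by linarith+
  then have "(1 + s) * (1 + 1 / s) \<le> 2 * (2 / s)"
    using s by (intro mult_mono) auto
  then have "s * ((1 + s) * (1 + 1 / s)) \<le> s * (2 * (2 / s))"
    using s by (intro mult_left_mono) auto
  also have "\<dots> = 4" using s by simp
  finally have "s powr e * ((1 + s) powr e * (1 + 1 / s) powr e) \<le> 4 powr e"
    using s \<open>0 \<le> e\<close> by (simp add: powr_mono2 add_pos_pos flip: powr_mult)
  moreover have "1 + s \<noteq> 0" "1 + 1 / s \<noteq> 0"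
    using s \<open>1 \<le> 1 / s\<close> by linarith+
  then have "0 < (1 + s) powr e * (1 + 1 / s) powr e"
    by simp
  ultimately have "s powr e \<le> 4 powr e / ((1 + s) powr e * (1 + 1 / s) powr e)"
    by (simp only: pos_le_divide_eq)
  then show ?thesis
    unfolding s_def[symmetric] ba powr_minus by (simp add: divide_inverse mult.assoc)
qed

lemma rapidly_decreasing_tensor:
  fixes h :: "'n::finite \<Rightarrow> real \<Rightarrow> real"
  assumes h: "\<And>i. h i \<in> Cc N"
  shows "rapidly_decreasing (\<lambda>x::real^'n. complex_of_real (\<Prod>i\<in>UNIV. h i (x $ i)))"
  unfolding rapidly_decreasing_def
proof
  fix m
  let ?n = "real CARD('n)"
  have "\<exists>M \<rho>. 0 \<le> M \<and> 0 \<le> \<rho> \<and> (\<forall>x. \<bar>h i x\<bar> \<le> M) \<and> (\<forall>x. \<rho> < \<bar>x\<bar> \<longrightarrow> h i x = 0)" for i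
  proof (rule Cc_bounds[OF h[of i]])
    fix M \<rho> assume "0 \<le> M" "0 \<le> \<rho>" "\<And>k x. k \<le> N \<Longrightarrow> \<bar>(deriv ^^ k) (h i) x\<bar> \<le> M"
      "\<And>k x. \<rho> < \<bar>x\<bar> \<Longrightarrow> (deriv ^^ k) (h i) x = 0"
    from this(1,2) this(3)[of 0] this(4)[of _ 0] show ?thesis by auto
  qed
  then obtain M \<rho> where M: "\<And>i. 0 \<le> M i" "\<And>i x. \<bar>h i x\<bar> \<le> M i"
    and \<rho>: "\<And>i. 0 \<le> \<rho> i" "\<And>i x. \<rho> i < \<bar>x\<bar> \<Longrightarrow> h i x = 0"
    by metis
  define r where "r = (\<Sum>i\<in>UNIV. \<rho> i)"
  have r: "0 \<le> r"
    unfolding r_def by (auto intro!: sum_nonneg \<rho>(1))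
  have "(1 + norm x) ^ m * norm (complex_of_real (\<Prod>i\<in>UNIV. h i (x $ i))) \<le> (1 + r) ^ m * (\<Prod>i\<in>UNIV. M i)" for x :: "real^'n"
  proof (cases "\<exists>i. \<rho> i < \<bar>x $ i\<bar>")
    case True
    then have "(\<Prod>i\<in>UNIV. h i (x $ i)) = 0"
      using \<rho>(2) by (metis UNIV_I finite_class.finite_UNIV prod_zero)
    then show ?thesis
      unfolding \<open>(\<Prod>i\<in>UNIV. h i (x $ i)) = 0\<close> using M r by (simp add: prod_nonneg)
  next
    case False
    then have "\<bar>x $ i\<bar> \<le> \<rho> i" for i by (meson not_le)
    then have "norm x \<le> r"
      unfolding r_def by (intro order_trans[OF norm_le_l1_cart] sum_mono)
    moreover have "norm (complex_of_real (\<Prod>i\<in>UNIV. h i (x $ i))) \<le> (\<Prod>i\<in>UNIV. M i)"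
      unfolding norm_of_real abs_prod by (intro prod_mono conjI M abs_ge_zero)
    ultimately show ?thesis
      using r by (intro mult_mono power_mono) auto
  qed
  then show "\<exists>C. \<forall>x::real^'n. (1 + norm x) ^ m * norm (complex_of_real (\<Prod>i\<in>UNIV. h i (x $ i))) \<le> C" by blast
qed

text \<open>Rescaling to the coordinates of the smaller cube divides the displacement by the larger
  side, exactly as in the weight of \<open>almost_diagonal\<close>. If \<open>R\<close> is not
  larger than \<open>Q\<close>, the cancellation of \<open>f\<close> is used, otherwise that of
  \<open>\<Theta>\<close>.\<close>

lemma pair_adapt_almost_diagonal_bound:
  fixes f :: "real^'n::finite \<Rightarrow> complex" and h :: "'n \<Rightarrow> real \<Rightarrow> real"
  assumes f: "f \<in> S_infty" and h: "\<And>i. h i \<in> Cc N"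
    and \<Theta>_def: "\<Theta> = (\<lambda>x. complex_of_real (\<Prod>i\<in>UNIV. h i (x $ i)))"
    and moments: "\<And>\<alpha>. (\<Sum>i\<in>UNIV. \<alpha> i) \<le> N \<Longrightarrow> (LINT x|lborel. monomial \<alpha> x *\<^sub>R \<Theta> x) = 0"
  defines "e \<equiv> real N + real CARD('n) / 2"
  obtains C where "0 \<le> C" "\<And>R Q. cmod (pair (adapt f R) (adapt \<Theta> Q)) \<le>
     C * (1 + side R / side Q) powr (- e) * (1 + side Q / side R) powr (- e)
       * (1 + norm (corner Q - corner R) / max (side Q) (side R)) powr (- real m)"
proof -
  have f_schwartz: "f \<in> schwartz"
    using f by (auto simp: S_infty_def)
  have f_meas [measurable]: "f \<in> borel_measurable borel"
    using schwartz_measurable[OF f_schwartz, of "[]"] by (simp add: partials_def)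
  have h_meas [measurable]: "h i \<in> borel_measurable borel" for i
    using h by (rule Cc_measurable)
  have \<Theta>_meas [measurable]: "\<Theta> \<in> borel_measurable borel"
    unfolding \<Theta>_def by measurable
  have \<Theta>_rapid: "rapidly_decreasing \<Theta>"
    unfolding \<Theta>_def by (rule rapidly_decreasing_tensor[of h N, OF h])
  obtain C1 where C1: "\<And>s v. 0 < s \<Longrightarrow> s \<le> 1 \<Longrightarrow>
    (1 + norm v) ^ m * cmod (LINT y|lborel. f y * \<Theta> (v + s *\<^sub>R y)) \<le> C1 * s ^ N"
    using small_scale_bound[of h N f m, OF h f] unfolding \<Theta>_def by blast
  obtain C2 where C2: "\<And>b u. 0 < b \<Longrightarrow> b \<le> 1 \<Longrightarrow>
    (1 + norm u) ^ m * cmod (LINT z|lborel. f (u + b *\<^sub>R z) * \<Theta> z) \<le> C2 * b ^ N"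
    using large_scale_bound[OF f_schwartz \<Theta>_rapid \<Theta>_meas, of N m] moments by blast
  \<comment> \<open>4 powr e comes from \<open>min_max_powr_le\<close>; the maximum with 0 is taken
    because \<open>C1\<close> and \<open>C2\<close> carry no sign.\<close>
  define C where "C = (max 0 (max C1 C2)) * 4 powr e"
  have "0 \<le> e" by (simp add: e_def)
  have scale: "(s powr (real CARD('n) / 2)) * (C' * s ^ N) \<le> max 0 (max C1 C2) * s powr e"
    if "0 < s" "C' \<le> max C1 C2" for s C'
  proof -
    have "(s powr (real CARD('n) / 2)) * (C' * s ^ N) = C' * s powr e"
      using that by (simp add: e_def powr_add powr_realpow mult_ac)
    also have "\<dots> \<le> max 0 (max C1 C2) * s powr e"
      using that by (intro mult_right_mono) auto
    finally show ?thesis .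
  qed
  have weight: "c \<le> X * (1 + w) powr (- real m)" if "(1 + w) ^ m * c \<le> X" "0 \<le> w" for c X w :: real
    using that by (simp add: powr_minus powr_realpow add_pos_nonneg field_simps)
  show ?thesis
  proof (rule that[of C])
    show "0 \<le> C" by (simp add: C_def)
    fix R Q :: "'n cube"
    let ?d = "norm (corner Q - corner R)" and ?p = "pair (adapt f R) (adapt \<Theta> Q)"
    have pos: "0 < side R" "0 < side Q" by simp_all
    show "cmod ?p \<le> C * (1 + side R / side Q) powr (- e) * (1 + side Q / side R) powr (- e)
       * (1 + ?d / max (side Q) (side R)) powr (- real m)"
    proof (cases "side R \<le> side Q")
      case True
      let ?s = "side R / side Q" and ?v = "(corner R - corner Q) /\<^sub>R side Q"
      have s: "0 < ?s" "?s \<le> 1" using True pos by auto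
      have v: "norm ?v = ?d / max (side Q) (side R)"
        using True pos by (simp add: norm_minus_commute divide_inverse max_def mult.commute)
      have "(1 + norm ?v) ^ m * cmod ?p = ?s powr (real CARD('n) / 2) * ((1 + norm ?v) ^ m * cmod (LINT y|lborel. f y * \<Theta> (?v + ?s *\<^sub>R y)))"
        unfolding pair_adapt_affine[OF f_meas \<Theta>_meas] volume_powr_ratio by simp
      also have "\<dots> \<le> ?s powr (real CARD('n) / 2) * (C1 * ?s ^ N)"
        by (intro mult_left_mono C1[OF s]) simp
      also have "\<dots> \<le> max 0 (max C1 C2) * ?s powr e"
        using s by (intro scale) auto
      also have "\<dots> \<le> max 0 (max C1 C2) * (4 powr e * (1 + ?s) powr (- e) * (1 + side Q / side R) powr (- e))"
        using True pos \<open>0 \<le> e\<close> by (intro mult_left_mono min_max_powr_le) auto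
      finally show ?thesis
        unfolding v[symmetric] C_def by (intro weight norm_ge_zero) (simp add: mult.assoc)
    next
      case False
      let ?b = "side Q / side R" and ?u = "(corner Q - corner R) /\<^sub>R side R"
      have b: "0 < ?b" "?b \<le> 1" using False pos by auto
      have u: "norm ?u = ?d / max (side Q) (side R)"
        using False pos by (simp add: divide_inverse max_def mult.commute)
      have "(1 + norm ?u) ^ m * cmod ?p = ?b powr (real CARD('n) / 2) * ((1 + norm ?u) ^ m * cmod (LINT z|lborel. f (?u + ?b *\<^sub>R z) * \<Theta> z))"
        unfolding pair_commute[of "adapt f R"] pair_adapt_affine[OF \<Theta>_meas f_meas] volume_powr_ratio by (simp add: mult.commute)
      also have "\<dots> \<le> ?b powr (real CARD('n) / 2) * (C2 * ?b ^ N)"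
        by (intro mult_left_mono C2[OF b]) simp
      also have "\<dots> \<le> max 0 (max C1 C2) * ?b powr e"
        using b by (intro scale) auto
      also have "\<dots> \<le> max 0 (max C1 C2) * (4 powr e * (1 + ?b) powr (- e) * (1 + side R / side Q) powr (- e))"
        using False pos \<open>0 \<le> e\<close> by (intro mult_left_mono min_max_powr_le) auto
      finally show ?thesis
        unfolding u[symmetric] C_def by (intro weight norm_ge_zero) (simp add: mult_ac)
    qed
  qed
qed

section \<open>Parseval identity for the wavelet basis\<close>

lemma L2_mult_integrable:
  assumes "f \<in> L2" "h \<in> L2" shows "integrable lborel (\<lambda>x. f x * h x)"
proof -
  have [measurable]: "f \<in> borel_measurable borel" "h \<in> borel_measurable borel"
    using assms by (auto simp: L2_def)
  have "integrable lborel (\<lambda>x. (cmod (f x))\<^sup>2 + (cmod (h x))\<^sup>2)"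
    using assms by (auto simp: L2_def)
  then show ?thesis
  proof (rule Bochner_Integration.integrable_bound)
    have "norm (f x * h x) \<le> (cmod (f x))\<^sup>2 + (cmod (h x))\<^sup>2" for x
      using sum_squares_bound[of "cmod (f x)" "cmod (h x)"] mult_nonneg_nonneg[OF norm_ge_zero norm_ge_zero, of "f x" "h x"]
      unfolding norm_mult by linarith
    then show "AE x in lborel. norm (f x * h x) \<le> norm ((cmod (f x))\<^sup>2 + (cmod (h x))\<^sup>2)"
      by (intro always_eventually allI) (simp add: order_trans[OF _ abs_ge_self])
  qed simp
qed

text \<open>A Cauchy--Schwarz inequality with a worse constant in \<open>f\<close>, enough for
  continuity in \<open>h\<close>. It follows from |h f| \<le> t |h|^2 + |f|^2 / t by choosing t
  close to the inverse of the norm of \<open>h\<close>.\<close>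

lemma norm_pair_le_L2:
  fixes f h :: "real^'n::finite \<Rightarrow> complex"
  assumes h: "h \<in> L2" and f: "f \<in> L2"
  shows "cmod (pair h f) \<le> (1 + (LINT x|lborel. (cmod (f x))\<^sup>2)) * sqrt (LINT x|lborel. (cmod (h x))\<^sup>2)"
proof -
  let ?a = "LINT x|lborel. (cmod (h x))\<^sup>2" and ?b = "LINT x|lborel. (cmod (f x))\<^sup>2"
  let ?D = "sqrt ?a"
  have int: "integrable lborel (\<lambda>x. (cmod (h x))\<^sup>2)" "integrable lborel (\<lambda>x. (cmod (f x))\<^sup>2)"
    using f h by (auto simp: L2_def)
  have a: "0 \<le> ?a" and b: "0 \<le> ?b" by simp_all
  have AM_GM: "cmod (pair h f) \<le> t * ?a + ?b / t" if t: "0 < t" for t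
  proof -
    have "cmod (pair h f) \<le> (LINT x|lborel. t * (cmod (h x))\<^sup>2 + (cmod (f x))\<^sup>2 / t)"
      unfolding pair_def
    proof (rule norm_integral_le[OF L2_mult_integrable[OF h f]])
      show "integrable lborel (\<lambda>x. t * (cmod (h x))\<^sup>2 + (cmod (f x))\<^sup>2 / t)"
        using int by simp
      fix x
      let ?u = "sqrt t * cmod (h x)" and ?v = "cmod (f x) / sqrt t"
      have "2 * ?u * ?v \<le> ?u\<^sup>2 + ?v\<^sup>2"
        by (rule sum_squares_bound)
      moreover have "?u * ?v = cmod (h x) * cmod (f x)"
        using t by simp
      moreover have "?u\<^sup>2 + ?v\<^sup>2 = t * (cmod (h x))\<^sup>2 + (cmod (f x))\<^sup>2 / t"
        using t by (simp add: power_mult_distrib power_divide)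
      moreover have "0 \<le> cmod (h x) * cmod (f x)" by simp
      ultimately show "norm (h x * f x) \<le> t * (cmod (h x))\<^sup>2 + (cmod (f x))\<^sup>2 / t"
        unfolding norm_mult by linarith
    qed
    also have "\<dots> = t * ?a + ?b / t"
      using int by simp
    finally show ?thesis .
  qed
  define D where "D = ?D"
  have D: "0 \<le> D" "?a = D * D"
    using a by (simp_all add: D_def)
  show ?thesis
    unfolding D_def[symmetric]
  proof (rule field_le_epsilon)
    fix e :: real assume "0 < e"
    \<comment> \<open>The shift by \<open>\<eta>\<close> keeps t = 1 / (D + \<eta>) defined when D =
      0; its size makes the error at most e.\<close>
    define \<eta> where "\<eta> = e / (1 + ?b)"
    have "0 < 1 + ?b" using b by linarith
    with \<open>0 < e\<close> have \<eta>: "0 < \<eta>" and \<eta>_mult: "(1 + ?b) * \<eta> = e"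
      by (simp_all add: \<eta>_def)
    have D\<eta>: "0 < D + \<eta>" using D \<eta> by linarith
    have "cmod (pair h f) \<le> 1 / (D + \<eta>) * ?a + ?b / (1 / (D + \<eta>))"
      by (rule AM_GM) (use D\<eta> in simp)
    also have "1 / (D + \<eta>) * ?a = D * (D / (D + \<eta>))"
      unfolding D(2) by simp
    also have "D * (D / (D + \<eta>)) \<le> D * 1"
      using D \<eta> D\<eta> by (intro mult_left_mono) auto
    finally have "cmod (pair h f) \<le> D + ?b * (D + \<eta>)"
      by simp
    moreover have "?b * \<eta> \<le> (1 + ?b) * \<eta>"
      using \<eta> by (intro mult_right_mono) auto
    moreover note \<eta>_mult
    moreover have "D + ?b * (D + \<eta>) = (1 + ?b) * D + ?b * \<eta>"
      by (simp add: algebra_simps)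
    ultimately show "cmod (pair h f) \<le> (1 + ?b) * D + e"
      by linarith
  qed
qed

section \<open>Linear combinations in \<open>L2\<close> and the Parseval identity\<close>

lemma L2_add: assumes "f \<in> L2" "h \<in> L2" shows "(\<lambda>x. f x + h x) \<in> L2"
proof -
  have [measurable]: "f \<in> borel_measurable borel" "h \<in> borel_measurable borel"
    using assms by (auto simp: L2_def)
  have "integrable lborel (\<lambda>x. 2 * (cmod (f x))\<^sup>2 + 2 * (cmod (h x))\<^sup>2)"
    using assms by (auto simp: L2_def)
  then have "integrable lborel (\<lambda>x. (cmod (f x + h x))\<^sup>2)"
  proof (rule Bochner_Integration.integrable_bound)
    have "(cmod (f x + h x))\<^sup>2 \<le> 2 * (cmod (f x))\<^sup>2 + 2 * (cmod (h x))\<^sup>2" for x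
    proof -
      have "(cmod (f x + h x))\<^sup>2 \<le> (cmod (f x) + cmod (h x))\<^sup>2"
        by (intro power_mono norm_triangle_ineq) simp
      then show ?thesis
        using sum_squares_bound[of "cmod (f x)" "cmod (h x)"] unfolding power2_sum by linarith
    qed
    then show "AE x in lborel. norm ((cmod (f x + h x))\<^sup>2) \<le> norm (2 * (cmod (f x))\<^sup>2 + 2 * (cmod (h x))\<^sup>2)"
      by (intro always_eventually allI) (simp add: order_trans[OF _ abs_ge_self])
  qed simp
  then show ?thesis by (simp add: L2_def)
qed

lemma L2_scale: assumes "f \<in> L2" shows "(\<lambda>x. c * f x) \<in> L2"
proof -
  have [measurable]: "f \<in> borel_measurable borel" and int: "integrable lborel (\<lambda>x. (cmod (f x))\<^sup>2)"
    using assms by (auto simp: L2_def)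
  have "integrable lborel (\<lambda>x. (cmod c)\<^sup>2 * (cmod (f x))\<^sup>2)"
    using int by (rule integrable_mult_right)
  then have "integrable lborel (\<lambda>x. (cmod (c * f x))\<^sup>2)"
    by (simp only: norm_mult power_mult_distrib)
  then show ?thesis
    unfolding L2_def by simp
qed

lemma L2_sum: "finite K \<Longrightarrow> (\<And>i. i \<in> K \<Longrightarrow> f i \<in> L2) \<Longrightarrow> (\<lambda>x. \<Sum>i\<in>K. f i x) \<in> L2"
proof (induction K rule: finite_induct)
  case empty
  then show ?case by (simp add: L2_def)
next
  case (insert i K)
  then have "(\<lambda>x. f i x + (\<Sum>i\<in>K. f i x)) \<in> L2"
    by (intro L2_add) auto
  then show ?case using insert by simp
qed

text \<open>Only \<open>u\<close> is expanded; pairing with \<open>f\<close> is continuous for the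
  \<open>L2\<close> distance, so the expansion may be paired term by term. Reality of the basis
  identifies its coefficients with bilinear pairings.\<close>

lemma orthonormal_basis_pair_has_sum:
  fixes b :: "'i \<Rightarrow> real^'n::finite \<Rightarrow> complex"
  assumes basis: "orthonormal_basis b I L2" and real: "\<And>i x. cnj (b i x) = b i x"
    and u: "u \<in> L2" and f: "f \<in> L2"
  shows "((\<lambda>i. pair u (b i) * pair (b i) f) has_sum pair u f) I"
proof -
  have b: "b i \<in> L2" if "i \<in> I" for i
    using basis that by (simp add: orthonormal_basis_def)
  define c where "c i = pair u (b i)" for i
  have inner: "L2_inner u (b i) = c i" for i
    by (simp add: L2_inner_def pair_def real c_def)
  define r where "r K x = u x - (\<Sum>i\<in>K. c i * b i x)" for K x
  have lim: "((\<lambda>K. L2_dist u (\<lambda>x. \<Sum>i\<in>K. c i * b i x)) \<longlongrightarrow> 0) (finite_subsets_at_top I)"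
    using basis u unfolding orthonormal_basis_def inner[symmetric] by blast
  let ?F = "1 + (LINT x|lborel. (cmod (f x))\<^sup>2)"
  have "((\<lambda>K. ?F * L2_dist u (\<lambda>x. \<Sum>i\<in>K. c i * b i x)) \<longlongrightarrow> ?F * 0) (finite_subsets_at_top I)"
    by (intro tendsto_mult tendsto_const lim)
  then have lim': "((\<lambda>K. ?F * L2_dist u (\<lambda>x. \<Sum>i\<in>K. c i * b i x)) \<longlongrightarrow> 0) (finite_subsets_at_top I)"
    by simp
  have bound: "norm ((\<Sum>i\<in>K. c i * pair (b i) f) - pair u f) \<le> ?F * L2_dist u (\<lambda>x. \<Sum>i\<in>K. c i * b i x)"
    if K: "finite K" "K \<subseteq> I" for K
  proof -
    have s: "(\<lambda>x. \<Sum>i\<in>K. c i * b i x) \<in> L2"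
      using K b by (intro L2_sum L2_scale) auto
    have "(\<lambda>x. u x + (- 1) * (\<Sum>i\<in>K. c i * b i x)) \<in> L2"
      by (intro L2_add u L2_scale s)
    then have r: "r K \<in> L2"
      by (simp add: r_def[abs_def])
    have "pair (r K) f = (LINT x|lborel. u x * f x - (\<Sum>i\<in>K. c i * b i x) * f x)"
      by (simp add: pair_def r_def algebra_simps)
    also have "\<dots> = pair u f - (LINT x|lborel. (\<Sum>i\<in>K. c i * b i x) * f x)"
      unfolding pair_def by (intro Bochner_Integration.integral_diff L2_mult_integrable u f s)
    also have "(LINT x|lborel. (\<Sum>i\<in>K. c i * b i x) * f x) = (LINT x|lborel. (\<Sum>i\<in>K. c i * (b i x * f x)))"
      by (simp add: sum_distrib_right mult.assoc)
    also have "\<dots> = (\<Sum>i\<in>K. LINT x|lborel. c i * (b i x * f x))"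
      using K b by (intro Bochner_Integration.integral_sum integrable_mult_right L2_mult_integrable f) auto
    also have "\<dots> = (\<Sum>i\<in>K. c i * pair (b i) f)"
      by (simp add: pair_def)
    finally have "norm ((\<Sum>i\<in>K. c i * pair (b i) f) - pair u f) = norm (pair (r K) f)"
      by (simp add: norm_minus_commute)
    also have "\<dots> \<le> ?F * sqrt (LINT x|lborel. (cmod (r K x))\<^sup>2)"
      by (rule norm_pair_le_L2[OF r f])
    finally show ?thesis
      by (simp add: L2_dist_def r_def)
  qed
  have "((\<lambda>K. (\<Sum>i\<in>K. c i * pair (b i) f) - pair u f) \<longlongrightarrow> 0) (finite_subsets_at_top I)"
  proof (rule Lim_null_comparison[OF _ lim'])
    show "\<forall>\<^sub>F K in finite_subsets_at_top I. norm ((\<Sum>i\<in>K. c i * pair (b i) f) - pair u f)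
        \<le> ?F * L2_dist u (\<lambda>x. \<Sum>i\<in>K. c i * b i x)"
      by (rule eventually_finite_subsets_at_top_weakI) (rule bound)
  qed
  then have "((\<lambda>K. \<Sum>i\<in>K. c i * pair (b i) f) \<longlongrightarrow> pair u f) (finite_subsets_at_top I)"
    by (rule LIM_zero_cancel)
  then show ?thesis
    by (simp add: has_sum_def c_def)
qed

lemma schwartz_L2:
  assumes "f \<in> schwartz" shows "f \<in> L2"
proof -
  have rapid: "rapidly_decreasing f" and [measurable]: "f \<in> borel_measurable borel"
    using schwartz_rapidly_decreasing[OF assms, of "[]"] schwartz_measurable[OF assms, of "[]"]
    by (simp_all add: partials_def)
  obtain C where C: "\<And>x. (1 + norm x) ^ 0 * norm (f x) \<le> C"
    using rapidly_decreasing_bound[OF rapid] by blast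
  have "integrable lborel (\<lambda>x. (cmod (f x))\<^sup>2)"
  proof (rule rapidly_decreasing_integrable)
    show "rapidly_decreasing (\<lambda>x. (cmod (f x))\<^sup>2)"
      using C by (intro rapidly_decreasing_dominated[OF rapid, of _ C 0]) (simp add: power2_eq_square mult_right_mono)
  qed simp
  then show ?thesis by (simp add: L2_def)
qed

lemma daubechies_parseval:
  assumes "daubechies_system N \<Psi>" "u \<in> schwartz" "f \<in> schwartz"
  shows "((\<lambda>(l, Q). pair u (adapt (\<Psi> l) Q) * pair (adapt (\<Psi> l) Q) f) has_sum pair u f) wavelet_indices"
proof -
  obtain s w where \<Psi>: "\<Psi> = wavelet_product s w"
    and basis: "orthonormal_basis (\<lambda>(l, Q). adapt (\<Psi> l) Q) wavelet_indices L2"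
    using assms(1) unfolding daubechies_system_def by blast
  have "((\<lambda>i. pair u ((\<lambda>(l, Q). adapt (\<Psi> l) Q) i) * pair ((\<lambda>(l, Q). adapt (\<Psi> l) Q) i) f) has_sum pair u f) wavelet_indices"
    by (rule orthonormal_basis_pair_has_sum[OF basis])
       (auto simp: assms schwartz_L2 \<Psi> adapt_def wavelet_product_def scaleR_conv_of_real)
  then show ?thesis
    by (simp add: case_prod_unfold)
qed

lemma daubechies_pair_bound:
  fixes f :: "real^'n::finite \<Rightarrow> complex"
  assumes \<Psi>: "daubechies_system N \<Psi>" and l: "l \<in> wavelet_types" and f: "f \<in> S_infty"
  defines "\<kappa> \<equiv> real N + real CARD('n) / 2"
  shows "\<exists>C\<ge>0. \<forall>R Q. cmod (pair (adapt f R) (adapt (\<Psi> l) Q)) \<le>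
     C * (1 + side R / side Q) powr (- \<kappa>) * (1 + side Q / side R) powr (- \<kappa>)
       * (1 + norm (corner Q - corner R) / max (side Q) (side R)) powr (- real m)"
proof -
  obtain s w where sw: "s \<in> Cc N" "w \<in> Cc N" and eq: "\<Psi> = wavelet_product s w"
    and moments: "\<And>\<alpha>. (\<Sum>i\<in>UNIV. \<alpha> i) \<le> N \<Longrightarrow> (LINT x|lborel. monomial \<alpha> x *\<^sub>R \<Psi> l x) = 0"
    using \<Psi> l unfolding daubechies_system_def by blast
  define h where "h i = (if l i then w else s)" for i
  have h: "h i \<in> Cc N" for i
    using sw by (simp add: h_def)
  have "\<Psi> l = (\<lambda>x. complex_of_real (\<Prod>i\<in>UNIV. h i (x $ i)))"
    by (simp add: eq wavelet_product_def h_def fun_eq_iff)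
  show ?thesis
    unfolding \<kappa>_def
    by (rule pair_adapt_almost_diagonal_bound[OF f h \<open>\<Psi> l = _\<close> moments, where m = m]) blast+
qed

text \<open>The majorant \<open>b\<close> is separate from \<open>B\<close> so that one wavelet
  estimate serves all matrices obtained by deleting entries.\<close>

lemma almost_diagonal_mono:
  assumes "\<exists>C\<ge>0. \<forall>R Q. b R Q \<le> C * (1 + side R / side Q) powr (- \<kappa>) * (1 + side Q / side R) powr (- \<kappa>)
       * (1 + norm (corner Q - corner R) / max (side Q) (side R)) powr (- D)"
    and "\<And>Q R. cmod (B Q R) \<le> b R Q"
  shows "almost_diagonal D \<kappa> \<kappa> B"
proof -
  obtain C where C: "\<And>R Q. b R Q \<le> C * (1 + side R / side Q) powr (- \<kappa>) * (1 + side Q / side R) powr (- \<kappa>)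
       * (1 + norm (corner Q - corner R) / max (side Q) (side R)) powr (- D)"
    using assms(1) by blast
  then show ?thesis
    unfolding almost_diagonal_def using order_trans[OF assms(2) C] by blast
qed

text \<open>The bound is symmetric in the two cubes because both exponents equal
  \<open>\<kappa>\<close>, so transposition is free. The maximum with 0 admits zero entries without
  a sign condition on \<open>b\<close>.\<close>

lemma almost_diagonal_mono_transpose:
  assumes "\<exists>C\<ge>0. \<forall>R Q. b R Q \<le> C * (1 + side R / side Q) powr (- \<kappa>) * (1 + side Q / side R) powr (- \<kappa>)
       * (1 + norm (corner Q - corner R) / max (side Q) (side R)) powr (- D)"
    and "\<And>R Q. cmod (B R Q) \<le> max 0 (b R Q)"
  shows "almost_diagonal D \<kappa> \<kappa> B"
proof -
  obtain C where "0 \<le> C" and C: "\<And>R Q. b R Q \<le> C * (1 + side R / side Q) powr (- \<kappa>) * (1 + side Q / side R) powr (- \<kappa>)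
       * (1 + norm (corner Q - corner R) / max (side Q) (side R)) powr (- D)"
    using assms(1) by blast
  have "cmod (B R Q) \<le> C * (1 + side Q / side R) powr (- \<kappa>) * (1 + side R / side Q) powr (- \<kappa>)
       * (1 + norm (corner R - corner Q) / max (side R) (side Q)) powr (- D)" for R Q
  proof -
    have "max 0 (b R Q) \<le> C * (1 + side R / side Q) powr (- \<kappa>) * (1 + side Q / side R) powr (- \<kappa>)
       * (1 + norm (corner Q - corner R) / max (side Q) (side R)) powr (- D)"
      using C[of R Q] \<open>0 \<le> C\<close> by simp
    from order_trans[OF assms(2) this] show ?thesis
      by (simp add: norm_minus_commute max.commute mult_ac)
  qed
  then show ?thesis
    unfolding almost_diagonal_def by blast
qed

section \<open>Wavelet expansions in discretizable spaces\<close>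

lemma infsum_scaleC_right:
  fixes y :: "'i \<Rightarrow> 'x::complex_banach"
  assumes "y summable_on I"
  shows "(\<Sum>\<^sub>\<infinity>i\<in>I. c *\<^sub>C y i) = c *\<^sub>C (\<Sum>\<^sub>\<infinity>i\<in>I. y i)"
  by (rule infsumI[OF has_sum_bounded_linear[OF bounded_linear_scaleC_right has_sum_infsum[OF assms]]])

lemma discretizable_LP_pair:
  assumes "discretizable d e f A nA a na" "LP_pair \<phi> \<psi>"
  shows "\<exists>C. \<forall>g\<in>A. analysis_op \<phi> g \<in> a \<and> na (analysis_op \<phi> g) \<le> C * nA g"
    and "\<exists>C. \<forall>t\<in>a. synthesis_op \<psi> t \<in> A \<and> nA (synthesis_op \<psi> t) \<le> C * na t"
    and "g \<in> A \<Longrightarrow> synthesis_op \<psi> (analysis_op \<phi> g) = g"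
proof -
  have "\<forall>\<phi> \<psi>. LP_pair \<phi> \<psi> \<longrightarrow>
        (\<exists>C. \<forall>g\<in>A. analysis_op \<phi> g \<in> a \<and> na (analysis_op \<phi> g) \<le> C * nA g) \<and>
        (\<exists>C. \<forall>t\<in>a. synthesis_op \<psi> t \<in> A \<and> nA (synthesis_op \<psi> t) \<le> C * na t) \<and>
        (\<forall>g\<in>A. synthesis_op \<psi> (analysis_op \<phi> g) = g)"
    using assms(1) by (simp add: discretizable_def)
  note this[rule_format, OF assms(2)]
  then show "\<exists>C. \<forall>g\<in>A. analysis_op \<phi> g \<in> a \<and> na (analysis_op \<phi> g) \<le> C * nA g"
    "\<exists>C. \<forall>t\<in>a. synthesis_op \<psi> t \<in> A \<and> nA (synthesis_op \<psi> t) \<le> C * na t"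
    "g \<in> A \<Longrightarrow> synthesis_op \<psi> (analysis_op \<phi> g) = g"
    by simp_all
qed

lemma discretizable_almost_diagonal:
  fixes a :: "('n::finite cube \<Rightarrow> 'x::complex_banach) set"
    and B :: "'n cube \<Rightarrow> 'n cube \<Rightarrow> complex"
    and t :: "'n cube \<Rightarrow> 'x"
  assumes "discretizable d e f A nA a na" "d < D" "e < E" "f < F" "almost_diagonal D E F B"
  shows "t \<in> a \<Longrightarrow> (\<lambda>R. B Q R *\<^sub>C t R) abs_summable_on UNIV"
    and "t \<in> a \<Longrightarrow> matrix_op B t \<in> a"
    and "\<exists>C\<ge>0. \<forall>t\<in>a. na (matrix_op B t) \<le> C * na t"
proof -
  have *: "(\<forall>t\<in>a. \<forall>Q. (\<lambda>R. B Q R *\<^sub>C t R) abs_summable_on UNIV) \<and>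
        (\<exists>C. \<forall>t\<in>a. matrix_op B t \<in> a \<and> na (matrix_op B t) \<le> C * na t)"
    using assms unfolding discretizable_def by blast
  then show "t \<in> a \<Longrightarrow> (\<lambda>R. B Q R *\<^sub>C t R) abs_summable_on UNIV" "t \<in> a \<Longrightarrow> matrix_op B t \<in> a"
    by blast+
  obtain C where C: "\<And>t. t \<in> a \<Longrightarrow> na (matrix_op B t) \<le> C * na t"
    using * by blast
  have "0 \<le> na t" if "t \<in> a" for t
    using assms(1) that unfolding discretizable_def quasi_normed_space_def by blast
  then have "na (matrix_op B t) \<le> \<bar>C\<bar> * na t" if "t \<in> a" for t
    using C[OF that] that by (meson abs_ge_self mult_right_mono order_trans)
  then show "\<exists>C\<ge>0. \<forall>t\<in>a. na (matrix_op B t) \<le> C * na t"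
    by (intro exI[of _ "\<bar>C\<bar>"]) auto
qed

lemma finite_wavelet_types: "finite (wavelet_types :: ('n::finite \<Rightarrow> bool) set)"
  by (simp add: wavelet_types_def)

lemma wavelet_reconstruction:
  fixes A :: "('n::finite, 'x::complex_banach) distr set" and \<kappa> :: real
  assumes A: "discretizable d e f A nA a na" and \<kappa>: "e < \<kappa>" "f < \<kappa>" "\<kappa> = real N + real CARD('n) / 2"
    and \<Psi>: "daubechies_system N \<Psi>" and LP: "LP_pair \<phi> \<psi>" and g: "g \<in> A" and h: "h \<in> S_infty"
  shows "((\<lambda>(l, Q). pair (adapt (\<Psi> l) Q) h *\<^sub>C distr_pair \<phi> \<psi> g (adapt (\<Psi> l) Q)) has_sum g h) wavelet_indices"
proof -
  define t where "t = analysis_op \<phi> g"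
  have t: "t \<in> a" and syn: "synthesis_op \<psi> t = g"
    using discretizable_LP_pair[OF A LP] g unfolding t_def by metis+
  obtain m :: nat where m: "d < real m"
    using reals_Archimedean2 by blast
  have \<psi>: "\<psi> \<in> S_infty"
    using LP littlewood_paley_S_infty by (auto simp: LP_pair_def)
  have schwartz: "\<psi> \<in> schwartz" "h \<in> schwartz"
    using \<psi> h by (auto simp: S_infty_def)
  note ad = discretizable_almost_diagonal[OF A m \<kappa>(1,2)]
  define b where "b l Q R = pair (adapt \<psi> R) (adapt (\<Psi> l) Q)" for l Q R
  define c where "c l Q = pair (adapt (\<Psi> l) Q) h" for l Q
  define x where "x p R = (case p of (l, Q) \<Rightarrow> (c l Q * b l Q R) *\<^sub>C t R)" for p R
  have b_ad: "almost_diagonal (real m) \<kappa> \<kappa> (\<lambda>Q R. if P Q R then b l Q R else 0)"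
    if "l \<in> wavelet_types" for l P
    using daubechies_pair_bound[OF \<Psi> that \<psi>, of m] unfolding \<kappa>(3)
    by (rule almost_diagonal_mono) (simp add: b_def)
  \<comment> \<open>Since \<open>h\<close> is \<open>adapt h (0, 0)\<close>, its coefficients are
    placed in the row of the unit cube, and all other rows are zero.\<close>
  have c_ad: "almost_diagonal (real m) \<kappa> \<kappa> (\<lambda>R Q. if R = (0, 0) then c l Q else 0)"
    if "l \<in> wavelet_types" for l
    using daubechies_pair_bound[OF \<Psi> that h, of m] unfolding \<kappa>(3)
    by (rule almost_diagonal_mono_transpose) (auto simp: c_def adapt_unit_cube pair_commute[of h])
  have coeff: "distr_pair \<phi> \<psi> g (adapt (\<Psi> l) Q) = matrix_op (b l) t Q" for l Q
    by (simp add: distr_pair_def matrix_op_def b_def t_def analysis_op_def)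
  have row: "(\<lambda>R. b l Q R *\<^sub>C t R) abs_summable_on UNIV" if "l \<in> wavelet_types" for l Q
    using ad(1)[OF b_ad[OF that, of "\<lambda>_ _. True"] t] by simp
  have x_eq: "x (l, Q) R = c l Q *\<^sub>C (b l Q R *\<^sub>C t R)" for l Q R
    by (simp add: x_def scaleC_scaleC)
  have x_row: "x p abs_summable_on UNIV" if "p \<in> wavelet_indices" for p
  proof -
    obtain l Q where p: "p = (l, Q)" "l \<in> wavelet_types"
      using \<open>p \<in> wavelet_indices\<close> unfolding wavelet_indices_def by blast
    have "(\<lambda>R. cmod (c l Q) * norm (b l Q R *\<^sub>C t R)) summable_on UNIV"
      by (intro summable_on_cmult_right row p)
    then show ?thesis
      by (simp add: p x_eq norm_scaleC)
  qed
  have "(\<lambda>(p, R). x p R) summable_on wavelet_indices \<times> UNIV"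
  proof (rule summable_on_if_masked_iterated_sums[OF x_row])
    fix S :: "((('n \<Rightarrow> bool) \<times> 'n cube) \<times> 'n cube) set"
    define y where "y p = (\<Sum>\<^sub>\<infinity>R. if (p, R) \<in> S then x p R else 0)" for p
    let ?B = "\<lambda>l Q R. if ((l, Q), R) \<in> S then b l Q R else 0"
    have y: "y (l, Q) = c l Q *\<^sub>C matrix_op (?B l) t Q" if l: "l \<in> wavelet_types" for l Q
    proof -
      have "(\<lambda>R. ?B l Q R *\<^sub>C t R) summable_on UNIV"
        using ad(1)[OF b_ad[OF l, of "\<lambda>Q R. ((l, Q), R) \<in> S"] t] by (rule abs_summable_summable)
      then have "(\<Sum>\<^sub>\<infinity>R. c l Q *\<^sub>C (?B l Q R *\<^sub>C t R)) = c l Q *\<^sub>C matrix_op (?B l) t Q"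
        unfolding matrix_op_def by (rule infsum_scaleC_right)
      moreover have "c l Q *\<^sub>C (?B l Q R *\<^sub>C t R) = (if ((l, Q), R) \<in> S then x (l, Q) R else 0)" for R
        by (simp add: x_eq scaleC_scaleC)
      ultimately show ?thesis
        by (simp add: y_def)
    qed
    have "(\<lambda>Q. y (l, Q)) abs_summable_on UNIV" if l: "l \<in> wavelet_types" for l
    proof -
      \<comment> \<open>The masked matrix sends \<open>t\<close> into \<open>a\<close>. Absolute
        convergence in row (0, 0) of the matrix of \<open>c_ad\<close>, applied to this new
        sequence, is that of the masked outer sum.\<close>
      have "matrix_op (?B l) t \<in> a"
        by (rule ad(2)[OF b_ad[OF l] t])
      from ad(1)[OF c_ad[OF l] this, of "(0, 0)"] show ?thesis
        by (simp add: y[OF l])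
    qed
    then have "y abs_summable_on Sigma wavelet_types (\<lambda>_. UNIV)"
      using finite_wavelet_types by (intro iffD2[OF Infinite_Sum.abs_summable_on_Sigma_iff]) simp
    then show "(\<lambda>p. \<Sum>\<^sub>\<infinity>R. if (p, R) \<in> S then x p R else 0) abs_summable_on wavelet_indices"
      by (simp add: y_def wavelet_indices_def)
  qed
  \<comment> \<open>Unconditional summability over the product set permits exchanging the sums. In
    the new order the inner sums are Parseval identities for \<open>adapt \<psi> R\<close> and
    \<open>h\<close>, and the outer sum is the synthesis of \<open>t\<close>.\<close>
  note sums = this
  have "(\<Sum>\<^sub>\<infinity>p\<in>wavelet_indices. \<Sum>\<^sub>\<infinity>R. x p R) = (\<Sum>\<^sub>\<infinity>R. \<Sum>\<^sub>\<infinity>p\<in>wavelet_indices. x p R)"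
    by (rule infsum_swap_banach[OF sums])
  also have "\<dots> = (\<Sum>\<^sub>\<infinity>R. distr_of (adapt \<psi> R) (t R) h)"
  proof (rule infsum_cong)
    fix R
    have "((\<lambda>(l, Q). b l Q R * c l Q) has_sum pair (adapt \<psi> R) h) wavelet_indices"
      unfolding b_def c_def by (rule daubechies_parseval[OF \<Psi> schwartz_adapt[OF schwartz(1)] schwartz(2)])
    from has_sum_bounded_linear[OF bounded_linear_scaleC_left this, of "t R"]
    have "((\<lambda>p. x p R) has_sum pair (adapt \<psi> R) h *\<^sub>C t R) wavelet_indices"
      by (simp add: x_def case_prod_unfold mult.commute)
    then show "(\<Sum>\<^sub>\<infinity>p\<in>wavelet_indices. x p R) = distr_of (adapt \<psi> R) (t R) h"
      using h by (simp add: infsumI distr_of_def)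
  qed
  also have "\<dots> = g h"
    unfolding syn[symmetric] by (simp add: synthesis_op_def)
  finally have value_eq: "(\<Sum>\<^sub>\<infinity>p\<in>wavelet_indices. \<Sum>\<^sub>\<infinity>R. x p R) = g h" .
  have "((\<lambda>p. \<Sum>\<^sub>\<infinity>R. x p R) has_sum g h) wavelet_indices"
    using has_sum_infsum[OF summable_on_Sigma_banach[OF sums]] by (simp add: value_eq)
  moreover have "(\<Sum>\<^sub>\<infinity>R. x (l, Q) R) = c l Q *\<^sub>C matrix_op (b l) t Q" if "l \<in> wavelet_types" for l Q
    unfolding x_eq matrix_op_def by (rule infsum_scaleC_right[OF abs_summable_summable[OF row[OF that]]])
  then have "(\<Sum>\<^sub>\<infinity>R. x p R) = (case p of (l, Q) \<Rightarrow> c l Q *\<^sub>C matrix_op (b l) t Q)" if "p \<in> wavelet_indices" for p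
    using that by (auto simp: wavelet_indices_def)
  ultimately show ?thesis
    by (simp add: coeff c_def cong: has_sum_cong)
qed

theorem theorem20p2:
  fixes d e f :: real
    and A :: "('n::finite, 'x::complex_banach) distr set"
    and nA :: "('n, 'x) distr \<Rightarrow> real"
    and a :: "('n cube \<Rightarrow> 'x) set"
    and na :: "('n cube \<Rightarrow> 'x) \<Rightarrow> real"
    and N :: nat
    and \<Psi> :: "('n \<Rightarrow> bool) \<Rightarrow> real^'n \<Rightarrow> complex"
    and \<phi> \<psi> :: "real^'n \<Rightarrow> complex"
  assumes "discretizable d e f A nA a na"
    and "real N > max e f - real CARD('n) / 2"
    and "daubechies_system N \<Psi>"
    and "LP_pair \<phi> \<psi>"
  shows "(\<forall>g\<in>A. distr_has_sum
             (\<lambda>(l, Q). distr_of (adapt (\<Psi> l) Q) (distr_pair \<phi> \<psi> g (adapt (\<Psi> l) Q)))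
             wavelet_indices g) \<and>
         (\<exists>c C. 0 < c \<and> 0 < C \<and>
            (\<forall>g\<in>A. (\<forall>l\<in>wavelet_types. (\<lambda>Q. distr_pair \<phi> \<psi> g (adapt (\<Psi> l) Q)) \<in> a) \<and>
                   c * (\<Sum>l\<in>wavelet_types. na (\<lambda>Q. distr_pair \<phi> \<psi> g (adapt (\<Psi> l) Q))) \<le> nA g \<and>
                   nA g \<le> C * (\<Sum>l\<in>wavelet_types. na (\<lambda>Q. distr_pair \<phi> \<psi> g (adapt (\<Psi> l) Q)))))"
proof -
  define \<kappa> where "\<kappa> = real N + real CARD('n) / 2"
  have \<kappa>: "e < \<kappa>" "f < \<kappa>"
    using assms(2) unfolding \<kappa>_def by linarith+
  obtain m :: nat where m: "d < real m"
    using reals_Archimedean2 by blast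
  have LP: "\<phi> \<in> S_infty" "\<psi> \<in> S_infty" "\<And>R. adapt \<phi> R \<in> S_infty"
    using assms(4) littlewood_paley_S_infty littlewood_paley_adapt_S_infty by (auto simp: LP_pair_def)
  let ?T = "wavelet_types :: ('n \<Rightarrow> bool) set"
  define u where "u g l = (\<lambda>Q. distr_pair \<phi> \<psi> g (adapt (\<Psi> l) Q))" for g :: "('n, 'x) distr" and l
  have rec: "((\<lambda>(l, Q). pair (adapt (\<Psi> l) Q) h *\<^sub>C u g l Q) has_sum g h) wavelet_indices"
    if "g \<in> A" "h \<in> S_infty" for g h
    unfolding u_def by (rule wavelet_reconstruction[OF assms(1) \<kappa> \<kappa>_def assms(3,4) that])
  note ad = discretizable_almost_diagonal[OF assms(1) m \<kappa>]
  have nA: "0 \<le> nA g" if "g \<in> A" for g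
  proof -
    have "quasi_normed_space A nA"
      using assms(1) by (simp add: discretizable_def)
    then have "\<forall>v\<in>A. 0 \<le> nA v"
      by (simp add: quasi_normed_space_def)
    then show ?thesis using that ..
  qed
  have a: "quasi_normed_space a na"
    using assms(1) by (simp add: discretizable_def)
  then have na: "0 \<le> na t" if "t \<in> a" for t
    using that by (simp add: quasi_normed_space_def)
  note disc = discretizable_LP_pair[OF assms(1,4)]
  obtain Ca where Ca: "\<And>g. g \<in> A \<Longrightarrow> analysis_op \<phi> g \<in> a" "\<And>g. g \<in> A \<Longrightarrow> na (analysis_op \<phi> g) \<le> Ca * nA g"
    using disc(1) by metis
  obtain Cs where Cs: "\<And>t. t \<in> a \<Longrightarrow> nA (synthesis_op \<psi> t) \<le> Cs * na t"
    using disc(2) by metis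
  note inv = disc(3)

  define B where "B l Q R = pair (adapt \<psi> R) (adapt (\<Psi> l) Q)" for l Q R
  have B: "almost_diagonal (real m) \<kappa> \<kappa> (B l)" if "l \<in> ?T" for l
    using daubechies_pair_bound[OF assms(3) that LP(2), of m] unfolding \<kappa>_def
    by (rule almost_diagonal_mono) (simp add: B_def)
  have u_eq: "u g l = matrix_op (B l) (analysis_op \<phi> g)" for g l
    by (simp add: u_def fun_eq_iff distr_pair_def matrix_op_def B_def analysis_op_def)
  have u_in: "u g l \<in> a" if "g \<in> A" "l \<in> ?T" for g l
    unfolding u_eq using ad(2)[OF B[OF that(2)]] Ca(1)[OF that(1)] by blast
  have "\<exists>C\<ge>0. \<forall>g\<in>A. na (u g l) \<le> C * nA g" if l: "l \<in> ?T" for l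
  proof -
    obtain C where C: "0 \<le> C" "\<And>t. t \<in> a \<Longrightarrow> na (matrix_op (B l) t) \<le> C * na t"
      using ad(3)[OF B[OF l]] by blast
    have "na (u g l) \<le> (C * \<bar>Ca\<bar>) * nA g" if "g \<in> A" for g
    proof -
      have "na (u g l) \<le> C * na (analysis_op \<phi> g)"
        unfolding u_eq using C(2) Ca(1)[OF that] by blast
      also have "\<dots> \<le> C * (\<bar>Ca\<bar> * nA g)"
        using Ca(2)[OF that] nA[OF that] C(1)
        by (intro mult_left_mono) (meson abs_ge_self mult_right_mono order_trans)
      finally show ?thesis by (simp add: mult.assoc)
    qed
    then show ?thesis
      using C(1) by (intro exI[of _ "C * \<bar>Ca\<bar>"]) auto
  qed
  then obtain M where M: "\<And>l. l \<in> ?T \<Longrightarrow> 0 \<le> M l" "\<And>l g. l \<in> ?T \<Longrightarrow> g \<in> A \<Longrightarrow> na (u g l) \<le> M l * nA g"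
    by metis
  \<comment> \<open>Each \<open>M l\<close> is the bound of a wavelet matrix times that of the
    analysis operator. The summand 1 keeps \<open>c\<close> meaningful even if all
    \<open>M l\<close> are 0.\<close>
  define c where "c = 1 / (1 + (\<Sum>l\<in>?T. M l))"
  have M_sum: "0 \<le> (\<Sum>l\<in>?T. M l)"
    by (intro sum_nonneg M)
  then have c: "0 < c"
    by (simp add: c_def)
  have lower: "c * (\<Sum>l\<in>?T. na (u g l)) \<le> nA g" if g: "g \<in> A" for g
  proof -
    have "(\<Sum>l\<in>?T. na (u g l)) \<le> (\<Sum>l\<in>?T. M l) * nA g"
      unfolding sum_distrib_right by (intro sum_mono M(2) g)
    also have "\<dots> \<le> (1 + (\<Sum>l\<in>?T. M l)) * nA g"
      using nA[OF g] by (intro mult_right_mono) auto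
    finally show ?thesis
      unfolding c_def using M_sum by (simp add: divide_le_eq mult.commute)
  qed

  define B' where "B' l R Q = pair (adapt (\<Psi> l) Q) (adapt \<phi> R)" for l R Q
  have B': "almost_diagonal (real m) \<kappa> \<kappa> (B' l)" if "l \<in> ?T" for l
    using daubechies_pair_bound[OF assms(3) that LP(1), of m] unfolding \<kappa>_def
    by (rule almost_diagonal_mono_transpose) (simp add: B'_def pair_commute[of "adapt (\<Psi> l) _"])
  \<comment> \<open>There are finitely many wavelet types, so the unconditional expansion tested
    against \<open>adapt \<phi> R\<close> splits into one matrix product per type.\<close>
  have expand: "analysis_op \<phi> g = (\<lambda>R. \<Sum>l\<in>?T. matrix_op (B' l) (u g l) R)" if g: "g \<in> A" for g
  proof
    fix R
    have sum: "((\<lambda>(l, Q). B' l R Q *\<^sub>C u g l Q) has_sum g (adapt \<phi> R)) (Sigma ?T (\<lambda>_. UNIV))"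
      using rec[OF g LP(3), of R] by (simp add: B'_def wavelet_indices_def)
    have "(\<Sum>\<^sub>\<infinity>l\<in>?T. \<Sum>\<^sub>\<infinity>Q. B' l R Q *\<^sub>C u g l Q) = (\<Sum>\<^sub>\<infinity>(l, Q)\<in>Sigma ?T (\<lambda>_. UNIV). B' l R Q *\<^sub>C u g l Q)"
      by (rule infsum_Sigma'_banach[OF has_sum_imp_summable[OF sum]])
    also have "\<dots> = g (adapt \<phi> R)"
      by (rule infsumI[OF sum])
    finally show "analysis_op \<phi> g R = (\<Sum>l\<in>?T. matrix_op (B' l) (u g l) R)"
      using finite_wavelet_types by (simp add: analysis_op_def matrix_op_def)
  qed
  obtain K where K: "0 \<le> K" "\<And>v. (\<And>l. l \<in> ?T \<Longrightarrow> v l \<in> a) \<Longrightarrow> na (\<lambda>R. \<Sum>l\<in>?T. v l R) \<le> K * (\<Sum>l\<in>?T. na (v l))"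
    using quasi_normed_space_sum[OF a finite_wavelet_types] by blast
  have "\<exists>C\<ge>0. \<forall>t\<in>a. na (matrix_op (B' l) t) \<le> C * na t" if "l \<in> ?T" for l
    by (rule ad(3)[OF B'[OF that]])
  then obtain M' where M': "\<And>l. l \<in> ?T \<Longrightarrow> 0 \<le> M' l" "\<And>l t. l \<in> ?T \<Longrightarrow> t \<in> a \<Longrightarrow> na (matrix_op (B' l) t) \<le> M' l * na t"
    by metis
  \<comment> \<open>\<open>Cs\<close> bounds the synthesis operator, \<open>K\<close> is the price
    of summing over the types in a quasi-norm, and \<open>M' l\<close> bounds the transposed
    matrices; the summand 1 ensures positivity.\<close>
  define C where "C = 1 + \<bar>Cs\<bar> * (K * (\<Sum>l\<in>?T. M' l))"
  have M'_sum: "0 \<le> (\<Sum>l\<in>?T. M' l)"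
    by (intro sum_nonneg M')
  then have C: "0 < C"
    using K(1) by (simp add: C_def add_pos_nonneg)
  have upper: "nA g \<le> C * (\<Sum>l\<in>?T. na (u g l))" if g: "g \<in> A" for g
  proof -
    let ?s = "\<Sum>l\<in>?T. na (u g l)"
    have s: "0 \<le> ?s"
      using u_in[OF g] na by (intro sum_nonneg) auto
    have "na (analysis_op \<phi> g) \<le> K * (\<Sum>l\<in>?T. na (matrix_op (B' l) (u g l)))"
      unfolding expand[OF g] using ad(2)[OF B'] u_in[OF g] by (intro K(2)) auto
    also have "\<dots> \<le> K * (\<Sum>l\<in>?T. M' l * ?s)"
    proof (intro mult_left_mono sum_mono K(1))
      fix l assume l: "l \<in> ?T"
      have "na (matrix_op (B' l) (u g l)) \<le> M' l * na (u g l)"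
        by (rule M'(2)[OF l u_in[OF g l]])
      \<comment> \<open>Enlarging each norm to the full sum lets the constants be factored
        out.\<close>
      also have "\<dots> \<le> M' l * ?s"
        using l u_in[OF g] na M'(1) finite_wavelet_types by (intro mult_left_mono member_le_sum) auto
      finally show "na (matrix_op (B' l) (u g l)) \<le> M' l * ?s" .
    qed
    finally have "na (analysis_op \<phi> g) \<le> K * (\<Sum>l\<in>?T. M' l) * ?s"
      by (simp add: sum_distrib_right mult.assoc)
    then have "\<bar>Cs\<bar> * na (analysis_op \<phi> g) \<le> \<bar>Cs\<bar> * (K * (\<Sum>l\<in>?T. M' l) * ?s)"
      by (intro mult_left_mono) auto
    moreover have "nA g \<le> Cs * na (analysis_op \<phi> g)"
      using Cs[OF Ca(1)[OF g]] inv[OF g] by simp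
    moreover have "Cs * na (analysis_op \<phi> g) \<le> \<bar>Cs\<bar> * na (analysis_op \<phi> g)"
      using na[OF Ca(1)[OF g]] by (intro mult_right_mono) auto
    moreover have "C * ?s = ?s + \<bar>Cs\<bar> * (K * (\<Sum>l\<in>?T. M' l) * ?s)"
      by (simp add: C_def algebra_simps)
    ultimately show ?thesis
      using s by linarith
  qed

  have "distr_has_sum (\<lambda>(l, Q). distr_of (adapt (\<Psi> l) Q) (u g l Q)) wavelet_indices g" if "g \<in> A" for g
    unfolding distr_has_sum_def
    using rec[OF that] by (simp add: distr_of_def case_prod_unfold)
  then show ?thesis
    using c C lower upper u_in unfolding u_def by blast
qed

end
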